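(* For any QCSP $\mathcal{C}$ on $d$-dimensional qudits there is another QCSP $\mathcal{C}'$ on qubits, and $\mathsf{AC}^0$ circuits $f$ and $g$, such that $f$ reduces $\mathcal{C}$ to $\mathcal{C}'$ and $g$ reduces $\mathcal{C}'$ to $\mathcal{C}$. If $\mathcal{C}$ is $k$-local, then $\mathcal{C}'$ can be chosen to be $4\cdot 2^{\lceil\log_2(\lceil\log_2(d)\rceil)\rceil}\,k$-local.
   Context: A (strong) quantum constraint satisfaction problem (QCSP) on $d$-dimensional qudits ($d$-qudits) is given by a finite set of clause types, each a positive semidefinite operator (e.g. a projector) acting on at most $k$ qudits of dimension $d$ for a constant $k$ ($k$-local). An instance is a number $n$ of qudits and a list of $\mathrm{poly}(n)$ clauses, each given by a clause type together with an ordered list of the (integer-numbered) qudits it acts on; as a string, it is the list of these integers. The problem is the promise problem of deciding whether there is an $n$-qudit state annihilated by all the clauses (YES, "satisfiable"/frustration-free), or every state $|\psi\rangle$ satisfies $\sum_i\langle\psi|H_i|\psi\rangle\ge1/\mathrm{poly}(n)$ (NO, "unsatisfiable"). "Reduces" means many-one reduction of instances: satisfiable instances are mapped to satisfiable ones and unsatisfiable instances to unsatisfiable ones. *)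

theory Defs
  imports
    "HOL-Computational_Algebra.Polynomial"
    "Jordan_Normal_Form.Schur_Decomposition"
begin

section \<open>Operators and states on qudits\<close>

text \<open>
  The space of \<open>n\<close> qudits of dimension \<open>d\<close> is \<open>carrier_vec (d ^ n)\<close>. The basis state with index \<open>i\<close> has
  qudit \<open>q\<close> in the state given by the base-\<open>d\<close> digit of \<open>i\<close> at position \<open>q\<close>; qudit 0 is the least
  significant one.
\<close>

definition digit :: "nat \<Rightarrow> nat \<Rightarrow> nat \<Rightarrow> nat" where
  "digit d i q = (i div d ^ q) mod d"

definition restrict_index :: "nat \<Rightarrow> nat list \<Rightarrow> nat \<Rightarrow> nat" where
  "restrict_index d qs i = (\<Sum>l<length qs. digit d i (qs ! l) * d ^ l)"

text \<open>
  The operator \<open>M\<close> on \<open>length qs\<close> qudits, applied to the qudits listed in \<open>qs\<close> (qudit \<open>l\<close> of \<open>M\<close> being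
  qudit \<open>qs ! l\<close> of the system), tensored with the identity on all other qudits.
\<close>

definition act_on :: "nat \<Rightarrow> nat \<Rightarrow> complex mat \<Rightarrow> nat list \<Rightarrow> complex mat" where
  "act_on d n M qs = mat (d ^ n) (d ^ n) (\<lambda>(i, j).
     if \<forall>q<n. q \<notin> set qs \<longrightarrow> digit d i q = digit d j q
     then M $$ (restrict_index d qs i, restrict_index d qs j) else 0)"

definition states :: "nat \<Rightarrow> nat \<Rightarrow> complex vec set" where
  "states d n = {\<psi> \<in> carrier_vec (d ^ n). \<psi> \<bullet>c \<psi> = 1}"

definition pos_semidef :: "nat \<Rightarrow> complex mat \<Rightarrow> bool" where
  "pos_semidef m M \<longleftrightarrow> M \<in> carrier_mat m m \<and> mat_adjoint M = M \<and>
     (\<forall>v \<in> carrier_vec m. 0 \<le> Re ((M *\<^sub>v v) \<bullet>c v))"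

section \<open>Quantum constraint satisfaction problems\<close>

text \<open>
  A clause type is an arity together with an operator on that many qudits. The two polynomials
  are those of the promise: the number of clauses of an instance on \<open>n\<close> qudits is at most
  \<open>poly count_poly n\<close>, and unsatisfiable means energy at least \<open>1 / poly gap_poly n\<close>.
\<close>

record qcsp =
  qdim :: nat
  ctypes :: "(nat \<times> complex mat) list"
  count_poly :: "nat poly"
  gap_poly :: "nat poly"

definition is_qcsp :: "qcsp \<Rightarrow> bool" where
  "is_qcsp C \<longleftrightarrow> 0 < qdim C \<and> gap_poly C \<noteq> 0 \<and>
     (\<forall>(a, M) \<in> set (ctypes C). pos_semidef (qdim C ^ a) M)"

definition is_local :: "nat \<Rightarrow> qcsp \<Rightarrow> bool" where
  "is_local k C \<longleftrightarrow> (\<forall>(a, M) \<in> set (ctypes C). a \<le> k)"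

text \<open>A clause is the number of its type and the list of qudits it acts on.\<close>

type_synonym clause = "nat \<times> nat list"
type_synonym instance_data = "nat \<times> clause list"

definition is_clause :: "qcsp \<Rightarrow> nat \<Rightarrow> clause \<Rightarrow> bool" where
  "is_clause C n = (\<lambda>(t, qs). t < length (ctypes C) \<and> length qs = fst (ctypes C ! t) \<and>
     distinct qs \<and> set qs \<subseteq> {..<n})"

definition is_instance :: "qcsp \<Rightarrow> instance_data \<Rightarrow> bool" where
  "is_instance C = (\<lambda>(n, cs). 0 < n \<and> length cs \<le> poly (count_poly C) n \<and>
     (\<forall>c \<in> set cs. is_clause C n c))"

definition clause_op :: "qcsp \<Rightarrow> nat \<Rightarrow> clause \<Rightarrow> complex mat" where
  "clause_op C n = (\<lambda>(t, qs). act_on (qdim C) n (snd (ctypes C ! t)) qs)"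

definition satisfiable :: "qcsp \<Rightarrow> instance_data \<Rightarrow> bool" where
  "satisfiable C = (\<lambda>(n, cs). \<exists>\<psi> \<in> states (qdim C) n.
     \<forall>c \<in> set cs. clause_op C n c *\<^sub>v \<psi> = 0\<^sub>v (qdim C ^ n))"

definition unsatisfiable :: "qcsp \<Rightarrow> instance_data \<Rightarrow> bool" where
  "unsatisfiable C = (\<lambda>(n, cs). \<forall>\<psi> \<in> states (qdim C) n.
     (\<Sum>c\<leftarrow>cs. Re ((clause_op C n c *\<^sub>v \<psi>) \<bullet>c \<psi>)) \<ge> 1 / real (poly (gap_poly C) n))"

section \<open>Instances as strings\<close>

text \<open>
  An instance is written as the integers \<open>n\<close>; \<open>t, q\<^sub>1, \<dots>, q\<^sub>a\<close>; \<open>\<dots>\<close> in binary (most significant bit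
  first), each integer terminated by \<open>Comma\<close>, the number \<open>n\<close> and each clause terminated by \<open>Semi\<close>.
  The length of the output of a circuit is determined by the length of its input, so padding has
  to be possible: leading zeros and superfluous \<open>Semi\<close> symbols are permitted.
\<close>

datatype symbol = Bit bool | Comma | Semi

fun symbol_bits :: "symbol \<Rightarrow> bool list" where
  "symbol_bits (Bit b) = [False, b]"
| "symbol_bits Comma = [True, False]"
| "symbol_bits Semi = [True, True]"

definition bits_value :: "bool list \<Rightarrow> nat" where
  "bits_value bs = horner_sum of_bool 2 (rev bs)"

inductive enc_nats :: "nat list \<Rightarrow> symbol list \<Rightarrow> bool" where
  "enc_nats [] []"
| "bs \<noteq> [] \<Longrightarrow> enc_nats ms w \<Longrightarrow> enc_nats (bits_value bs # ms) (map Bit bs @ Comma # w)"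

inductive enc_clauses :: "clause list \<Rightarrow> symbol list \<Rightarrow> bool" where
  "enc_clauses [] []"
| "enc_clauses cs w \<Longrightarrow> enc_clauses cs (Semi # w)"
| "enc_nats (t # qs) u \<Longrightarrow> enc_clauses cs w \<Longrightarrow> enc_clauses ((t, qs) # cs) (u @ Semi # w)"

definition encodes :: "bool list \<Rightarrow> instance_data \<Rightarrow> bool" where
  "encodes x = (\<lambda>(n, cs). \<exists>u w. enc_nats [n] u \<and> enc_clauses cs w \<and>
     x = concat (map symbol_bits (u @ Semi # w)))"

definition yes_strings :: "qcsp \<Rightarrow> bool list set" where
  "yes_strings C = {x. \<exists>I. encodes x I \<and> is_instance C I \<and> satisfiable C I}"

definition no_strings :: "qcsp \<Rightarrow> bool list set" where
  "no_strings C = {x. \<exists>I. encodes x I \<and> is_instance C I \<and> unsatisfiable C I}"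

definition reduces :: "(bool list \<Rightarrow> bool list) \<Rightarrow> qcsp \<Rightarrow> qcsp \<Rightarrow> bool" where
  "reduces f C C' \<longleftrightarrow>
     f ` yes_strings C \<subseteq> yes_strings C' \<and> f ` no_strings C \<subseteq> no_strings C'"

section \<open>Constant-depth circuits\<close>

text \<open>
  A circuit is a list of gates in topological order, each gate naming the positions of the earlier
  gates that feed it, together with the list of gates that are its outputs. The size counts gates
  and wires.
\<close>

datatype gate = InG nat | NotG nat | AndG "nat list" | OrG "nat list"

type_synonym circuit = "gate list \<times> nat list"

fun operands :: "gate \<Rightarrow> nat list" where
  "operands (InG i) = []"
| "operands (NotG j) = [j]"
| "operands (AndG js) = js"
| "operands (OrG js) = js"

fun gate_value :: "bool list \<Rightarrow> bool list \<Rightarrow> gate \<Rightarrow> bool" where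
  "gate_value x vs (InG i) = x ! i"
| "gate_value x vs (NotG j) = (\<not> vs ! j)"
| "gate_value x vs (AndG js) = (\<forall>j \<in> set js. vs ! j)"
| "gate_value x vs (OrG js) = (\<exists>j \<in> set js. vs ! j)"

definition gate_values :: "bool list \<Rightarrow> gate list \<Rightarrow> bool list" where
  "gate_values x gs = foldl (\<lambda>vs g. vs @ [gate_value x vs g]) [] gs"

fun gate_depth :: "nat list \<Rightarrow> gate \<Rightarrow> nat" where
  "gate_depth ds (InG i) = 0"
| "gate_depth ds g = Suc (Max (insert 0 ((!) ds ` set (operands g))))"

definition gate_depths :: "gate list \<Rightarrow> nat list" where
  "gate_depths gs = foldl (\<lambda>ds g. ds @ [gate_depth ds g]) [] gs"

definition is_circuit :: "nat \<Rightarrow> circuit \<Rightarrow> bool" where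
  "is_circuit N = (\<lambda>(gs, outs).
     (\<forall>p<length gs. (\<forall>j \<in> set (operands (gs ! p)). j < p) \<and> (\<forall>i. gs ! p = InG i \<longrightarrow> i < N)) \<and>
     (\<forall>j \<in> set outs. j < length gs))"

definition circuit_size :: "circuit \<Rightarrow> nat" where
  "circuit_size = (\<lambda>(gs, outs). (\<Sum>g\<leftarrow>gs. 1 + length (operands g)) + length outs)"

definition circuit_depth :: "circuit \<Rightarrow> nat" where
  "circuit_depth = (\<lambda>(gs, outs). Max (insert 0 (set (gate_depths gs))))"

definition run_circuit :: "circuit \<Rightarrow> bool list \<Rightarrow> bool list" where
  "run_circuit = (\<lambda>(gs, outs) x. map ((!) (gate_values x gs)) outs)"

definition AC0 :: "(bool list \<Rightarrow> bool list) \<Rightarrow> bool" where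
  "AC0 f \<longleftrightarrow> (\<exists>(K :: nat \<Rightarrow> circuit) (D :: nat) (s :: nat poly). \<forall>N.
     is_circuit N (K N) \<and> circuit_depth (K N) \<le> D \<and> circuit_size (K N) \<le> poly s N \<and>
     (\<forall>x. length x = N \<longrightarrow> f x = run_circuit (K N) x))"

end

theory Submission
  imports Defs "HOL-Analysis.Continuum_Not_Denumerable"
begin

text \<open>
  A qudit is encoded into a block of \<open>b = 4 * 2 ^ m\<close> qubits, by a code \<open>V\<close> of dimension \<open>d\<close> that is
  monogamous: two blocks that share a qubit can be in \<open>V\<close> simultaneously only if they are the same
  block, with the qubits in the same order. For each way of overlapping there is a subspace of
  dimension \<open>2 ^ (b - 2)\<close> that excludes it (a fixed pair of bit values if a qubit has different
  positions in the two blocks, a singlet between a shared and an unshared position otherwise).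
  Excluding an overlap is an open condition on lines of constraint matrices, so a generic \<open>V\<close>
  excludes all of them.

  A clause of the qubit problem measures whether its blocks are in \<open>V\<close>, decodes them, giving a fixed
  state in case of failure, and applies the old clause; its energy is the energy of the old clause
  plus the probability of a failure. Decoding all blocks of a state thus gives a mixture of states of
  the qudits that has at most the same energy, and encoding preserves energies, so the least
  energies agree exactly and the same polynomials serve for both problems.

  Since \<open>b\<close> is a power of two, the qubits of a block are numbered by appending bits to the number of
  the qudit. Conversely, an instance of the qubit problem whose blocks overlap inconsistently is not
  satisfiable and is mapped to a fixed unsatisfiable instance; otherwise blocks are replaced by
  qudits. Both maps are first-order definable with bounded quantifiers over positions, hence in
  \<open>AC0\<close>. If there is no unsatisfiable instance at all, a trivial problem suffices.
\<close>

section \<open>Digits and configurations\<close>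

text \<open>The obstacle is the way back: an arbitrary qubit instance need not be an encoded one,
  and its clauses may overlap in any way. A qubit instance with an inconsistent overlap may still
  lie outside the promise; it suffices that it is not satisfiable, because then an unsatisfiable
  image breaks nothing. The excluding subspaces leave \<open>b - 2\<close> of the \<open>b\<close>
  qubits free, whence the requirement \<open>d \<le> 2 ^ (b - 2)\<close>. The factor 4 is the least
  power of two that guarantees it: with \<open>d = 2\<close> and factor 2 one would have
  \<open>b = 2\<close>, which leaves dimension 1. A single code has to work for all numbers
  \<open>n\<close> of qubits, hence for infinitely many overlaps, so an argument with finitely many
  exceptions is not enough. The overlaps are countable and each excludes finitely many real
  parameters, while the reals are uncountable. Energies are compared on abstract sites: a site is a
  qudit in one problem and a block of qubits in the other. Normalization is avoided by comparing
  energy with norm, so that the unnormalized outcomes of a decoding can be averaged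
  directly.\<close>

abbreviation configs :: "nat \<Rightarrow> 'q set \<Rightarrow> ('q \<Rightarrow> nat) set" where
  "configs D U \<equiv> PiE U (\<lambda>_. {..<D})"

definition place_value :: "nat \<Rightarrow> nat \<Rightarrow> (nat \<Rightarrow> nat) \<Rightarrow> nat" where
  "place_value D a u = (\<Sum>l<a. u l * D ^ l)"

definition digits :: "nat \<Rightarrow> nat \<Rightarrow> nat \<Rightarrow> nat \<Rightarrow> nat" where
  "digits D a i = (\<lambda>l\<in>{..<a}. digit D i l)"

definition pull :: "'q list \<Rightarrow> ('q \<Rightarrow> 'b) \<Rightarrow> nat \<Rightarrow> 'b" where
  "pull qs u = (\<lambda>l\<in>{..<length qs}. u (qs ! l))"

lemma place_value_less: "(\<And>l. l < a \<Longrightarrow> u l < D) \<Longrightarrow> place_value D a u < D ^ a"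
proof (induction a)
  case (Suc a)
  then have "place_value D a u < D ^ a" "u a \<le> D - 1" "0 < D" by (force simp: less_Suc_eq)+
  then have "place_value D (Suc a) u < D ^ a + (D - 1) * D ^ a"
    by (simp add: place_value_def add_less_le_mono)
  also have "\<dots> = D ^ Suc a" using \<open>0 < D\<close> by (simp add: algebra_simps)
  finally show ?case .
qed (simp add: place_value_def)

lemma digit_place_value:
  assumes "\<And>l. l < a \<Longrightarrow> u l < D" "l < a" shows "digit D (place_value D a u) l = u l"
  using assms
proof (induction a)
  case (Suc a)
  have IH: "place_value D a u < D ^ a" using Suc.prems place_value_less[of a u D] by auto
  have e: "place_value D (Suc a) u = place_value D a u + u a * D ^ a" by (simp add: place_value_def)
  have D: "0 < D" "u a < D" using Suc.prems(1)[of a] by auto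
  show ?case
  proof (cases "l = a")
    case True
    then show ?thesis using IH D by (simp add: e digit_def)
  next
    case False
    then have l: "l < a" using Suc.prems by auto
    then have "D ^ a = D ^ (a - l - 1) * D * D ^ l"
      using less_imp_Suc_add[OF l] by (auto simp: power_add)
    then have e': "place_value D (Suc a) u = place_value D a u + (u a * D ^ (a - l - 1) * D) * D ^ l"
      unfolding e by (simp only: mult.assoc)
    have "place_value D (Suc a) u div D ^ l = place_value D a u div D ^ l + u a * D ^ (a - l - 1) * D"
      unfolding e' using D by (intro div_mult_self1[THEN trans]) auto
    then show ?thesis using Suc.IH Suc.prems l by (simp add: digit_def)
  qed
qed simp

lemma place_value_digit: "i < D ^ a \<Longrightarrow> place_value D a (digit D i) = i"
proof (induction a arbitrary: i)
  case (Suc a)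
  have "0 < D" using Suc.prems by (cases D) auto
  have "i mod D ^ a < D ^ a" using \<open>0 < D\<close> by simp
  moreover have "digit D (i mod D ^ a) l = digit D i l" if "l < a" for l
  proof -
    have "D ^ a = D ^ l * D ^ (a - l)" "D dvd D ^ (a - l)" using that by (simp_all flip: power_add)
    then have "i mod D ^ a div D ^ l = i div D ^ l mod D ^ (a - l)" "D dvd D ^ (a - l)"
      using \<open>0 < D\<close> by (auto simp: mod_mult2_eq)
    then show ?thesis by (simp add: digit_def mod_mod_cancel)
  qed
  ultimately have "place_value D a (digit D i) = i mod D ^ a"
    using Suc.IH[of "i mod D ^ a"] by (simp add: place_value_def)
  moreover have "digit D i a = i div D ^ a"
    using Suc.prems \<open>0 < D\<close> by (simp add: digit_def less_mult_imp_div_less)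
  ultimately show ?case by (simp add: place_value_def mod_div_mult_eq)
qed (simp add: place_value_def)

lemma digit_less: "0 < D \<Longrightarrow> digit D i l < D" by (simp add: digit_def)

lemma digits_in_configs: "0 < D \<Longrightarrow> digits D a i \<in> configs D {..<a}"
  by (auto simp: digits_def digit_less)

lemma place_value_digits: "i < D ^ a \<Longrightarrow> place_value D a (digits D a i) = i"
  using place_value_digit[of i D a] by (simp add: place_value_def digits_def)

lemma digits_place_value: "u \<in> configs D {..<a} \<Longrightarrow> digits D a (place_value D a u) = u"
proof
  fix l assume u: "u \<in> configs D {..<a}"
  have "u l < D" if "l < a" for l using PiE_mem[OF u, of l] that by simp
  then show "digits D a (place_value D a u) l = u l"
    using PiE_arb[OF u, of l] by (cases "l < a") (simp_all add: digits_def digit_place_value)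
qed

lemma place_value_configs_less: "u \<in> configs D {..<a} \<Longrightarrow> place_value D a u < D ^ a"
  by (rule place_value_less) auto

lemma bij_betw_place_value: "0 < D \<Longrightarrow> bij_betw (place_value D a) (configs D {..<a}) {..<D ^ a}"
  using place_value_configs_less[of _ a D] digits_in_configs[of D a]
  by (intro bij_betw_byWitness[where f' = "digits D a"] ballI image_subsetI)
     (simp_all add: digits_place_value place_value_digits)

lemma finite_configs [simp]: "finite U \<Longrightarrow> finite (configs D U)"
  by (simp add: finite_PiE)

lemma restrict_index_eq: "restrict_index d qs i = place_value d (length qs) (pull qs (digit d i))"
  by (simp add: restrict_index_def place_value_def pull_def)

lemma restrict_index_less: "0 < d \<Longrightarrow> restrict_index d qs i < d ^ length qs"
  unfolding restrict_index_eq by (rule place_value_less) (simp add: pull_def digit_less)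

lemma digit_restrict_index:
  "0 < d \<Longrightarrow> l < length qs \<Longrightarrow> digit d (restrict_index d qs i) l = digit d i (qs ! l)"
  unfolding restrict_index_eq by (subst digit_place_value) (simp_all add: pull_def digit_less)

lemma restrict_index_append:
  "restrict_index d (qs @ rs) i = restrict_index d qs i + restrict_index d rs i * d ^ length qs"
proof (induction rs rule: rev_induct)
  case (snoc r rs)
  have "restrict_index d (qs' @ [r]) i = restrict_index d qs' i + digit d i r * d ^ length qs'" for qs'
    by (simp add: restrict_index_def nth_append)
  from this[of "qs @ rs"] this[of rs] show ?case
    using snoc by (simp add: algebra_simps power_add)
qed (simp add: restrict_index_def)

text \<open>Consecutive groups of \<open>s\<close> digits in base \<open>d\<close> are digits in
  base \<open>d ^ s\<close>. This is what allows a block of qubits to be treated as one site of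
  larger dimension.\<close>

lemma restrict_index_concat:
  assumes "\<And>q. q \<in> set qs \<Longrightarrow> length (\<beta> q) = s"
  shows "restrict_index d (concat (map \<beta> qs)) i =
    place_value (d ^ s) (length qs) (pull qs (\<lambda>q. restrict_index d (\<beta> q) i))"
  using assms
proof (induction qs rule: rev_induct)
  case (snoc q qs)
  have "length (concat (map \<beta> qs)) = length qs * s"
    using snoc.prems by (induction qs) auto
  then show ?case using snoc
    by (simp add: restrict_index_append place_value_def pull_def nth_append power_mult[symmetric] mult.commute)
qed (simp add: restrict_index_def place_value_def)

section \<open>Sums over configurations\<close>

definition merge :: "'q set \<Rightarrow> ('q \<Rightarrow> 'b) \<Rightarrow> ('q \<Rightarrow> 'b) \<Rightarrow> 'q \<Rightarrow> 'b" where
  "merge T u v = (\<lambda>q. if q \<in> T then u q else v q)"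

lemma bij_betw_merge:
  assumes "T \<subseteq> U"
  shows "bij_betw (\<lambda>(u, v). merge T u v) (PiE T B \<times> PiE (U - T) B) (PiE U B)"
proof (rule bij_betw_byWitness[where f' = "\<lambda>w. (restrict w T, restrict w (U - T))"])
  show "\<forall>p\<in>PiE T B \<times> PiE (U - T) B.
      (restrict (case p of (u, v) \<Rightarrow> merge T u v) T, restrict (case p of (u, v) \<Rightarrow> merge T u v) (U - T)) = p"
    by (auto simp: merge_def fun_eq_iff PiE_iff extensional_def)
  show "\<forall>w\<in>PiE U B. (case (restrict w T, restrict w (U - T)) of (u, v) \<Rightarrow> merge T u v) = w"
    using assms by (auto simp: merge_def fun_eq_iff PiE_iff extensional_def)
  show "(\<lambda>(u, v). merge T u v) ` (PiE T B \<times> PiE (U - T) B) \<subseteq> PiE U B"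
    using assms by (auto simp: merge_def PiE_iff extensional_def)
  show "(\<lambda>w. (restrict w T, restrict w (U - T))) ` PiE U B \<subseteq> PiE T B \<times> PiE (U - T) B"
    using assms by (auto simp: PiE_iff)
qed

lemma sum_PiE_split:
  assumes "T \<subseteq> U"
  shows "(\<Sum>w\<in>PiE U B. F w) = (\<Sum>u\<in>PiE T B. \<Sum>v\<in>PiE (U - T) B. F (merge T u v))"
  using sum.reindex_bij_betw[OF bij_betw_merge[OF assms, of B], of F]
  by (simp add: sum.cartesian_product prod.case_eq_if)

lemma bij_betw_pull:
  assumes "distinct qs"
  shows "bij_betw (pull qs) (configs D (set qs)) (configs D {..<length qs})"
proof -
  define h where "h = inv_into {..<length qs} ((!) qs)"
  have h: "h (qs ! l) = l" if "l < length qs" for l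
    unfolding h_def using that assms by (intro inv_into_f_f) (auto intro: inj_on_nth)
  show ?thesis
  proof (rule bij_betw_byWitness[where f' = "\<lambda>v. \<lambda>q\<in>set qs. v (h q)"])
    show "\<forall>u\<in>configs D (set qs). (\<lambda>q\<in>set qs. pull qs u (h q)) = u"
      using h by (auto simp: pull_def fun_eq_iff PiE_iff extensional_def in_set_conv_nth)
    show "\<forall>v\<in>configs D {..<length qs}. pull qs (\<lambda>q\<in>set qs. v (h q)) = v"
      using h by (auto simp: pull_def fun_eq_iff PiE_iff extensional_def)
    show "pull qs ` configs D (set qs) \<subseteq> configs D {..<length qs}"
      by (auto simp: pull_def PiE_iff extensional_def split: if_splits)
    show "(\<lambda>v. \<lambda>q\<in>set qs. v (h q)) ` configs D {..<length qs} \<subseteq> configs D (set qs)"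
      using h by (auto simp: PiE_iff in_set_conv_nth)
  qed
qed

lemma sum_pull:
  "distinct qs \<Longrightarrow> (\<Sum>u\<in>configs D (set qs). F (pull qs u)) = (\<Sum>v\<in>configs D {..<length qs}. F v)"
  by (rule sum.reindex_bij_betw[OF bij_betw_pull])

lemma prod_set_list:
  "distinct qs \<Longrightarrow> (\<Prod>q\<in>set qs. F q) = (\<Prod>l<length qs. F (qs ! l))"
  by (rule sym, rule prod.reindex_bij_betw[OF bij_betw_nth]) auto

lemma pull_cong: "(\<And>q. q \<in> set qs \<Longrightarrow> u q = v q) \<Longrightarrow> pull qs u = pull qs v"
  by (auto simp: pull_def fun_eq_iff restrict_def)

section \<open>Clauses as forms on configurations\<close>

text \<open>The quadratic form of an operator with kernel \<open>m\<close> on the sites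
  \<open>qs\<close>, tensored with the identity. Sites come from an arbitrary set instead of an
  initial segment of the numbers, so that qudits and blocks of qubits can play the same
  role.\<close>

definition form :: "nat \<Rightarrow> 'q set \<Rightarrow> ((nat \<Rightarrow> nat) \<Rightarrow> (nat \<Rightarrow> nat) \<Rightarrow> complex) \<Rightarrow> 'q list \<Rightarrow>
    (('q \<Rightarrow> nat) \<Rightarrow> complex) \<Rightarrow> complex" where
  "form D U m qs \<phi> = (\<Sum>u\<in>configs D U. \<Sum>u'\<in>configs D U.
     if \<forall>q\<in>U - set qs. u q = u' q then m (pull qs u) (pull qs u') * \<phi> u' * cnj (\<phi> u) else 0)"

definition norm_form :: "nat \<Rightarrow> 'q set \<Rightarrow> (('q \<Rightarrow> nat) \<Rightarrow> complex) \<Rightarrow> complex" where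
  "norm_form D U \<phi> = (\<Sum>u\<in>configs D U. \<phi> u * cnj (\<phi> u))"

definition kernel_of :: "nat \<Rightarrow> nat \<Rightarrow> complex mat \<Rightarrow> (nat \<Rightarrow> nat) \<Rightarrow> (nat \<Rightarrow> nat) \<Rightarrow> complex" where
  "kernel_of D a M v v' = M $$ (place_value D a v, place_value D a v')"

text \<open>A block of \<open>s\<close> qudits of dimension \<open>e\<close> acts as one site of
  dimension \<open>e ^ s\<close>. Blocks of one element give back the qudits themselves, so the
  original and the encoded problem are both instances.\<close>

locale block_system =
  fixes e n s :: nat and U :: "'q set" and \<beta> :: "'q \<Rightarrow> nat list"
  assumes e_pos: "0 < e" and finite_U: "finite U"
    and length_block: "\<And>q. q \<in> U \<Longrightarrow> length (\<beta> q) = s"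
    and distinct_block: "\<And>q. q \<in> U \<Longrightarrow> distinct (\<beta> q)"
    and block_subset: "\<And>q. q \<in> U \<Longrightarrow> set (\<beta> q) \<subseteq> {..<n}"
    and block_disjoint: "\<And>q q'. q \<in> U \<Longrightarrow> q' \<in> U \<Longrightarrow> q \<noteq> q' \<Longrightarrow> set (\<beta> q) \<inter> set (\<beta> q') = {}"
begin

definition rest :: "nat set" where "rest = {..<n} - (\<Union>q\<in>U. set (\<beta> q))"

definition dec :: "nat \<Rightarrow> ('q \<Rightarrow> nat) \<times> (nat \<Rightarrow> nat)" where
  "dec i = (\<lambda>q\<in>U. restrict_index e (\<beta> q) i, \<lambda>p\<in>rest. digit e i p)"

definition enc :: "('q \<Rightarrow> nat) \<Rightarrow> (nat \<Rightarrow> nat) \<Rightarrow> nat" where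
  "enc u z = inv_into {..<e ^ n} dec (u, z)"

lemma finite_rest [simp]: "finite rest" by (simp add: rest_def)

lemma digit_block:
  "q \<in> U \<Longrightarrow> l < s \<Longrightarrow> digit e (fst (dec i) q) l = digit e i (\<beta> q ! l)"
  using digit_restrict_index[OF e_pos, of l "\<beta> q" i] by (simp add: dec_def length_block)

lemma digit_rest: "p \<in> rest \<Longrightarrow> snd (dec i) p = digit e i p"
  by (simp add: dec_def)

lemma position_cases:
  assumes "p < n"
  obtains "p \<in> rest" | q l where "q \<in> U" "l < s" "p = \<beta> q ! l" "p \<in> set (\<beta> q)"
  using assms by (auto simp: rest_def in_set_conv_nth length_block)

lemma card_rest: "card rest + s * card U = n"
proof -
  have "card (\<Union>q\<in>U. set (\<beta> q)) = (\<Sum>q\<in>U. card (set (\<beta> q)))"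
    using finite_U block_disjoint by (intro card_UN_disjoint) auto
  also have "\<dots> = s * card U"
    by (simp add: distinct_card distinct_block length_block)
  finally have c: "card (\<Union>q\<in>U. set (\<beta> q)) = s * card U" .
  have "(\<Union>q\<in>U. set (\<beta> q)) \<subseteq> {..<n}" using block_subset by blast
  then have "card rest = n - s * card U" "s * card U \<le> n"
    using c card_mono[of "{..<n}" "\<Union>q\<in>U. set (\<beta> q)"] finite_U
    by (auto simp: rest_def card_Diff_subset finite_subset)
  then show ?thesis by simp
qed

lemma dec_in: "dec i \<in> configs (e ^ s) U \<times> configs e rest"
  using restrict_index_less[OF e_pos] by (auto simp: dec_def digit_less[OF e_pos] simp flip: length_block)

lemma bij_betw_dec: "bij_betw dec {..<e ^ n} (configs (e ^ s) U \<times> configs e rest)"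
proof -
  have inj: "inj_on dec {..<e ^ n}"
  proof (rule inj_onI)
    fix i j assume i: "i \<in> {..<e ^ n}" "j \<in> {..<e ^ n}" and ij: "dec i = dec j"
    have "digit e i p = digit e j p" if "p < n" for p
      using that
    proof (cases rule: position_cases)
      case 1
      then show ?thesis using digit_rest[of p i] digit_rest[of p j] ij by simp
    next
      case (2 q l)
      then show ?thesis using digit_block[of q l i] digit_block[of q l j] ij by simp
    qed
    then have "place_value e n (digit e i) = place_value e n (digit e j)"
      by (simp add: place_value_def)
    then show "i = j" using i place_value_digit[of _ e n] by (metis lessThan_iff)
  qed
  \<comment> \<open>Surjectivity comes from counting: \<open>card_rest\<close> makes both sides of
    the injection equally large.\<close>
  have "card (configs (e ^ s) U \<times> configs e rest) = e ^ n"
    using card_rest by (simp add: card_PiE finite_U card_cartesian_product flip: power_mult power_add)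
       (simp add: add.commute)
  then have "dec ` {..<e ^ n} = configs (e ^ s) U \<times> configs e rest"
    using inj dec_in by (intro card_subset_eq image_subsetI) (simp_all add: finite_U card_image)
  with inj show ?thesis by (simp add: bij_betw_def)
qed

lemma enc_less: "u \<in> configs (e ^ s) U \<Longrightarrow> z \<in> configs e rest \<Longrightarrow> enc u z < e ^ n"
  using bij_betw_dec inv_into_into[of "(u, z)" dec "{..<e ^ n}"] by (auto simp: enc_def bij_betw_def)

lemma dec_enc: "u \<in> configs (e ^ s) U \<Longrightarrow> z \<in> configs e rest \<Longrightarrow> dec (enc u z) = (u, z)"
  using bij_betw_dec f_inv_into_f[of "(u, z)" dec "{..<e ^ n}"] by (auto simp: enc_def bij_betw_def)

lemma enc_dec: "i < e ^ n \<Longrightarrow> enc (fst (dec i)) (snd (dec i)) = i"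
  using bij_betw_dec inv_into_f_f[of dec "{..<e ^ n}" i] by (auto simp: enc_def bij_betw_def)

lemma sum_configs:
  "(\<Sum>i<e ^ n. F i) = (\<Sum>z\<in>configs e rest. \<Sum>u\<in>configs (e ^ s) U. F (enc u z))"
proof -
  have "(\<Sum>i<e ^ n. F i) = (\<Sum>i<e ^ n. F (enc (fst (dec i)) (snd (dec i))))"
    by (simp add: enc_dec)
  also have "\<dots> = (\<Sum>p\<in>configs (e ^ s) U \<times> configs e rest. F (enc (fst p) (snd p)))"
    by (rule sum.reindex_bij_betw[OF bij_betw_dec])
  also have "\<dots> = (\<Sum>u\<in>configs (e ^ s) U. \<Sum>z\<in>configs e rest. F (enc u z))"
    by (simp add: sum.cartesian_product prod.case_eq_if)
  also have "\<dots> = (\<Sum>z\<in>configs e rest. \<Sum>u\<in>configs (e ^ s) U. F (enc u z))"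
    by (rule sum.swap)
  finally show ?thesis .
qed

text \<open>Disjointness of the blocks makes a block outside the clause share no qubit with it, so
  its value is determined by digits on which \<open>i\<close> and \<open>j\<close> must
  agree.\<close>

lemma off_clause_iff:
  assumes "set qs \<subseteq> U"
  shows "(\<forall>p<n. p \<notin> set (concat (map \<beta> qs)) \<longrightarrow> digit e i p = digit e j p) \<longleftrightarrow>
    snd (dec i) = snd (dec j) \<and> (\<forall>q\<in>U - set qs. fst (dec i) q = fst (dec j) q)" (is "?L \<longleftrightarrow> ?R")
proof
  assume L: ?L
  have "snd (dec i) = snd (dec j)"
    using L assms by (auto simp: dec_def rest_def fun_eq_iff restrict_def)
  moreover have "fst (dec i) q = fst (dec j) q" if q: "q \<in> U" "q \<notin> set qs" for q
  proof -
    have "digit e i p = digit e j p" if "p \<in> set (\<beta> q)" for p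
    proof -
      have "p < n" using that q(1) block_subset by blast
      moreover have "p \<notin> set (\<beta> q')" if "q' \<in> set qs" for q'
        using block_disjoint[of q q'] \<open>p \<in> set (\<beta> q)\<close> q assms that by blast
      ultimately show ?thesis using L by simp
    qed
    then have "pull (\<beta> q) (digit e i) = pull (\<beta> q) (digit e j)" by (rule pull_cong)
    then show ?thesis using q by (simp add: dec_def restrict_index_eq)
  qed
  ultimately show ?R by blast
next
  assume R: ?R
  show ?L
  proof (intro allI impI)
    fix p assume p: "p < n" "p \<notin> set (concat (map \<beta> qs))"
    from \<open>p < n\<close> show "digit e i p = digit e j p"
    proof (cases rule: position_cases)
      case 1
      then show ?thesis using digit_rest[of p i] digit_rest[of p j] R by simp
    next
      case (2 q l)
      then have "q \<in> U - set qs" using p by auto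
      then show ?thesis using 2 digit_block[of q l i] digit_block[of q l j] R by simp
    qed
  qed
qed

lemma restrict_index_clause:
  assumes "set qs \<subseteq> U"
  shows "restrict_index e (concat (map \<beta> qs)) i = place_value (e ^ s) (length qs) (pull qs (fst (dec i)))"
  using assms by (subst restrict_index_concat[where s = s])
    (auto simp: length_block dec_def intro!: arg_cong[where f = "place_value _ _"] pull_cong)

text \<open>Qubits in no block lie outside the clause, so the operator is diagonal in
  \<open>z\<close> and acts on each slice separately.\<close>

lemma act_on_mult_index:
  assumes "\<psi> \<in> carrier_vec (e ^ n)" "set qs \<subseteq> U" and u: "u \<in> configs (e ^ s) U" "z \<in> configs e rest"
  shows "(act_on e n M (concat (map \<beta> qs)) *\<^sub>v \<psi>) $ enc u z =
    (\<Sum>u'\<in>configs (e ^ s) U. if \<forall>q\<in>U - set qs. u q = u' q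
       then kernel_of (e ^ s) (length qs) M (pull qs u) (pull qs u') * \<psi> $ enc u' z else 0)"
proof -
  have entry: "act_on e n M (concat (map \<beta> qs)) $$ (enc u z, enc u' z') =
      (if z = z' \<and> (\<forall>q\<in>U - set qs. u q = u' q)
       then kernel_of (e ^ s) (length qs) M (pull qs u) (pull qs u') else 0)"
    if u': "u' \<in> configs (e ^ s) U" "z' \<in> configs e rest" for u' z'
    unfolding act_on_def
    by (simp only: index_mat(1)[OF enc_less[OF u] enc_less[OF u']] prod.case off_clause_iff[OF assms(2)]
        restrict_index_clause[OF assms(2)] dec_enc[OF u] dec_enc[OF u'] fst_conv snd_conv kernel_of_def)
  have "(act_on e n M (concat (map \<beta> qs)) *\<^sub>v \<psi>) $ enc u z =
      (\<Sum>j<e ^ n. act_on e n M (concat (map \<beta> qs)) $$ (enc u z, j) * \<psi> $ j)"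
    using assms enc_less[OF u] by (simp add: act_on_def scalar_prod_def lessThan_atLeast0)
  also have "\<dots> = (\<Sum>z'\<in>configs e rest. \<Sum>u'\<in>configs (e ^ s) U. if z = z' \<and> (\<forall>q\<in>U - set qs. u q = u' q)
       then kernel_of (e ^ s) (length qs) M (pull qs u) (pull qs u') * \<psi> $ enc u' z' else 0)"
    unfolding sum_configs
    by (intro sum.cong refl) (simp add: entry del: set_concat)
  also have "\<dots> = (\<Sum>z'\<in>configs e rest. if z = z' then \<Sum>u'\<in>configs (e ^ s) U. if \<forall>q\<in>U - set qs. u q = u' q
       then kernel_of (e ^ s) (length qs) M (pull qs u) (pull qs u') * \<psi> $ enc u' z' else 0 else 0)"
    by (intro sum.cong refl) auto
  finally show ?thesis using u by (simp add: sum.delta)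
qed

lemma act_on_form:
  assumes "\<psi> \<in> carrier_vec (e ^ n)" "set qs \<subseteq> U"
  shows "(act_on e n M (concat (map \<beta> qs)) *\<^sub>v \<psi>) \<bullet>c \<psi> =
    (\<Sum>z\<in>configs e rest. form (e ^ s) U (kernel_of (e ^ s) (length qs) M) qs (\<lambda>u. \<psi> $ enc u z))"
proof -
  have "(act_on e n M (concat (map \<beta> qs)) *\<^sub>v \<psi>) \<bullet>c \<psi> =
      (\<Sum>i<e ^ n. (act_on e n M (concat (map \<beta> qs)) *\<^sub>v \<psi>) $ i * cnj (\<psi> $ i))"
    using assms by (simp add: act_on_def scalar_prod_def lessThan_atLeast0)
  also have "\<dots> = (\<Sum>z\<in>configs e rest. form (e ^ s) U (kernel_of (e ^ s) (length qs) M) qs (\<lambda>u. \<psi> $ enc u z))"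
    unfolding sum_configs form_def
    by (intro sum.cong refl)
       (simp only: act_on_mult_index[OF assms] sum_distrib_right if_distrib[where f = "\<lambda>x. x * _"] mult_zero_left)
  finally show ?thesis .
qed

lemma norm_configs:
  assumes "\<psi> \<in> carrier_vec (e ^ n)"
  shows "\<psi> \<bullet>c \<psi> = (\<Sum>z\<in>configs e rest. norm_form (e ^ s) U (\<lambda>u. \<psi> $ enc u z))"
  using assms sum_configs[of "\<lambda>i. \<psi> $ i * cnj (\<psi> $ i)"]
  by (simp add: scalar_prod_def norm_form_def lessThan_atLeast0)

text \<open>A constraint on one block couples only basis states that differ in that block.
  Annihilation by it thus becomes a system of linear equations for each slice.\<close>

lemma act_on_block:
  assumes "\<psi> \<in> carrier_vec (e ^ n)" "q \<in> U" and u: "u \<in> configs (e ^ s) U" "z \<in> configs e rest"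
  shows "(act_on e n M (\<beta> q) *\<^sub>v \<psi>) $ enc u z = (\<Sum>v<e ^ s. M $$ (u q, v) * \<psi> $ enc (u(q := v)) z)"
proof -
  have pv: "place_value D (Suc 0) (pull [q] u) = u q" for D u by (simp add: place_value_def pull_def)
  have "(act_on e n M (\<beta> q) *\<^sub>v \<psi>) $ enc u z =
    (\<Sum>u'\<in>configs (e ^ s) U. if \<forall>p\<in>U - {q}. u p = u' p then M $$ (u q, u' q) * \<psi> $ enc u' z else 0)"
    using act_on_mult_index[OF assms(1) _ u, of "[q]" M] assms(2) by (simp add: kernel_of_def pv cong: if_cong)
  also have "\<dots> = (\<Sum>u'\<in>(\<lambda>v. u(q := v)) ` {..<e ^ s}. M $$ (u q, u' q) * \<psi> $ enc u' z)"
  proof -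
    have "{u' \<in> configs (e ^ s) U. \<forall>p\<in>U - {q}. u p = u' p} = (\<lambda>v. u(q := v)) ` {..<e ^ s}"
    proof (intro equalityI subsetI)
      fix u' assume u': "u' \<in> {u' \<in> configs (e ^ s) U. \<forall>p\<in>U - {q}. u p = u' p}"
      then have "u' x = (u(q := u' q)) x" for x
        using u(1) by (cases "x \<in> U") (auto simp: PiE_iff extensional_def)
      then have "u' = u(q := u' q)" by (rule ext)
      moreover have "u' q < e ^ s" using u' assms(2) by (auto simp: PiE_iff)
      ultimately show "u' \<in> (\<lambda>v. u(q := v)) ` {..<e ^ s}" by blast
    qed (use u(1) assms(2) in \<open>auto simp: PiE_iff extensional_def split: if_splits\<close>)
    then show ?thesis using finite_U by (simp add: sum.If_cases Int_def)
  qed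
  also have "\<dots> = (\<Sum>v<e ^ s. M $$ (u q, v) * \<psi> $ enc (u(q := v)) z)"
    by (subst sum.reindex) (auto simp: inj_on_def fun_eq_iff dest!: spec[of _ q])
  finally show ?thesis .
qed

end

lemma pull_in_configs:
  assumes "u \<in> configs D U" "set qs \<subseteq> U"
  shows "pull qs u \<in> configs D {..<length qs}"
proof (rule PiE_I)
  fix l assume "l \<in> {..<length qs}"
  then have "qs ! l \<in> U" "l < length qs" using assms(2) by auto
  then show "pull qs u l \<in> {..<D}" using PiE_mem[OF assms(1), of "qs ! l"] by (simp add: pull_def)
qed (simp add: pull_def)

lemma form_cong:
  assumes "\<And>v v'. v \<in> configs D {..<length qs} \<Longrightarrow> v' \<in> configs D {..<length qs} \<Longrightarrow> m v v' = m' v v'"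
    and "set qs \<subseteq> U"
  shows "form D U m qs \<phi> = form D U m' qs \<phi>"
  unfolding form_def using pull_in_configs[OF _ assms(2)]
  by (intro sum.cong refl if_cong) (simp add: assms(1))

lemma form_add: "form D U (\<lambda>v v'. m v v' + m' v v') qs \<phi> = form D U m qs \<phi> + form D U m' qs \<phi>"
  unfolding form_def sum.distrib[symmetric] by (intro sum.cong refl) (auto simp: algebra_simps)

text \<open>Equality on the clause and equality off the clause together leave only the diagonal
  terms.\<close>

lemma form_delta:
  assumes "finite U" "set qs \<subseteq> U"
  shows "form D U (\<lambda>v v'. of_bool (v = v')) qs \<phi> = norm_form D U \<phi>"
proof -
  have "(\<forall>q\<in>U - set qs. u q = u' q) \<and> pull qs u = pull qs u' \<longleftrightarrow> u' = u"
    if "u \<in> configs D U" "u' \<in> configs D U" for u u'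
  proof
    assume *: "(\<forall>q\<in>U - set qs. u q = u' q) \<and> pull qs u = pull qs u'"
    have "u q = u' q" if q: "q \<in> set qs" for q
    proof -
      obtain l where "l < length qs" "q = qs ! l" using q by (auto simp: in_set_conv_nth)
      then show ?thesis using fun_cong[OF conjunct2[OF *], of l] by (simp add: pull_def)
    qed
    then have "u' q = u q" if "q \<in> U" for q using * that by (cases "q \<in> set qs") auto
    then show "u' = u" by (rule PiE_ext[OF that(2,1)])
  qed auto
  then have "form D U (\<lambda>v v'. of_bool (v = v')) qs \<phi> =
      (\<Sum>u\<in>configs D U. \<Sum>u'\<in>configs D U. if u' = u then \<phi> u' * cnj (\<phi> u) else 0)"
    unfolding form_def by (intro sum.cong refl) auto
  also have "\<dots> = norm_form D U \<phi>"
    using assms(1) by (simp add: norm_form_def sum.delta)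
  finally show ?thesis .
qed

lemma sum_sum_reindex_bij_betw:
  assumes "bij_betw h A B"
  shows "(\<Sum>x\<in>A. \<Sum>y\<in>A. F (h x) (h y)) = (\<Sum>x\<in>B. \<Sum>y\<in>B. F x y)"
  using sum.reindex_bij_betw[OF assms, of "\<lambda>x. \<Sum>y\<in>B. F x y"]
  by (simp add: sum.reindex_bij_betw[OF assms])

text \<open>When the clause covers all sites no identity factor remains, and the form is that of the
  matrix itself. Positivity of the clause types enters the forms through this case.\<close>

lemma form_full:
  assumes "distinct qs" "0 < D" and M: "M \<in> carrier_mat (D ^ length qs) (D ^ length qs)"
  obtains v where "v \<in> carrier_vec (D ^ length qs)"
    "form D (set qs) (kernel_of D (length qs) M) qs \<phi> = (M *\<^sub>v v) \<bullet>c v"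
proof -
  let ?a = "length qs"
  define g where "g = inv_into (configs D (set qs)) (pull qs)"
  define v where "v = vec (D ^ ?a) (\<lambda>i. \<phi> (g (digits D ?a i)))"
  have g: "g (pull qs u) = u" if "u \<in> configs D (set qs)" for u
    unfolding g_def using that bij_betw_pull[OF assms(1), of D] by (simp add: bij_betw_def inv_into_f_f)
  have "form D (set qs) (kernel_of D ?a M) qs \<phi> =
      (\<Sum>u\<in>configs D (set qs). \<Sum>u'\<in>configs D (set qs).
        kernel_of D ?a M (pull qs u) (pull qs u') * \<phi> (g (pull qs u')) * cnj (\<phi> (g (pull qs u))))"
    unfolding form_def by (intro sum.cong refl) (simp add: g)
  also have "\<dots> = (\<Sum>x\<in>configs D {..<?a}. \<Sum>y\<in>configs D {..<?a}.
        kernel_of D ?a M x y * \<phi> (g y) * cnj (\<phi> (g x)))"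
    by (rule sum_sum_reindex_bij_betw[OF bij_betw_pull[OF assms(1)]])
  also have "\<dots> = (\<Sum>x\<in>configs D {..<?a}. \<Sum>y\<in>configs D {..<?a}.
        M $$ (place_value D ?a x, place_value D ?a y) * v $ place_value D ?a y * cnj (v $ place_value D ?a x))"
    by (intro sum.cong refl)
       (simp add: kernel_of_def v_def place_value_configs_less digits_place_value)
  also have "\<dots> = (\<Sum>i<D ^ ?a. \<Sum>j<D ^ ?a. M $$ (i, j) * v $ j * cnj (v $ i))"
    by (rule sum_sum_reindex_bij_betw[OF bij_betw_place_value[OF assms(2)]])
  also have "\<dots> = (M *\<^sub>v v) \<bullet>c v"
    using M by (simp add: scalar_prod_def v_def lessThan_atLeast0 sum_distrib_right mult_mat_vec_def)
  finally show ?thesis using that[of v] by (simp add: v_def)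
qed

section \<open>Product channels\<close>

lemma sum_rotate:
  "(\<Sum>a\<in>A. \<Sum>b\<in>B. \<Sum>c\<in>C. \<Sum>x\<in>X. F a b c x) = (\<Sum>x\<in>X. \<Sum>a\<in>A. \<Sum>b\<in>B. \<Sum>c\<in>C. F a b c x)"
proof -
  have "(\<Sum>b\<in>B. \<Sum>c\<in>C. \<Sum>x\<in>X. F a b c x) = (\<Sum>x\<in>X. \<Sum>b\<in>B. \<Sum>c\<in>C. F a b c x)" for a
  proof -
    have "(\<Sum>c\<in>C. \<Sum>x\<in>X. F a b c x) = (\<Sum>x\<in>X. \<Sum>c\<in>C. F a b c x)" for b by (rule sum.swap)
    then show ?thesis by (simp only:) (rule sum.swap)
  qed
  then show ?thesis by (simp only:) (rule sum.swap)
qed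

lemma sum_sum_prod_PiE:
  fixes F :: "'q \<Rightarrow> nat \<Rightarrow> nat \<Rightarrow> complex"
  assumes "finite U"
  shows "(\<Sum>w\<in>configs R U. \<Sum>y\<in>configs d U. \<Prod>q\<in>U. F q (w q) (y q)) = (\<Prod>q\<in>U. \<Sum>w<R. \<Sum>y<d. F q w y)"
proof -
  have "(\<Sum>w\<in>configs R U. \<Sum>y\<in>configs d U. \<Prod>q\<in>U. F q (w q) (y q)) =
      (\<Sum>w\<in>configs R U. \<Prod>q\<in>U. \<Sum>y<d. F q (w q) y)"
    using assms by (intro sum.cong refl) (rule prod_sum_PiE[symmetric], auto)
  also have "\<dots> = (\<Prod>q\<in>U. \<Sum>w<R. \<Sum>y<d. F q w y)"
    using assms by (intro prod_sum_PiE[symmetric]) auto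
  finally show ?thesis .
qed

lemma prod_of_bool: "finite U \<Longrightarrow> (\<Prod>q\<in>U. of_bool (P q) :: complex) = of_bool (\<forall>q\<in>U. P q)"
  by (induction U rule: finite_induct) auto

lemma configs_eq_iff:
  "x \<in> configs D U \<Longrightarrow> x' \<in> configs D U \<Longrightarrow> x = x' \<longleftrightarrow> (\<forall>q\<in>U. x q = x' q)"
  using PiE_ext by blast

lemma pull_merge: "set qs = T \<Longrightarrow> pull qs (merge T u v) = pull qs u"
  by (intro pull_cong) (simp add: merge_def)

text \<open>A channel from dimension \<open>m\<close> to dimension \<open>d\<close> given by
  \<open>R\<close> Kraus operators; \<open>K w y x\<close> is the entry of the operator with label
  \<open>w\<close> in row \<open>y\<close> and column \<open>x\<close>.\<close>

locale channel =
  fixes K :: "nat \<Rightarrow> nat \<Rightarrow> nat \<Rightarrow> complex" and R d m :: nat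
  assumes trace_preserving: "\<And>x x'. x < m \<Longrightarrow> x' < m \<Longrightarrow>
    (\<Sum>w<R. \<Sum>y<d. cnj (K w y x) * K w y x') = of_bool (x = x')"
begin

definition push :: "'q set \<Rightarrow> ('q \<Rightarrow> nat) \<Rightarrow> (('q \<Rightarrow> nat) \<Rightarrow> complex) \<Rightarrow> ('q \<Rightarrow> nat) \<Rightarrow> complex" where
  "push U w \<phi> y = (\<Sum>x\<in>configs m U. (\<Prod>q\<in>U. K (w q) (y q) (x q)) * \<phi> x)"

text \<open>The product channel in the Heisenberg picture. The kernel \<open>mw\<close> may depend
  on the outcomes \<open>w\<close>, which later allows a failed decoding to be charged.\<close>

definition dual_kernel :: "nat \<Rightarrow> ((nat \<Rightarrow> nat) \<Rightarrow> (nat \<Rightarrow> nat) \<Rightarrow> (nat \<Rightarrow> nat) \<Rightarrow> complex) \<Rightarrow>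
    (nat \<Rightarrow> nat) \<Rightarrow> (nat \<Rightarrow> nat) \<Rightarrow> complex" where
  "dual_kernel a mw x x' = (\<Sum>w\<in>configs R {..<a}. \<Sum>y\<in>configs d {..<a}. \<Sum>y'\<in>configs d {..<a}.
     mw w y y' * (\<Prod>l<a. cnj (K (w l) (y l) (x l)) * K (w l) (y' l) (x' l)))"

lemma trace_preserving_prod:
  assumes "finite U" "\<And>q. q \<in> U \<Longrightarrow> x q < m" "\<And>q. q \<in> U \<Longrightarrow> x' q < m"
  shows "(\<Sum>w\<in>configs R U. \<Sum>y\<in>configs d U. \<Prod>q\<in>U. cnj (K (w q) (y q) (x q)) * K (w q) (y q) (x' q)) =
    of_bool (\<forall>q\<in>U. x q = x' q)"
  unfolding sum_sum_prod_PiE[OF assms(1), of "\<lambda>q w y. cnj (K w y (x q)) * K w y (x' q)"]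
  using assms by (simp add: trace_preserving prod_of_bool)

text \<open>The sums factor into a part on the clause and a part off it. Off the clause the
  condition forces \<open>y' = y\<close>, and trace preservation reduces that factor to a
  delta.\<close>

lemma dual_kernel_clause:
  assumes U: "finite U" "set qs \<subseteq> U" "distinct qs" and x: "x \<in> configs m U" "x' \<in> configs m U"
  shows "(\<Sum>w\<in>configs R U. \<Sum>y\<in>configs d U. \<Sum>y'\<in>configs d U.
      if \<forall>q\<in>U - set qs. y q = y' q then mw (pull qs w) (pull qs y) (pull qs y') *
        (\<Prod>q\<in>U. cnj (K (w q) (y q) (x q)) * K (w q) (y' q) (x' q)) else 0) =
    (if \<forall>q\<in>U - set qs. x q = x' q then dual_kernel (length qs) mw (pull qs x) (pull qs x') else 0)"
    (is "?L = ?R")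
proof -
  let ?T = "set qs" and ?V = "U - set qs"
  let ?f = "\<lambda>w y y' q. cnj (K (w q) (y q) (x q)) * K (w q) (y' q) (x' q)"
  have fin: "finite ?T" "finite ?V" using U by auto
  have prod_merge: "(\<Prod>q\<in>U. ?f (merge ?T w1 w2) (merge ?T y1 y2) (merge ?T y1' y2') q) =
      (\<Prod>q\<in>?T. ?f w1 y1 y1' q) * (\<Prod>q\<in>?V. ?f w2 y2 y2' q)" for w1 w2 y1 y2 y1' y2'
  proof -
    have "(\<Prod>q\<in>U. ?f (merge ?T w1 w2) (merge ?T y1 y2) (merge ?T y1' y2') q) =
      (\<Prod>q\<in>?T. ?f (merge ?T w1 w2) (merge ?T y1 y2) (merge ?T y1' y2') q) *
      (\<Prod>q\<in>?V. ?f (merge ?T w1 w2) (merge ?T y1 y2) (merge ?T y1' y2') q)"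
      by (subst prod.subset_diff[OF U(2,1)]) (rule mult.commute)
    also have "\<dots> = (\<Prod>q\<in>?T. ?f w1 y1 y1' q) * (\<Prod>q\<in>?V. ?f w2 y2 y2' q)"
      by (intro arg_cong2[where f = "(*)"] prod.cong refl) (auto simp: merge_def)
    finally show ?thesis .
  qed
  let ?A = "\<lambda>w1 y1 y1'. mw (pull qs w1) (pull qs y1) (pull qs y1') * (\<Prod>q\<in>?T. ?f w1 y1 y1' q)"
  let ?B = "\<lambda>w2 y2 y2'. \<Prod>q\<in>?V. ?f w2 y2 y2' q"
  have "?L = (\<Sum>w1\<in>configs R ?T. \<Sum>w2\<in>configs R ?V. \<Sum>y1\<in>configs d ?T. \<Sum>y2\<in>configs d ?V.
      \<Sum>y1'\<in>configs d ?T. \<Sum>y2'\<in>configs d ?V. if y2' = y2 then ?A w1 y1 y1' * ?B w2 y2 y2' else 0)"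
    unfolding sum_PiE_split[OF U(2)]
  proof (intro sum.cong refl)
    fix w1 w2 y1 y2 y1' y2'
    assume y: "y2 \<in> configs d ?V" "y2' \<in> configs d ?V"
    have "(\<forall>q\<in>?V. merge ?T y1 y2 q = merge ?T y1' y2' q) \<longleftrightarrow> y2' = y2"
      using configs_eq_iff[OF y(2,1)] by (auto simp: merge_def)
    then show "(if \<forall>q\<in>?V. merge ?T y1 y2 q = merge ?T y1' y2' q
        then mw (pull qs (merge ?T w1 w2)) (pull qs (merge ?T y1 y2)) (pull qs (merge ?T y1' y2')) *
          (\<Prod>q\<in>U. ?f (merge ?T w1 w2) (merge ?T y1 y2) (merge ?T y1' y2') q) else 0) =
        (if y2' = y2 then ?A w1 y1 y1' * ?B w2 y2 y2' else 0)"
      unfolding pull_merge[OF refl] prod_merge by (simp add: mult.assoc)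
  qed
  also have "\<dots> = (\<Sum>w1\<in>configs R ?T. \<Sum>w2\<in>configs R ?V. \<Sum>y1\<in>configs d ?T. \<Sum>y2\<in>configs d ?V.
      \<Sum>y1'\<in>configs d ?T. ?A w1 y1 y1' * ?B w2 y2 y2)"
    using fin by (simp add: sum.delta)
  also have "\<dots> = (\<Sum>w1\<in>configs R ?T. \<Sum>w2\<in>configs R ?V. \<Sum>y1\<in>configs d ?T. \<Sum>y2\<in>configs d ?V.
      (\<Sum>y1'\<in>configs d ?T. ?A w1 y1 y1') * ?B w2 y2 y2)"
    by (simp only: sum_distrib_right)
  also have "\<dots> = (\<Sum>w1\<in>configs R ?T. \<Sum>w2\<in>configs R ?V. (\<Sum>y1\<in>configs d ?T. \<Sum>y1'\<in>configs d ?T. ?A w1 y1 y1') *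
      (\<Sum>y2\<in>configs d ?V. ?B w2 y2 y2))"
    by (simp only: sum_product)
  also have "\<dots> = (\<Sum>w1\<in>configs R ?T. \<Sum>y1\<in>configs d ?T. \<Sum>y1'\<in>configs d ?T. ?A w1 y1 y1') *
      (\<Sum>w2\<in>configs R ?V. \<Sum>y2\<in>configs d ?V. ?B w2 y2 y2)"
    by (simp only: sum_product)
  also have "(\<Sum>w2\<in>configs R ?V. \<Sum>y2\<in>configs d ?V. ?B w2 y2 y2) = of_bool (\<forall>q\<in>?V. x q = x' q)"
    using x by (intro trace_preserving_prod fin) (auto dest: PiE_mem)
  also have "(\<Sum>w1\<in>configs R ?T. \<Sum>y1\<in>configs d ?T. \<Sum>y1'\<in>configs d ?T. ?A w1 y1 y1') =
      dual_kernel (length qs) mw (pull qs x) (pull qs x')"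
  proof -
    let ?C = "\<lambda>w y y'. mw w y y' *
        (\<Prod>l<length qs. cnj (K (w l) (y l) (pull qs x l)) * K (w l) (y' l) (pull qs x' l))"
    have "?A w y y' = ?C (pull qs w) (pull qs y) (pull qs y')" for w y y'
      unfolding prod_set_list[OF U(3)] by (intro arg_cong2[where f = "(*)"] prod.cong refl) (simp_all add: pull_def)
    then have "(\<Sum>w1\<in>configs R ?T. \<Sum>y1\<in>configs d ?T. \<Sum>y1'\<in>configs d ?T. ?A w1 y1 y1') =
      (\<Sum>w1\<in>configs R ?T. \<Sum>y1\<in>configs d ?T. \<Sum>y1'\<in>configs d ?T. ?C (pull qs w1) (pull qs y1) (pull qs y1'))"
      by (simp only:)
    also have "\<dots> = (\<Sum>w1\<in>configs R ?T. \<Sum>y1\<in>configs d {..<length qs}. \<Sum>y1'\<in>configs d {..<length qs}. ?C (pull qs w1) y1 y1')"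
      by (intro sum.cong refl sum_sum_reindex_bij_betw[OF bij_betw_pull[OF U(3)]])
    also have "\<dots> = (\<Sum>w1\<in>configs R {..<length qs}. \<Sum>y1\<in>configs d {..<length qs}. \<Sum>y1'\<in>configs d {..<length qs}. ?C w1 y1 y1')"
      by (rule sum_pull[OF U(3)])
    finally show ?thesis by (simp only: dual_kernel_def)
  qed
  finally show ?thesis by simp
qed

text \<open>
  The channel acts trivially on the sites outside a clause, so pushing a vector through it changes
  the energy of the clause only by the dual channel on the clause.
\<close>

lemma sum_form_push:
  assumes U: "finite U" "set qs \<subseteq> U" "distinct qs"
  shows "(\<Sum>w\<in>configs R U. form d U (mw (pull qs w)) qs (push U w \<phi>)) =
    form m U (dual_kernel (length qs) mw) qs \<phi>"
proof -
  let ?X = "configs m U" and ?Y = "configs d U" and ?W = "configs R U"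
  let ?f = "\<lambda>w y y' x x'. if \<forall>q\<in>U - set qs. y q = y' q then mw (pull qs w) (pull qs y) (pull qs y') *
        (\<Prod>q\<in>U. cnj (K (w q) (y q) (x q)) * K (w q) (y' q) (x' q)) else 0"
  have e: "(if \<forall>q\<in>U - set qs. y q = y' q then mw (pull qs w) (pull qs y) (pull qs y') *
        push U w \<phi> y' * cnj (push U w \<phi> y) else 0) =
      (\<Sum>x\<in>?X. \<Sum>x'\<in>?X. ?f w y y' x x' * (\<phi> x' * cnj (\<phi> x)))" for w y y'
  proof -
    have p: "cnj (push U w \<phi> y) * push U w \<phi> y' =
        (\<Sum>x\<in>?X. \<Sum>x'\<in>?X. (\<Prod>q\<in>U. cnj (K (w q) (y q) (x q)) * K (w q) (y' q) (x' q)) * (\<phi> x' * cnj (\<phi> x)))"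
      unfolding push_def cnj_sum sum_product by (intro sum.cong refl) (simp add: prod.distrib mult_ac)
    show ?thesis
    proof (cases "\<forall>q\<in>U - set qs. y q = y' q")
      case True
      then show ?thesis using p
        by (simp add: sum_distrib_left mult.assoc mult.commute[of "push U w \<phi> y'"])
    next
      case False
      show ?thesis by (simp only: False if_False mult_zero_left sum.neutral_const)
    qed
  qed
  have "(\<Sum>w\<in>?W. form d U (mw (pull qs w)) qs (push U w \<phi>)) =
      (\<Sum>w\<in>?W. \<Sum>y\<in>?Y. \<Sum>y'\<in>?Y. \<Sum>x\<in>?X. \<Sum>x'\<in>?X. ?f w y y' x x' * (\<phi> x' * cnj (\<phi> x)))"
    unfolding form_def e ..
  also have "\<dots> = (\<Sum>x\<in>?X. \<Sum>w\<in>?W. \<Sum>y\<in>?Y. \<Sum>y'\<in>?Y. \<Sum>x'\<in>?X. ?f w y y' x x' * (\<phi> x' * cnj (\<phi> x)))"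
    by (rule sum_rotate)
  also have "\<dots> = (\<Sum>x\<in>?X. \<Sum>x'\<in>?X. \<Sum>w\<in>?W. \<Sum>y\<in>?Y. \<Sum>y'\<in>?Y. ?f w y y' x x' * (\<phi> x' * cnj (\<phi> x)))"
    by (intro sum.cong refl sum_rotate)
  also have "\<dots> = (\<Sum>x\<in>?X. \<Sum>x'\<in>?X. (\<Sum>w\<in>?W. \<Sum>y\<in>?Y. \<Sum>y'\<in>?Y. ?f w y y' x x') * (\<phi> x' * cnj (\<phi> x)))"
    by (simp only: sum_distrib_right)
  also have "\<dots> = (\<Sum>x\<in>?X. \<Sum>x'\<in>?X. (if \<forall>q\<in>U - set qs. x q = x' q
      then dual_kernel (length qs) mw (pull qs x) (pull qs x') else 0) * (\<phi> x' * cnj (\<phi> x)))"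
    by (intro sum.cong refl arg_cong2[where f = "(*)"] dual_kernel_clause[OF U])
  also have "\<dots> = form m U (dual_kernel (length qs) mw) qs \<phi>"
    unfolding form_def by (intro sum.cong refl) (simp add: mult.assoc)
  finally show ?thesis .
qed

text \<open>Applying to each outcome the adjoint of its Kraus operator and summing gives the
  identity, by trace preservation. The vector is therefore determined by its outcomes; this is used
  when all outcomes but one vanish.\<close>

lemma push_reconstruct:
  assumes "finite U" "x \<in> configs m U"
  shows "\<phi> x = (\<Sum>w\<in>configs R U. \<Sum>y\<in>configs d U. (\<Prod>q\<in>U. cnj (K (w q) (y q) (x q))) * push U w \<phi> y)"
proof -
  have "(\<Sum>w\<in>configs R U. \<Sum>y\<in>configs d U. (\<Prod>q\<in>U. cnj (K (w q) (y q) (x q))) * push U w \<phi> y) =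
      (\<Sum>w\<in>configs R U. \<Sum>y\<in>configs d U. \<Sum>x'\<in>configs m U.
        (\<Prod>q\<in>U. cnj (K (w q) (y q) (x q)) * K (w q) (y q) (x' q)) * \<phi> x')"
    by (simp add: push_def sum_distrib_left prod.distrib mult.assoc)
  also have "\<dots> = (\<Sum>w\<in>configs R U. \<Sum>x'\<in>configs m U. \<Sum>y\<in>configs d U.
        (\<Prod>q\<in>U. cnj (K (w q) (y q) (x q)) * K (w q) (y q) (x' q)) * \<phi> x')"
    by (intro sum.cong refl sum.swap)
  also have "\<dots> = (\<Sum>x'\<in>configs m U. \<Sum>w\<in>configs R U. \<Sum>y\<in>configs d U.
        (\<Prod>q\<in>U. cnj (K (w q) (y q) (x q)) * K (w q) (y q) (x' q)) * \<phi> x')"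
    by (rule sum.swap)
  also have "\<dots> = (\<Sum>x'\<in>configs m U. of_bool (\<forall>q\<in>U. x q = x' q) * \<phi> x')"
  proof (intro sum.cong refl)
    fix x' assume x': "x' \<in> configs m U"
    have "(\<Sum>w\<in>configs R U. \<Sum>y\<in>configs d U. (\<Prod>q\<in>U. cnj (K (w q) (y q) (x q)) * K (w q) (y q) (x' q)) * \<phi> x') =
       (\<Sum>w\<in>configs R U. \<Sum>y\<in>configs d U. \<Prod>q\<in>U. cnj (K (w q) (y q) (x q)) * K (w q) (y q) (x' q)) * \<phi> x'"
      by (simp only: sum_distrib_right)
    also have "\<dots> = of_bool (\<forall>q\<in>U. x q = x' q) * \<phi> x'"
      using assms x' by (subst trace_preserving_prod) (auto dest: PiE_mem)
    finally show "(\<Sum>w\<in>configs R U. \<Sum>y\<in>configs d U.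
        (\<Prod>q\<in>U. cnj (K (w q) (y q) (x q)) * K (w q) (y q) (x' q)) * \<phi> x') = of_bool (\<forall>q\<in>U. x q = x' q) * \<phi> x'" .
  qed
  also have "\<dots> = (\<Sum>x'\<in>configs m U. if x = x' then \<phi> x' else 0)"
    by (intro sum.cong refl) (simp add: configs_eq_iff[OF assms(2)])
  also have "\<dots> = \<phi> x" using assms by (simp add: sum.delta)
  finally show ?thesis by simp
qed

end

text \<open>
  The code given by an isometry \<open>E\<close>, with a decoding channel: label 0 decodes, all other labels
  report a state orthogonal to the code.
\<close>

locale code =
  fixes E :: "nat \<Rightarrow> nat \<Rightarrow> complex" and d m :: nat
  assumes d_pos: "0 < d"
    and isometry: "\<And>y y'. y < d \<Longrightarrow> y' < d \<Longrightarrow> (\<Sum>x<m. cnj (E x y) * E x y') = of_bool (y = y')"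
begin

text \<open>The operator with label \<open>Suc j\<close> takes row \<open>j\<close> of the projector
  onto the complement of the code and outputs basis state 0. There is one such label for each of the
  \<open>m\<close> rows, hence \<open>Suc m\<close> labels in all.\<close>

definition K :: "nat \<Rightarrow> nat \<Rightarrow> nat \<Rightarrow> complex" where
  "K w y x = (case w of 0 \<Rightarrow> cnj (E x y)
     | Suc j \<Rightarrow> if y = 0 then of_bool (j = x) - (\<Sum>t<d. E j t * cnj (E x t)) else 0)"

lemma K_simps [simp]: "K 0 y x = cnj (E x y)"
  "K (Suc j) y x = (if y = 0 then of_bool (j = x) - (\<Sum>t<d. E j t * cnj (E x t)) else 0)"
  by (simp_all add: K_def)

text \<open>On the code, label 0 inverts the isometry, and the complementary projector of the other
  labels vanishes.\<close>

lemma K_encode: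
  assumes "w < Suc m" "y < d" "y' < d"
  shows "(\<Sum>x<m. K w y x * E x y') = of_bool (w = 0 \<and> y = y')"
proof (cases w)
  case 0
  then show ?thesis using isometry[OF assms(2,3)] by simp
next
  case (Suc j)
  have "(\<Sum>x<m. (of_bool (j = x) - (\<Sum>t<d. E j t * cnj (E x t))) * E x y') =
      (\<Sum>x<m. if j = x then E x y' else 0) - (\<Sum>x<m. \<Sum>t<d. E j t * (cnj (E x t) * E x y'))"
    unfolding sum_subtractf[symmetric]
    by (intro sum.cong refl) (simp add: left_diff_distrib sum_distrib_right mult.assoc)
  also have "\<dots> = E j y' - (\<Sum>t<d. \<Sum>x<m. E j t * (cnj (E x t) * E x y'))"
    using Suc assms(1) by (subst sum.swap) simp
  also have "(\<Sum>t<d. \<Sum>x<m. E j t * (cnj (E x t) * E x y')) = (\<Sum>t<d. E j t * of_bool (t = y'))"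
    using assms(3) by (intro sum.cong refl) (simp add: isometry flip: sum_distrib_left)
  also have "\<dots> = E j y'" using assms(3) by (simp add: of_bool_def if_distrib cong: if_cong)
  finally show ?thesis using Suc by (cases "y = 0") simp_all
qed

text \<open>With \<open>P\<close> the projector onto the code, label 0 contributes \<open>P\<close>
  and the other labels together contribute the square of \<open>1 - P\<close>. This is
  \<open>1 - P\<close> because the isometry makes \<open>P\<close> idempotent.\<close>

sublocale channel K "Suc m" d m
proof
  fix x x' assume x: "x < m" "x' < m"
  let ?P = "\<lambda>i j. \<Sum>t<d. E i t * cnj (E j t)"
  have cnjP: "cnj (?P i j) = ?P j i" for i j by (simp add: mult.commute)
  have "(\<Sum>y<d. cnj (K (Suc j) y x) * K (Suc j) y x') =
      (of_bool (j = x) - ?P x j) * (of_bool (j = x') - ?P j x')" for j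
  proof -
    have "(\<Sum>y<d. cnj (K (Suc j) y x) * K (Suc j) y x') =
        (\<Sum>y<d. if y = 0 then cnj (of_bool (j = x) - ?P j x) * (of_bool (j = x') - ?P j x') else 0)"
      by (intro sum.cong refl) auto
    also have "\<dots> = cnj (of_bool (j = x) - ?P j x) * (of_bool (j = x') - ?P j x')"
      using d_pos by simp
    finally show ?thesis by (simp add: mult.commute)
  qed
  then have "(\<Sum>w<Suc m. \<Sum>y<d. cnj (K w y x) * K w y x') =
      ?P x x' + (\<Sum>j<m. (of_bool (j = x) - ?P x j) * (of_bool (j = x') - ?P j x'))"
    by (simp only: sum.lessThan_Suc_shift) (simp add: mult.commute)
  also have "(\<Sum>j<m. (of_bool (j = x) - ?P x j) * (of_bool (j = x') - ?P j x')) =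
      of_bool (x = x') - ?P x x' - ?P x x' + (\<Sum>j<m. ?P x j * ?P j x')"
  proof -
    have "(\<Sum>j<m. (of_bool (j = x) - ?P x j) * (of_bool (j = x') - ?P j x')) =
        (\<Sum>j<m. (if j = x then of_bool (j = x') else 0) - (if j = x then ?P j x' else 0)
           - (if j = x' then ?P x j else 0) + ?P x j * ?P j x')"
      by (intro sum.cong refl) (auto simp: algebra_simps)
    also have "\<dots> = (\<Sum>j<m. if j = x then of_bool (j = x') else 0) - (\<Sum>j<m. if j = x then ?P j x' else 0)
           - (\<Sum>j<m. if j = x' then ?P x j else 0) + (\<Sum>j<m. ?P x j * ?P j x')"
      by (simp only: sum.distrib sum_subtractf)
    also have "\<dots> = of_bool (x = x') - ?P x x' - ?P x x' + (\<Sum>j<m. ?P x j * ?P j x')"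
      using x by simp
    finally show ?thesis .
  qed
  also have "(\<Sum>j<m. ?P x j * ?P j x') = ?P x x'"
  proof -
    have "(\<Sum>j<m. ?P x j * ?P j x') = (\<Sum>j<m. \<Sum>t<d. \<Sum>t'<d. E x t * cnj (E x' t') * (cnj (E j t) * E j t'))"
      unfolding sum_product by (intro sum.cong refl) (simp add: mult_ac)
    also have "\<dots> = (\<Sum>t<d. \<Sum>j<m. \<Sum>t'<d. E x t * cnj (E x' t') * (cnj (E j t) * E j t'))"
      by (rule sum.swap)
    also have "\<dots> = (\<Sum>t<d. \<Sum>t'<d. \<Sum>j<m. E x t * cnj (E x' t') * (cnj (E j t) * E j t'))"
      by (intro sum.cong refl sum.swap)
    also have "\<dots> = (\<Sum>t<d. \<Sum>t'<d. E x t * cnj (E x' t') * of_bool (t = t'))"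
      by (intro sum.cong refl) (simp add: isometry flip: sum_distrib_left)
    also have "\<dots> = (\<Sum>t<d. \<Sum>t'<d. if t = t' then E x t * cnj (E x' t') else 0)"
      by (intro sum.cong refl) auto
    also have "\<dots> = ?P x x'" by (intro sum.cong refl) simp
    finally show ?thesis .
  qed
  finally show "(\<Sum>w<Suc m. \<Sum>y<d. cnj (K w y x) * K w y x') = of_bool (x = x')" by simp
qed

definition encode :: "'q set \<Rightarrow> (('q \<Rightarrow> nat) \<Rightarrow> complex) \<Rightarrow> ('q \<Rightarrow> nat) \<Rightarrow> complex" where
  "encode U \<phi> x = (\<Sum>y\<in>configs d U. (\<Prod>q\<in>U. E (x q) (y q)) * \<phi> y)"

lemma push_encode:
  assumes "finite U" "w \<in> configs (Suc m) U" "y \<in> configs d U"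
  shows "push U w (encode U \<phi>) y = (if \<forall>q\<in>U. w q = 0 then \<phi> y else 0)"
proof -
  have "push U w (encode U \<phi>) y = (\<Sum>x\<in>configs m U. \<Sum>y'\<in>configs d U.
      (\<Prod>q\<in>U. K (w q) (y q) (x q) * E (x q) (y' q)) * \<phi> y')"
    by (simp only: push_def encode_def sum_distrib_left prod.distrib mult.assoc)
  also have "\<dots> = (\<Sum>y'\<in>configs d U. \<Sum>x\<in>configs m U.
      (\<Prod>q\<in>U. K (w q) (y q) (x q) * E (x q) (y' q)) * \<phi> y')"
    by (rule sum.swap)
  also have "\<dots> = (\<Sum>y'\<in>configs d U. (\<Prod>q\<in>U. \<Sum>x<m. K (w q) (y q) x * E x (y' q)) * \<phi> y')"
    using assms(1) by (intro sum.cong refl) (simp add: prod_sum_PiE flip: sum_distrib_right)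
  also have "\<dots> = (\<Sum>y'\<in>configs d U. (\<Prod>q\<in>U. of_bool (w q = 0 \<and> y q = y' q)) * \<phi> y')"
  proof (intro sum.cong refl arg_cong2[where f = "(*)"] prod.cong)
    fix y' q assume "y' \<in> configs d U" "q \<in> U"
    then have "w q < Suc m" "y q < d" "y' q < d" using assms by (auto simp: PiE_iff)
    then show "(\<Sum>x<m. K (w q) (y q) x * E x (y' q)) = of_bool (w q = 0 \<and> y q = y' q)" by (rule K_encode)
  qed
  also have "\<dots> = (\<Sum>y'\<in>configs d U. if y' = y then if \<forall>q\<in>U. w q = 0 then \<phi> y else 0 else 0)"
  proof (intro sum.cong refl)
    fix y' assume "y' \<in> configs d U"
    then have "y' = y \<longleftrightarrow> (\<forall>q\<in>U. y' q = y q)" using configs_eq_iff assms(3) by blast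
    then show "(\<Prod>q\<in>U. of_bool (w q = 0 \<and> y q = y' q)) * \<phi> y' =
        (if y' = y then if \<forall>q\<in>U. w q = 0 then \<phi> y else 0 else 0)"
      unfolding prod_of_bool[OF assms(1)] by auto
  qed
  also have "\<dots> = (if \<forall>q\<in>U. w q = 0 then \<phi> y else 0)"
    using assms by (simp add: sum.delta)
  finally show ?thesis .
qed

end

section \<open>Attained energies\<close>

lemma form_cong_vector:
  "(\<And>u. u \<in> configs D U \<Longrightarrow> \<phi> u = \<phi>' u) \<Longrightarrow> form D U m qs \<phi> = form D U m qs \<phi>'"
  unfolding form_def by (intro sum.cong refl if_cong) simp_all

lemma norm_form_cong_vector:
  "(\<And>u. u \<in> configs D U \<Longrightarrow> \<phi> u = \<phi>' u) \<Longrightarrow> norm_form D U \<phi> = norm_form D U \<phi>'"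
  unfolding norm_form_def by (intro sum.cong refl) simp_all

lemma form_zero [simp]: "form D U m qs (\<lambda>_. 0) = 0"
  by (simp add: form_def)

lemma norm_form_zero [simp]: "norm_form D U (\<lambda>_. 0) = 0"
  by (simp add: norm_form_def)

lemma Re_norm_form: "Re (norm_form D U \<phi>) = (\<Sum>u\<in>configs D U. (cmod (\<phi> u))\<^sup>2)"
  unfolding norm_form_def Re_sum
  by (intro sum.cong refl) (simp add: cmod_power2, simp add: power2_eq_square)

lemma norm_form_nonneg: "0 \<le> Re (norm_form D U \<phi>)"
  unfolding Re_norm_form by (simp add: sum_nonneg)

lemma norm_form_eq_0D:
  assumes "Re (norm_form D U \<phi>) = 0" "finite U" "u \<in> configs D U" shows "\<phi> u = 0"
  using assms unfolding Re_norm_form by (subst (asm) sum_nonneg_eq_0_iff) auto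

text \<open>Slices of a state and outcomes of a channel form unnormalized ensembles. Some member of
  positive norm does no worse than the average, which replaces a mixture by a pure state.\<close>

lemma exists_average:
  fixes t n :: "'a \<Rightarrow> real"
  assumes A: "finite A" and le: "sum t A \<le> \<mu> * sum n A" and pos: "0 < sum n A"
    and n: "\<And>a. a \<in> A \<Longrightarrow> 0 \<le> n a" and t: "\<And>a. a \<in> A \<Longrightarrow> n a = 0 \<Longrightarrow> 0 \<le> t a"
  shows "\<exists>a\<in>A. 0 < n a \<and> t a \<le> \<mu> * n a"
proof (rule ccontr)
  assume *: "\<not> (\<exists>a\<in>A. 0 < n a \<and> t a \<le> \<mu> * n a)"
  obtain a where a: "a \<in> A" "0 < n a" using pos n by (meson linorder_not_less sum_nonpos)
  have "sum (\<lambda>a. \<mu> * n a) A < sum t A"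
  proof (rule sum_strict_mono_ex1[OF A])
    show "\<forall>x\<in>A. \<mu> * n x \<le> t x"
    proof
      fix x assume x: "x \<in> A"
      then show "\<mu> * n x \<le> t x"
        using * n[OF x] t[OF x] by (cases "n x = 0") (auto simp: not_le less_eq_real_def)
    qed
    show "\<exists>x\<in>A. \<mu> * n x < t x" using * a by (intro bexI[of _ a]) auto
  qed
  with le show False by (simp add: sum_distrib_left)
qed

definition energy :: "nat \<Rightarrow> nat \<Rightarrow> (complex mat \<times> nat list) list \<Rightarrow> complex vec \<Rightarrow> real" where
  "energy e n ops \<psi> = (\<Sum>(M, qs)\<leftarrow>ops. Re ((act_on e n M qs *\<^sub>v \<psi>) \<bullet>c \<psi>))"

text \<open>A bound on the Rayleigh quotient without division, so that members of unnormalized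
  ensembles can be used as they are.\<close>

definition attains :: "nat \<Rightarrow> nat \<Rightarrow> (complex mat \<times> nat list) list \<Rightarrow> real \<Rightarrow> bool" where
  "attains e n ops \<mu> \<longleftrightarrow> (\<exists>\<psi>\<in>carrier_vec (e ^ n). 0 < Re (\<psi> \<bullet>c \<psi>) \<and>
     energy e n ops \<psi> \<le> \<mu> * Re (\<psi> \<bullet>c \<psi>))"

definition form_energy :: "nat \<Rightarrow> 'q set \<Rightarrow> (complex mat \<times> 'q list) list \<Rightarrow> (('q \<Rightarrow> nat) \<Rightarrow> complex) \<Rightarrow> real" where
  "form_energy D U ops \<phi> = (\<Sum>(M, qs)\<leftarrow>ops. Re (form D U (kernel_of D (length qs) M) qs \<phi>))"

definition form_attains :: "nat \<Rightarrow> 'q set \<Rightarrow> (complex mat \<times> 'q list) list \<Rightarrow> real \<Rightarrow> bool" where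
  "form_attains D U ops \<mu> \<longleftrightarrow> (\<exists>\<phi>. 0 < Re (norm_form D U \<phi>) \<and>
     form_energy D U ops \<phi> \<le> \<mu> * Re (norm_form D U \<phi>))"

lemma form_energy_cong_vector:
  "(\<And>u. u \<in> configs D U \<Longrightarrow> \<phi> u = \<phi>' u) \<Longrightarrow> form_energy D U ops \<phi> = form_energy D U ops \<phi>'"
  unfolding form_energy_def using form_cong_vector[where D = D and U = U and \<phi> = \<phi> and \<phi>' = \<phi>'] by simp

lemma form_energy_zero [simp]: "form_energy D U ops (\<lambda>_. 0) = 0"
  by (simp add: form_energy_def case_prod_unfold)

lemma form_energy_null:
  "Re (norm_form D U \<phi>) = 0 \<Longrightarrow> finite U \<Longrightarrow> form_energy D U ops \<phi> = 0"
  using form_energy_cong_vector[where D = D and U = U and \<phi> = \<phi> and \<phi>' = "\<lambda>_. 0"] norm_form_eq_0D[of D U \<phi>]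
  by simp

lemma form_attains_average:
  assumes "finite A" "finite U" "(\<Sum>a\<in>A. form_energy D U ops (\<phi> a)) \<le> \<mu> * (\<Sum>a\<in>A. Re (norm_form D U (\<phi> a)))"
    and "0 < (\<Sum>a\<in>A. Re (norm_form D U (\<phi> a)))"
  shows "form_attains D U ops \<mu>"
proof -
  have "\<exists>a\<in>A. 0 < Re (norm_form D U (\<phi> a)) \<and>
      form_energy D U ops (\<phi> a) \<le> \<mu> * Re (norm_form D U (\<phi> a))"
    by (rule exists_average) (use assms form_energy_null[OF _ assms(2)] in \<open>simp_all add: norm_form_nonneg\<close>)
  then show ?thesis unfolding form_attains_def by blast
qed

lemma sum_list_sum_swap:
  "(\<Sum>x\<leftarrow>xs. \<Sum>a\<in>A. (f x a :: real)) = (\<Sum>a\<in>A. \<Sum>x\<leftarrow>xs. f x a)"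
  by (induction xs) (simp_all add: sum.distrib)

context block_system
begin

definition place_ops :: "(complex mat \<times> 'q list) list \<Rightarrow> (complex mat \<times> nat list) list" where
  "place_ops ops = map (\<lambda>(M, qs). (M, concat (map \<beta> qs))) ops"

lemma energy_place_ops:
  assumes "\<psi> \<in> carrier_vec (e ^ n)" "\<forall>(M, qs)\<in>set ops. set qs \<subseteq> U"
  shows "energy e n (place_ops ops) \<psi> =
    (\<Sum>z\<in>configs e rest. form_energy (e ^ s) U ops (\<lambda>u. \<psi> $ enc u z))"
proof -
  have "energy e n (place_ops ops) \<psi> =
      (\<Sum>(M, qs)\<leftarrow>ops. \<Sum>z\<in>configs e rest. Re (form (e ^ s) U (kernel_of (e ^ s) (length qs) M) qs (\<lambda>u. \<psi> $ enc u z)))"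
    unfolding energy_def place_ops_def map_map
    using act_on_form[OF assms(1)] assms(2)
    by (intro arg_cong[where f = sum_list] map_cong refl) (auto simp: Re_sum)
  also have "\<dots> = (\<Sum>z\<in>configs e rest. form_energy (e ^ s) U ops (\<lambda>u. \<psi> $ enc u z))"
    unfolding form_energy_def case_prod_unfold by (rule sum_list_sum_swap)
  finally show ?thesis .
qed

text \<open>A state splits into slices, one for each value of the qubits in no block, and energy and
  norm are sums over the slices. Some slice is good enough by averaging; conversely a vector on the
  blocks extends to a state with a single nonzero slice.\<close>

lemma attains_iff:
  assumes "\<forall>(M, qs)\<in>set ops. set qs \<subseteq> U"
  shows "attains e n (place_ops ops) \<mu> \<longleftrightarrow> form_attains (e ^ s) U ops \<mu>"
proof
  assume "attains e n (place_ops ops) \<mu>"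
  then obtain \<psi> where psi: "\<psi> \<in> carrier_vec (e ^ n)" "0 < Re (\<psi> \<bullet>c \<psi>)"
    "energy e n (place_ops ops) \<psi> \<le> \<mu> * Re (\<psi> \<bullet>c \<psi>)" unfolding attains_def by blast
  show "form_attains (e ^ s) U ops \<mu>"
    by (rule form_attains_average[of "configs e rest" _ _ _ "\<lambda>z u. \<psi> $ enc u z"])
      (use psi finite_U in \<open>simp_all add: energy_place_ops[OF psi(1) assms] norm_configs[OF psi(1)] Re_sum\<close>)
next
  assume "form_attains (e ^ s) U ops \<mu>"
  then obtain \<phi> where phi: "0 < Re (norm_form (e ^ s) U \<phi>)"
    "form_energy (e ^ s) U ops \<phi> \<le> \<mu> * Re (norm_form (e ^ s) U \<phi>)" unfolding form_attains_def by blast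
  \<comment> \<open>The qubits in no block are put into the basis state 0; the energy does not
    depend on this choice.\<close>
  define z0 where "z0 = (\<lambda>p\<in>rest. 0 :: nat)"
  have z0: "z0 \<in> configs e rest" using e_pos by (auto simp: z0_def)
  define \<psi> where "\<psi> = vec (e ^ n) (\<lambda>i. if snd (dec i) = z0 then \<phi> (fst (dec i)) else 0)"
  have psi: "\<psi> \<in> carrier_vec (e ^ n)" by (simp add: \<psi>_def)
  have slice: "\<psi> $ enc u z = (if z = z0 then \<phi> u else 0)"
    if "u \<in> configs (e ^ s) U" "z \<in> configs e rest" for u z
    using that dec_enc[OF that] enc_less[OF that] by (auto simp: \<psi>_def)
  have N: "norm_form (e ^ s) U (\<lambda>u. \<psi> $ enc u z) = (if z = z0 then norm_form (e ^ s) U \<phi> else 0)"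
    if "z \<in> configs e rest" for z
    using norm_form_cong_vector[where D = "e ^ s" and U = U and \<phi> = "\<lambda>u. \<psi> $ enc u z" and \<phi>' = "\<lambda>u. if z = z0 then \<phi> u else 0"] slice that
    by (cases "z = z0") auto
  have F: "form_energy (e ^ s) U ops (\<lambda>u. \<psi> $ enc u z) = (if z = z0 then form_energy (e ^ s) U ops \<phi> else 0)"
    if "z \<in> configs e rest" for z
    using form_energy_cong_vector[where D = "e ^ s" and U = U and \<phi> = "\<lambda>u. \<psi> $ enc u z" and \<phi>' = "\<lambda>u. if z = z0 then \<phi> u else 0"] slice that
    by (cases "z = z0") auto
  have "Re (\<psi> \<bullet>c \<psi>) = Re (norm_form (e ^ s) U \<phi>)"
    unfolding norm_configs[OF psi] using z0 by (simp add: N)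
  moreover have "energy e n (place_ops ops) \<psi> = form_energy (e ^ s) U ops \<phi>"
    unfolding energy_place_ops[OF psi assms] using z0 by (simp add: F)
  ultimately show "attains e n (place_ops ops) \<mu>"
    unfolding attains_def using phi psi by (intro bexI[of _ \<psi>]) simp_all
qed

end

text \<open>The norm is the form of the identity on the empty clause, so this is a special case of
  \<open>sum_form_push\<close>.\<close>

lemma (in channel) norm_form_push:
  assumes "finite U"
  shows "norm_form m U \<phi> = (\<Sum>w\<in>configs R U. norm_form d U (push U w \<phi>))"
proof -
  have "(\<Sum>w\<in>configs R U. norm_form d U (push U w \<phi>)) =
      (\<Sum>w\<in>configs R U. form d U (\<lambda>v v'. of_bool (v = v')) [] (push U w \<phi>))"
    using assms by (simp add: form_delta)
  also have "\<dots> = form m U (dual_kernel 0 (\<lambda>_ v v'. of_bool (v = v'))) [] \<phi>"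
    using sum_form_push[of U "[]" "\<lambda>_ v v'. of_bool (v = v')" \<phi>] assms by simp
  also have "\<dots> = form m U (\<lambda>v v'. of_bool (v = v')) [] \<phi>"
    by (rule form_cong) (simp_all add: dual_kernel_def)
  also have "\<dots> = norm_form m U \<phi>" using assms by (simp add: form_delta)
  finally show ?thesis by simp
qed

context code
begin

text \<open>
  The operator that simulates \<open>M\<close>: the energy of \<open>M\<close> after decoding, plus one for every outcome of
  the decoding outside the code.
\<close>

definition code_kernel :: "complex mat \<Rightarrow> nat \<Rightarrow> (nat \<Rightarrow> nat) \<Rightarrow> (nat \<Rightarrow> nat) \<Rightarrow> (nat \<Rightarrow> nat) \<Rightarrow> complex" where
  "code_kernel M a w v v' = kernel_of d a M v v' + of_bool (v = v' \<and> (\<exists>l<a. w l \<noteq> 0))"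

definition code_op :: "complex mat \<Rightarrow> nat \<Rightarrow> complex mat" where
  "code_op M a = mat (m ^ a) (m ^ a)
     (\<lambda>(i, j). dual_kernel a (code_kernel M a) (digits m a i) (digits m a j))"

lemma form_code_op:
  fixes qs :: "'q list"
  assumes U: "finite U" "set qs \<subseteq> U" "distinct qs"
  shows "form m U (kernel_of m (length qs) (code_op M (length qs))) qs \<phi> =
    (\<Sum>w\<in>configs (Suc m) U. form d U (kernel_of d (length qs) M) qs (push U w \<phi>) +
       (if \<exists>q\<in>set qs. w q \<noteq> 0 then norm_form d U (push U w \<phi>) else 0))"
proof -
  let ?a = "length qs"
  have "form m U (kernel_of m ?a (code_op M ?a)) qs \<phi> = form m U (dual_kernel ?a (code_kernel M ?a)) qs \<phi>"
    using U by (intro form_cong)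
      (simp_all add: kernel_of_def code_op_def place_value_configs_less digits_place_value)
  also have "\<dots> = (\<Sum>w\<in>configs (Suc m) U. form d U (code_kernel M ?a (pull qs w)) qs (push U w \<phi>))"
    by (rule sum_form_push[symmetric, OF U])
  also have "\<dots> = (\<Sum>w\<in>configs (Suc m) U. form d U (kernel_of d (length qs) M) qs (push U w \<phi>) +
       (if \<exists>q\<in>set qs. w q \<noteq> 0 then norm_form d U (push U w \<phi>) else 0))"
  proof (intro sum.cong refl)
    fix w :: "'q \<Rightarrow> nat"
    have e: "(\<exists>l<?a. pull qs w l \<noteq> 0) \<longleftrightarrow> (\<exists>q\<in>set qs. w q \<noteq> 0)"
      by (auto simp: pull_def set_conv_nth)
    have "form d U (code_kernel M ?a (pull qs w)) qs (push U w \<phi>) =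
        form d U (kernel_of d ?a M) qs (push U w \<phi>) +
        form d U (\<lambda>v v'. of_bool (v = v' \<and> (\<exists>q\<in>set qs. w q \<noteq> 0))) qs (push U w \<phi>)"
      unfolding form_add[symmetric] code_kernel_def e ..
    also have "form d U (\<lambda>v v'. of_bool (v = v' \<and> (\<exists>q\<in>set qs. w q \<noteq> 0))) qs (push U w \<phi>) =
        (if \<exists>q\<in>set qs. w q \<noteq> 0 then norm_form d U (push U w \<phi>) else 0)"
    proof (cases "\<exists>q\<in>set qs. w q \<noteq> 0")
      case True
      then show ?thesis using U by (simp add: form_delta)
    next
      case False
      then show ?thesis by (simp add: form_def cong: if_cong)
    qed
    finally show "form d U (code_kernel M ?a (pull qs w)) qs (push U w \<phi>) =
        form d U (kernel_of d ?a M) qs (push U w \<phi>) +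
        (if \<exists>q\<in>set qs. w q \<noteq> 0 then norm_form d U (push U w \<phi>) else 0)" .
  qed
  finally show ?thesis .
qed

definition code_ops :: "(complex mat \<times> 'q list) list \<Rightarrow> (complex mat \<times> 'q list) list" where
  "code_ops ops = map (\<lambda>(M, qs). (code_op M (length qs), qs)) ops"

lemma form_energy_code_ops:
  assumes "finite U" "\<forall>(M, qs)\<in>set ops. set qs \<subseteq> U \<and> distinct qs"
  shows "form_energy m U (code_ops ops) \<phi> = (\<Sum>w\<in>configs (Suc m) U. form_energy d U ops (push U w \<phi>) +
    (\<Sum>(M, qs)\<leftarrow>ops. if \<exists>q\<in>set qs. w q \<noteq> 0 then Re (norm_form d U (push U w \<phi>)) else 0))"
proof -
  have "form_energy m U (code_ops ops) \<phi> = (\<Sum>(M, qs)\<leftarrow>ops. \<Sum>w\<in>configs (Suc m) U.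
      Re (form d U (kernel_of d (length qs) M) qs (push U w \<phi>)) +
      (if \<exists>q\<in>set qs. w q \<noteq> 0 then Re (norm_form d U (push U w \<phi>)) else 0))"
    unfolding form_energy_def code_ops_def map_map
  proof (intro arg_cong[where f = sum_list] map_cong refl)
    fix x assume "x \<in> set ops"
    moreover obtain M qs where "x = (M, qs)" by (cases x)
    ultimately have x: "x = (M, qs)" "set qs \<subseteq> U" "distinct qs" using assms(2) by auto
    show "((\<lambda>(M, qs). Re (form m U (kernel_of m (length qs) M) qs \<phi>)) \<circ> (\<lambda>(M, qs). (code_op M (length qs), qs))) x =
        (case x of (M, qs) \<Rightarrow> \<Sum>w\<in>configs (Suc m) U. Re (form d U (kernel_of d (length qs) M) qs (push U w \<phi>)) +
          (if \<exists>q\<in>set qs. w q \<noteq> 0 then Re (norm_form d U (push U w \<phi>)) else 0))"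
      unfolding x(1) o_def prod.case form_code_op[OF assms(1) x(2,3)] Re_sum
      by (intro sum.cong refl) (simp add: if_distrib[of Re])
  qed
  also have "\<dots> = (\<Sum>w\<in>configs (Suc m) U. \<Sum>(M, qs)\<leftarrow>ops.
      Re (form d U (kernel_of d (length qs) M) qs (push U w \<phi>)) +
      (if \<exists>q\<in>set qs. w q \<noteq> 0 then Re (norm_form d U (push U w \<phi>)) else 0))"
    unfolding case_prod_unfold by (rule sum_list_sum_swap)
  also have "\<dots> = (\<Sum>w\<in>configs (Suc m) U. form_energy d U ops (push U w \<phi>) +
    (\<Sum>(M, qs)\<leftarrow>ops. if \<exists>q\<in>set qs. w q \<noteq> 0 then Re (norm_form d U (push U w \<phi>)) else 0))"
    unfolding form_energy_def case_prod_unfold by (simp add: sum_list_addf)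
  finally show ?thesis .
qed

text \<open>Decoding: the failure charges are nonnegative, so the outcomes have in total at most the
  energy of the given vector and exactly its norm, and averaging applies. Encoding: only the outcome
  \<open>w0\<close> without failures survives, and it returns the original vector.\<close>

lemma form_attains_code_ops:
  assumes U: "finite U" and ops: "\<forall>(M, qs)\<in>set ops. set qs \<subseteq> U \<and> distinct qs"
  shows "form_attains m U (code_ops ops) \<mu> \<longleftrightarrow> form_attains d U ops \<mu>"
proof
  assume "form_attains m U (code_ops ops) \<mu>"
  then obtain \<phi> where phi: "0 < Re (norm_form m U \<phi>)"
    "form_energy m U (code_ops ops) \<phi> \<le> \<mu> * Re (norm_form m U \<phi>)" unfolding form_attains_def by blast
  have "(\<Sum>w\<in>configs (Suc m) U. form_energy d U ops (push U w \<phi>)) \<le> form_energy m U (code_ops ops) \<phi>"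
    unfolding form_energy_code_ops[OF U ops]
    by (intro sum_mono) (auto intro!: sum_list_nonneg simp: norm_form_nonneg)
  with phi show "form_attains d U ops \<mu>"
    by (intro form_attains_average[of "configs (Suc m) U" _ _ _ "\<lambda>w. push U w \<phi>"])
      (use U in \<open>simp_all add: norm_form_push Re_sum\<close>)
next
  assume "form_attains d U ops \<mu>"
  then obtain \<phi> where phi: "0 < Re (norm_form d U \<phi>)"
    "form_energy d U ops \<phi> \<le> \<mu> * Re (norm_form d U \<phi>)" unfolding form_attains_def by blast
  define w0 where "w0 = (\<lambda>q\<in>U. 0 :: nat)"
  have w0: "w0 \<in> configs (Suc m) U" by (auto simp: w0_def)
  have w: "(\<forall>q\<in>U. w q = 0) \<longleftrightarrow> w = w0" if "w \<in> configs (Suc m) U" for w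
    using configs_eq_iff[OF that w0] by (auto simp: w0_def)
  have N: "norm_form d U (push U w (encode U \<phi>)) = (if w = w0 then norm_form d U \<phi> else 0)"
    if "w \<in> configs (Suc m) U" for w
    using norm_form_cong_vector[where D = d and U = U and \<phi> = "push U w (encode U \<phi>)" and \<phi>' = "\<lambda>y. if w = w0 then \<phi> y else 0"]
      push_encode[OF U that] w[OF that] by (cases "w = w0") auto
  have F: "form_energy d U ops (push U w (encode U \<phi>)) = (if w = w0 then form_energy d U ops \<phi> else 0)"
    if "w \<in> configs (Suc m) U" for w
    using form_energy_cong_vector[where D = d and U = U and \<phi> = "push U w (encode U \<phi>)" and \<phi>' = "\<lambda>y. if w = w0 then \<phi> y else 0"]
      push_encode[OF U that] w[OF that] by (cases "w = w0") auto
  have "norm_form m U (encode U \<phi>) = norm_form d U \<phi>"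
    using w0 U by (simp add: norm_form_push N)
  moreover have "form_energy m U (code_ops ops) (encode U \<phi>) = form_energy d U ops \<phi>"
  proof -
    have P: "(\<Sum>(M, qs)\<leftarrow>ops. if \<exists>q\<in>set qs. w q \<noteq> 0 then Re (norm_form d U (push U w (encode U \<phi>))) else 0) = 0"
      if "w \<in> configs (Suc m) U" for w
    proof -
      have "(case x of (M, qs) \<Rightarrow> if \<exists>q\<in>set qs. w q \<noteq> 0 then Re (norm_form d U (push U w (encode U \<phi>))) else 0) = 0"
        if x: "x \<in> set ops" for x
      proof (cases "w = w0")
        case True
        have "set (snd x) \<subseteq> U" using ops x by (auto simp: case_prod_unfold)
        then have "\<not> (\<exists>q\<in>set (snd x). w q \<noteq> 0)" using True by (auto simp: w0_def)
        then show ?thesis by (simp add: case_prod_unfold)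
      qed (use N[OF \<open>w \<in> configs (Suc m) U\<close>] in \<open>simp add: case_prod_unfold\<close>)
      then show ?thesis by (simp add: sum_list_0 cong: map_cong)
    qed
    show ?thesis unfolding form_energy_code_ops[OF U ops] using w0 U by (simp add: F P del: neq0_conv)
  qed
  ultimately show "form_attains m U (code_ops ops) \<mu>"
    unfolding form_attains_def using phi by (intro exI[of _ "encode U \<phi>"]) simp
qed

end

section \<open>Satisfiability in terms of attained energies\<close>

lemma adjoint_index:
  "i < dim_col A \<Longrightarrow> j < dim_row A \<Longrightarrow> mat_adjoint A $$ (i, j) = conjugate (A $$ (j, i))"
  by (simp add: mat_adjoint_def mat_of_rows_def)

lemma quadratic_form_sum:
  fixes M :: "complex mat"
  assumes "M \<in> carrier_mat N N" "u \<in> carrier_vec N" "v \<in> carrier_vec N"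
  shows "(M *\<^sub>v u) \<bullet>c v = (\<Sum>i<N. \<Sum>j<N. M $$ (i, j) * u $ j * cnj (v $ i))"
  using assms by (simp add: scalar_prod_def mult_mat_vec_def lessThan_atLeast0 sum_distrib_right)

lemma self_inner:
  fixes v :: "complex vec"
  assumes "v \<in> carrier_vec N" shows "Re (v \<bullet>c v) = (\<Sum>i<N. (cmod (v $ i))\<^sup>2)" "Im (v \<bullet>c v) = 0"
proof -
  have "v \<bullet>c v = (\<Sum>i<N. v $ i * cnj (v $ i))"
    using assms by (simp add: scalar_prod_def lessThan_atLeast0)
  also have "\<dots> = complex_of_real (\<Sum>i<N. (cmod (v $ i))\<^sup>2)"
    by (simp only: complex_norm_square of_real_sum)
  finally have "v \<bullet>c v = complex_of_real (\<Sum>i<N. (cmod (v $ i))\<^sup>2)" .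
  then show "Re (v \<bullet>c v) = (\<Sum>i<N. (cmod (v $ i))\<^sup>2)" "Im (v \<bullet>c v) = 0"
    by (simp_all only: Re_complex_of_real Im_complex_of_real)
qed

lemma self_inner_eq_0:
  fixes v :: "complex vec"
  assumes "v \<in> carrier_vec N" "Re (v \<bullet>c v) = 0" shows "v = 0\<^sub>v N"
proof -
  have "\<forall>i<N. (cmod (v $ i))\<^sup>2 = 0"
    using assms(2) unfolding self_inner[OF assms(1)] by (subst (asm) sum_nonneg_eq_0_iff) auto
  then show ?thesis using assms(1) by (intro eq_vecI) auto
qed

lemma hermitian_index:
  assumes "pos_semidef N M" "i < N" "j < N" shows "cnj (M $$ (j, i)) = M $$ (i, j)"
  using assms adjoint_index[of i M j] by (auto simp: pos_semidef_def)

text \<open>Moving \<open>v\<close> in the direction \<open>u = M v\<close> changes the quadratic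
  form at first order by twice the squared norm of \<open>u\<close>. At a minimum with value 0 this
  must vanish.\<close>

lemma pos_semidef_null:
  assumes M: "pos_semidef N M" and v: "v \<in> carrier_vec N" and 0: "Re ((M *\<^sub>v v) \<bullet>c v) = 0"
  shows "M *\<^sub>v v = 0\<^sub>v N"
proof -
  have MC: "M \<in> carrier_mat N N" using M by (simp add: pos_semidef_def)
  define B where "B u v = (\<Sum>i<N. \<Sum>j<N. M $$ (i, j) * u j * cnj (v i))" for u v
  have B: "(M *\<^sub>v u) \<bullet>c w = B (($) u) (($) w)" if "u \<in> carrier_vec N" "w \<in> carrier_vec N" for u w
    using quadratic_form_sum[OF MC that] by (simp add: B_def)
  define u where "u = M *\<^sub>v v"
  have u: "u \<in> carrier_vec N" using MC v by (simp add: u_def)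
  have herm: "B (($) u) (($) v) = cnj (B (($) v) (($) u))"
  proof -
    have "cnj (B (($) v) (($) u)) = (\<Sum>i<N. \<Sum>j<N. M $$ (j, i) * cnj (v $ j) * u $ i)"
      unfolding B_def cnj_sum by (intro sum.cong refl) (simp add: hermitian_index[OF M])
    also have "\<dots> = B (($) u) (($) v)"
      unfolding B_def by (subst sum.swap) (simp add: mult_ac)
    finally show ?thesis by simp
  qed
  define c where "c = Re (B (($) v) (($) u))"
  define k where "k = Re (B (($) u) (($) u))"
  have k: "0 \<le> k" using M u by (simp add: k_def pos_semidef_def flip: B)
  have quad: "0 \<le> 2 * t * c + t\<^sup>2 * k" for t :: real
  proof -
    let ?w = "vec N (\<lambda>i. v $ i + complex_of_real t * u $ i)"
    have "B (($) ?w) (($) ?w) = B (($) v) (($) v) + of_real t * (B (($) v) (($) u) + B (($) u) (($) v)) +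
        of_real t * of_real t * B (($) u) (($) u)"
      unfolding B_def by (simp add: algebra_simps sum.distrib sum_distrib_left)
    then have "Re (B (($) ?w) (($) ?w)) = 2 * t * c + t\<^sup>2 * k"
      using 0 B[OF v v] unfolding herm by (simp add: c_def k_def power2_eq_square mult.assoc algebra_simps)
    moreover have "0 \<le> Re ((M *\<^sub>v ?w) \<bullet>c ?w)" using M by (simp add: pos_semidef_def)
    ultimately show ?thesis using B[of ?w ?w] by simp
  qed
  have "c = 0"
  proof (rule ccontr)
    assume "c \<noteq> 0"
    \<comment> \<open>At \<open>t = - r\<close> the bound \<open>quad\<close> equals minus
      \<open>r\<close> squared times \<open>k + 2\<close>; adding 1 to \<open>k\<close> avoids a
      zero denominator.\<close>
    define r where "r = c / (k + 1)"
    have c: "c = r * (k + 1)" using k by (simp add: r_def)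
    have "2 * (- r) * c + (- r)\<^sup>2 * k = - (r\<^sup>2 * (k + 2))"
      unfolding c by (simp add: algebra_simps power2_eq_square)
    moreover have "0 < r\<^sup>2 * (k + 2)" using k c \<open>c \<noteq> 0\<close> by simp
    ultimately show False using quad[of "- r"] by simp
  qed
  then have "Re (u \<bullet>c u) = 0" using B[OF v u] by (simp add: c_def u_def)
  then show ?thesis using self_inner_eq_0[OF u] by (simp add: u_def)
qed

lemma concat_map_single [simp]: "concat (map (\<lambda>q. [q]) qs) = qs"
  by (induction qs) auto

lemma block_system_single:
  "0 < e \<Longrightarrow> U \<subseteq> {..<n} \<Longrightarrow> block_system e n 1 U (\<lambda>q. [q])"
  by standard (auto intro: finite_subset)

lemma act_on_carrier [simp]: "act_on e n M qs \<in> carrier_mat (e ^ n) (e ^ n)"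
  by (simp add: act_on_def)

lemma form_full_nonneg:
  assumes "pos_semidef (D ^ length qs) M" "distinct qs" "0 < D"
  shows "0 \<le> Re (form D (set qs) (kernel_of D (length qs) M) qs \<phi>)"
proof -
  have "M \<in> carrier_mat (D ^ length qs) (D ^ length qs)" using assms(1) by (simp add: pos_semidef_def)
  then obtain v where "v \<in> carrier_vec (D ^ length qs)"
    "form D (set qs) (kernel_of D (length qs) M) qs \<phi> = (M *\<^sub>v v) \<bullet>c v"
    by (rule form_full[OF assms(2,3)])
  then show ?thesis using assms(1) by (simp add: pos_semidef_def)
qed

lemma pos_semidef_act_on:
  assumes "0 < e" "distinct qs" "set qs \<subseteq> {..<n}" and M: "pos_semidef (e ^ length qs) M"
  shows "pos_semidef (e ^ n) (act_on e n M qs)"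
  unfolding pos_semidef_def
proof (intro conjI ballI)
  interpret block_system e n 1 "set qs" "\<lambda>q. [q]"
    by (rule block_system_single) (use assms in auto)
  show "mat_adjoint (act_on e n M qs) = act_on e n M qs"
  proof (rule eq_matI)
    fix i j assume "i < dim_row (act_on e n M qs)" "j < dim_col (act_on e n M qs)"
    then have ij: "i < e ^ n" "j < e ^ n" by (simp_all add: act_on_def)
    then show "mat_adjoint (act_on e n M qs) $$ (i, j) = act_on e n M qs $$ (i, j)"
      using hermitian_index[OF M restrict_index_less[OF assms(1), of qs i] restrict_index_less[OF assms(1), of qs j]]
      by (subst adjoint_index) (auto simp: act_on_def)
  qed (simp_all add: act_on_def mat_adjoint_def)
  fix \<psi> :: "complex vec" assume psi: "\<psi> \<in> carrier_vec (e ^ n)"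
  show "0 \<le> Re ((act_on e n M qs *\<^sub>v \<psi>) \<bullet>c \<psi>)"
    using act_on_form[OF psi, of qs M] form_full_nonneg[OF M assms(2,1)]
    by (simp add: Re_sum sum_nonneg)
qed simp

definition clause_ops :: "qcsp \<Rightarrow> clause list \<Rightarrow> (complex mat \<times> nat list) list" where
  "clause_ops C cs = map (\<lambda>(t, qs). (snd (ctypes C ! t), qs)) cs"

lemma energy_clause_ops:
  "energy (qdim C) n (clause_ops C cs) \<psi> = (\<Sum>c\<leftarrow>cs. Re ((clause_op C n c *\<^sub>v \<psi>) \<bullet>c \<psi>))"
  unfolding energy_def clause_ops_def map_map
  by (intro arg_cong[where f = sum_list] map_cong refl) (auto simp: clause_op_def)

lemma pos_semidef_clause_op:
  assumes "is_qcsp C" "is_clause C n c" shows "pos_semidef (qdim C ^ n) (clause_op C n c)"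
proof -
  obtain t qs where c: "c = (t, qs)" by (cases c)
  then have t: "ctypes C ! t \<in> set (ctypes C)" "length qs = fst (ctypes C ! t)"
    using assms(2) by (auto simp: is_clause_def)
  have "pos_semidef (qdim C ^ length qs) (snd (ctypes C ! t))"
    using assms(1) t by (auto simp: is_qcsp_def case_prod_unfold)
  then show ?thesis
    using assms by (auto simp: clause_op_def c is_clause_def is_qcsp_def intro!: pos_semidef_act_on)
qed

lemma energy_smult:
  assumes "\<psi> \<in> carrier_vec (e ^ n)"
  shows "energy e n ops (complex_of_real r \<cdot>\<^sub>v \<psi>) = r\<^sup>2 * energy e n ops \<psi>"
proof -
  have "(act_on e n M qs *\<^sub>v (complex_of_real r \<cdot>\<^sub>v \<psi>)) \<bullet>c (complex_of_real r \<cdot>\<^sub>v \<psi>) =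
      complex_of_real (r\<^sup>2) * ((act_on e n M qs *\<^sub>v \<psi>) \<bullet>c \<psi>)" for M qs
    using assms by (subst (1 2) quadratic_form_sum[OF act_on_carrier])
      (auto simp: sum_distrib_left power2_eq_square mult_ac intro!: sum.cong)
  then show ?thesis
    unfolding energy_def by (simp add: case_prod_unfold sum_list_const_mult)
qed

lemma normalize_state:
  assumes "\<psi> \<in> carrier_vec (e ^ n)" "0 < Re (\<psi> \<bullet>c \<psi>)"
  shows "complex_of_real (1 / sqrt (Re (\<psi> \<bullet>c \<psi>))) \<cdot>\<^sub>v \<psi> \<in> states e n"
proof -
  let ?r = "1 / sqrt (Re (\<psi> \<bullet>c \<psi>))"
  have "(complex_of_real r \<cdot>\<^sub>v \<psi>) \<bullet>c (complex_of_real r \<cdot>\<^sub>v \<psi>) = complex_of_real (r\<^sup>2) * (\<psi> \<bullet>c \<psi>)" for r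
    using assms(1) by (simp add: scalar_prod_def sum_distrib_left power2_eq_square mult_ac)
  note scale = this[of ?r]
  define N where "N = Re (\<psi> \<bullet>c \<psi>)"
  have N: "\<psi> \<bullet>c \<psi> = complex_of_real N" "0 < N"
    using self_inner(2)[OF assms(1)] assms(2) by (simp_all add: complex_eq_iff N_def)
  have "complex_of_real ((1 / sqrt N)\<^sup>2) * complex_of_real N = 1"
    using N(2) by (simp add: power_divide flip: of_real_mult)
  then have "(complex_of_real ?r \<cdot>\<^sub>v \<psi>) \<bullet>c (complex_of_real ?r \<cdot>\<^sub>v \<psi>) = 1"
    using scale unfolding N(1) Re_complex_of_real by simp
  then show ?thesis using assms(1) by (simp add: states_def)
qed

text \<open>Clause energies are nonnegative, so a total of at most 0 makes each of them 0, and a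
  positive semidefinite operator with zero energy annihilates the state.\<close>

lemma satisfiable_iff:
  assumes C: "is_qcsp C" and cs: "\<forall>c\<in>set cs. is_clause C n c"
  shows "satisfiable C (n, cs) \<longleftrightarrow> attains (qdim C) n (clause_ops C cs) 0"
proof
  assume "satisfiable C (n, cs)"
  then obtain \<psi> where psi: "\<psi> \<in> states (qdim C) n" "\<forall>c\<in>set cs. clause_op C n c *\<^sub>v \<psi> = 0\<^sub>v (qdim C ^ n)"
    by (auto simp: satisfiable_def)
  then have c: "\<psi> \<in> carrier_vec (qdim C ^ n)" "\<psi> \<bullet>c \<psi> = 1" by (auto simp: states_def)
  have "energy (qdim C) n (clause_ops C cs) \<psi> = 0"
    unfolding energy_clause_ops using psi(2) c(1) by (simp cong: map_cong)
  then show "attains (qdim C) n (clause_ops C cs) 0"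
    unfolding attains_def using c by (intro bexI[of _ \<psi>]) auto
next
  assume "attains (qdim C) n (clause_ops C cs) 0"
  then obtain \<psi> where psi: "\<psi> \<in> carrier_vec (qdim C ^ n)" "0 < Re (\<psi> \<bullet>c \<psi>)"
    "energy (qdim C) n (clause_ops C cs) \<psi> \<le> 0" by (auto simp: attains_def)
  have nonneg: "0 \<le> Re ((clause_op C n c *\<^sub>v \<psi>) \<bullet>c \<psi>)" if "c \<in> set cs" for c
    using pos_semidef_clause_op[OF C] cs that psi(1) by (auto simp: pos_semidef_def)
  have "(\<Sum>c\<leftarrow>cs. Re ((clause_op C n c *\<^sub>v \<psi>) \<bullet>c \<psi>)) = 0"
    using psi(3) nonneg unfolding energy_clause_ops by (intro antisym sum_list_nonneg) auto
  then have "\<forall>c\<in>set cs. Re ((clause_op C n c *\<^sub>v \<psi>) \<bullet>c \<psi>) = 0"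
    using nonneg by (subst (asm) sum_list_nonneg_eq_0_iff) auto
  then have null: "clause_op C n c *\<^sub>v \<psi> = 0\<^sub>v (qdim C ^ n)" if "c \<in> set cs" for c
    using pos_semidef_null[OF pos_semidef_clause_op[OF C] psi(1)] cs that by blast
  let ?\<phi> = "complex_of_real (1 / sqrt (Re (\<psi> \<bullet>c \<psi>))) \<cdot>\<^sub>v \<psi>"
  have "clause_op C n c *\<^sub>v ?\<phi> = 0\<^sub>v (qdim C ^ n)" if "c \<in> set cs" for c
    using null[OF that] psi(1)
    by (subst mult_mat_vec[of _ "qdim C ^ n" "qdim C ^ n"]) (auto simp: clause_op_def split: prod.splits)
  then show "satisfiable C (n, cs)"
    unfolding satisfiable_def prod.case using normalize_state[OF psi(1,2)]
    by (intro bexI[of _ ?\<phi>] ballI)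
qed

text \<open>Quantifying over all levels below the gap lets a lower bound on energies be transferred
  through equivalences between instances of \<open>attains\<close>.\<close>

lemma unsatisfiable_iff:
  "unsatisfiable C (n, cs) \<longleftrightarrow>
    (\<forall>\<mu> < 1 / real (poly (gap_poly C) n). \<not> attains (qdim C) n (clause_ops C cs) \<mu>)"
proof (intro iffI allI impI notI)
  fix \<mu> assume U: "unsatisfiable C (n, cs)" and mu: "\<mu> < 1 / real (poly (gap_poly C) n)"
    and "attains (qdim C) n (clause_ops C cs) \<mu>"
  then obtain \<psi> where psi: "\<psi> \<in> carrier_vec (qdim C ^ n)" "0 < Re (\<psi> \<bullet>c \<psi>)"
    "energy (qdim C) n (clause_ops C cs) \<psi> \<le> \<mu> * Re (\<psi> \<bullet>c \<psi>)" by (auto simp: attains_def)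
  let ?r = "1 / sqrt (Re (\<psi> \<bullet>c \<psi>))"
  have "1 / real (poly (gap_poly C) n) \<le> energy (qdim C) n (clause_ops C cs) (complex_of_real ?r \<cdot>\<^sub>v \<psi>)"
    using U normalize_state[OF psi(1,2)] unfolding unsatisfiable_def energy_clause_ops by auto
  also have "\<dots> = energy (qdim C) n (clause_ops C cs) \<psi> / Re (\<psi> \<bullet>c \<psi>)"
    using psi(2) by (simp only: energy_smult[OF psi(1)]) (simp add: power_divide)
  also have "\<dots> \<le> \<mu>" using psi(2,3) by (simp add: divide_le_eq)
  finally show False using mu by simp
next
  assume A: "\<forall>\<mu> < 1 / real (poly (gap_poly C) n). \<not> attains (qdim C) n (clause_ops C cs) \<mu>"
  show "unsatisfiable C (n, cs)"
    unfolding unsatisfiable_def prod.case energy_clause_ops[symmetric]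
  proof (intro ballI leI notI)
    fix \<psi> assume "\<psi> \<in> states (qdim C) n"
      and lt: "energy (qdim C) n (clause_ops C cs) \<psi> < 1 / real (poly (gap_poly C) n)"
    then have "attains (qdim C) n (clause_ops C cs) (energy (qdim C) n (clause_ops C cs) \<psi>)"
      by (auto simp: attains_def states_def intro!: bexI[of _ \<psi>])
    then show False using A lt by blast
  qed
qed

section \<open>Monogamous codes\<close>

subsection \<open>Lines of matrices\<close>

lemma adjoint_inner:
  fixes A :: "complex mat"
  assumes "A \<in> carrier_mat N N" "w \<in> carrier_vec N" "v \<in> carrier_vec N"
  shows "(mat_adjoint A *\<^sub>v w) \<bullet>c v = w \<bullet>c (A *\<^sub>v v)"
proof -
  have adj: "mat_adjoint A \<in> carrier_mat N N" using assms by (auto simp: mat_adjoint_def)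
  have "(mat_adjoint A *\<^sub>v w) \<bullet>c v = (\<Sum>i<N. \<Sum>j<N. cnj (A $$ (j, i)) * w $ j * cnj (v $ i))"
    using assms by (subst quadratic_form_sum[OF adj]) (auto intro!: sum.cong simp: adjoint_index)
  also have "\<dots> = (\<Sum>j<N. \<Sum>i<N. cnj (A $$ (j, i)) * w $ j * cnj (v $ i))"
    by (rule sum.swap)
  also have "\<dots> = w \<bullet>c (A *\<^sub>v v)"
    using assms by (simp add: scalar_prod_def mult_mat_vec_def lessThan_atLeast0 sum_distrib_left mult_ac)
  finally show ?thesis .
qed

lemma smult_mat_mult_vec:
  fixes A :: "'a::comm_ring_1 mat"
  assumes "A \<in> carrier_mat nr nc" "v \<in> carrier_vec nc"
  shows "(c \<cdot>\<^sub>m A) *\<^sub>v v = c \<cdot>\<^sub>v (A *\<^sub>v v)"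
  using assms by (intro eq_vecI) (auto simp: scalar_prod_def sum_distrib_left mult.assoc)

text \<open>
  Joint injectivity of two matrices is an open condition on lines: where it fails, \<open>- 1 / t\<close> is an
  eigenvalue of a fixed matrix.
\<close>

lemma finite_singular_line:
  fixes A0 A1 B0 B1 :: "complex mat"
  assumes C: "A0 \<in> carrier_mat N N" "A1 \<in> carrier_mat N N" "B0 \<in> carrier_mat N N" "B1 \<in> carrier_mat N N"
    and inj: "\<And>v. v \<in> carrier_vec N \<Longrightarrow> A0 *\<^sub>v v = 0\<^sub>v N \<Longrightarrow> B0 *\<^sub>v v = 0\<^sub>v N \<Longrightarrow> v = 0\<^sub>v N"
  shows "finite {t. \<exists>v\<in>carrier_vec N. v \<noteq> 0\<^sub>v N \<and> (A0 + t \<cdot>\<^sub>m A1) *\<^sub>v v = 0\<^sub>v N \<and> (B0 + t \<cdot>\<^sub>m B1) *\<^sub>v v = 0\<^sub>v N}"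
    (is "finite ?S")
proof -
  have adj: "mat_adjoint A0 \<in> carrier_mat N N" "mat_adjoint B0 \<in> carrier_mat N N"
    using C by (auto simp: mat_adjoint_def)
  \<comment> \<open>The Gram matrix of the two matrices stacked on top of each other. It turns joint
    injectivity, a condition on a matrix that is not square, into invertibility of a square
    one.\<close>
  define X where "X = mat_adjoint A0 * A0 + mat_adjoint B0 * B0"
  define Z where "Z = mat_adjoint A0 * A1 + mat_adjoint B0 * B1"
  have X: "X \<in> carrier_mat N N" and Z: "Z \<in> carrier_mat N N" using C adj by (auto simp: X_def Z_def)
  have Xv: "X *\<^sub>v v = mat_adjoint A0 *\<^sub>v (A0 *\<^sub>v v) + mat_adjoint B0 *\<^sub>v (B0 *\<^sub>v v)" if "v \<in> carrier_vec N" for v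
    using that C adj unfolding X_def by (subst add_mult_distrib_mat_vec[of _ N N]) auto
  have Zv: "Z *\<^sub>v v = mat_adjoint A0 *\<^sub>v (A1 *\<^sub>v v) + mat_adjoint B0 *\<^sub>v (B1 *\<^sub>v v)" if "v \<in> carrier_vec N" for v
    using that C adj unfolding Z_def by (subst add_mult_distrib_mat_vec[of _ N N]) auto
  have "det X \<noteq> 0"
  proof
    assume "det X = 0"
    then obtain v where v: "v \<in> carrier_vec N" "v \<noteq> 0\<^sub>v N" "X *\<^sub>v v = 0\<^sub>v N"
      using det_0_iff_vec_prod_zero_field[OF X] by blast
    have Av: "A0 *\<^sub>v v \<in> carrier_vec N" "B0 *\<^sub>v v \<in> carrier_vec N" using C v by auto
    have "0 = (X *\<^sub>v v) \<bullet>c v" using v by simp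
    also have "\<dots> = (mat_adjoint A0 *\<^sub>v (A0 *\<^sub>v v)) \<bullet>c v + (mat_adjoint B0 *\<^sub>v (B0 *\<^sub>v v)) \<bullet>c v"
      unfolding Xv[OF v(1)] using adj Av v(1) by (subst add_scalar_prod_distrib[of _ N]) auto
    also have "\<dots> = (A0 *\<^sub>v v) \<bullet>c (A0 *\<^sub>v v) + (B0 *\<^sub>v v) \<bullet>c (B0 *\<^sub>v v)"
      by (simp only: adjoint_inner[OF C(1) Av(1) v(1)] adjoint_inner[OF C(3) Av(2) v(1)])
    finally have "Re ((A0 *\<^sub>v v) \<bullet>c (A0 *\<^sub>v v)) + Re ((B0 *\<^sub>v v) \<bullet>c (B0 *\<^sub>v v)) = 0"
      by (metis plus_complex.simps(1) zero_complex.simps(1))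
    moreover have "0 \<le> Re ((A0 *\<^sub>v v) \<bullet>c (A0 *\<^sub>v v))" "0 \<le> Re ((B0 *\<^sub>v v) \<bullet>c (B0 *\<^sub>v v))"
      unfolding self_inner(1)[OF Av(1)] self_inner(1)[OF Av(2)] by (simp_all add: sum_nonneg)
    ultimately have "Re ((A0 *\<^sub>v v) \<bullet>c (A0 *\<^sub>v v)) = 0" "Re ((B0 *\<^sub>v v) \<bullet>c (B0 *\<^sub>v v)) = 0" by linarith+
    then show False using inj[OF v(1)] v(2) self_inner_eq_0[OF Av(1)] self_inner_eq_0[OF Av(2)] by simp
  qed
  then have "X \<in> Units (ring_mat TYPE(complex) N undefined)" by (rule det_non_zero_imp_unit[OF X])
  then obtain Y where Y: "Y \<in> carrier_mat N N" "Y * X = 1\<^sub>m N"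
    by (auto simp: Units_def ring_mat_def)
  have YZ: "Y * Z \<in> carrier_mat N N" using Y Z by auto
  \<comment> \<open>Multiplying the two singular equations by the adjoints and adding gives
    \<open>X v = - t Z v\<close>, so \<open>v\<close> is an eigenvector of
    \<open>Y * Z\<close>.\<close>
  have "?S \<subseteq> (\<lambda>k. - 1 / k) ` {k. poly (char_poly (Y * Z)) k = 0}"
  proof
    fix t assume "t \<in> ?S"
    then obtain v where v: "v \<in> carrier_vec N" "v \<noteq> 0\<^sub>v N"
      "(A0 + t \<cdot>\<^sub>m A1) *\<^sub>v v = 0\<^sub>v N" "(B0 + t \<cdot>\<^sub>m B1) *\<^sub>v v = 0\<^sub>v N" by blast
    have lin: "M0 *\<^sub>v v = (- t) \<cdot>\<^sub>v (M1 *\<^sub>v v)"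
      if M: "M0 \<in> carrier_mat N N" "M1 \<in> carrier_mat N N" "(M0 + t \<cdot>\<^sub>m M1) *\<^sub>v v = 0\<^sub>v N" for M0 M1
    proof -
      have "(M0 + t \<cdot>\<^sub>m M1) *\<^sub>v v = M0 *\<^sub>v v + t \<cdot>\<^sub>v (M1 *\<^sub>v v)"
        using M v(1) by (subst add_mult_distrib_mat_vec[of _ N N]) (auto simp: smult_mat_mult_vec[of _ N N])
      with M(3) have s: "M0 *\<^sub>v v + t \<cdot>\<^sub>v (M1 *\<^sub>v v) = 0\<^sub>v N" by simp
      show ?thesis
      proof (rule eq_vecI)
        fix i assume "i < dim_vec ((- t) \<cdot>\<^sub>v (M1 *\<^sub>v v))"
        then have i: "i < N" using M(2) by simp
        have "(M0 *\<^sub>v v + t \<cdot>\<^sub>v (M1 *\<^sub>v v)) $ i = 0" using s i by simp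
        then show "(M0 *\<^sub>v v) $ i = ((- t) \<cdot>\<^sub>v (M1 *\<^sub>v v)) $ i"
          using i M(1,2) by (simp add: add_eq_0_iff)
      qed (use M in simp)
    qed
    have "v = (Y * X) *\<^sub>v v" using v(1) Y(2) by simp
    also have "\<dots> = Y *\<^sub>v (X *\<^sub>v v)" using Y(1) X v(1) by simp
    also have "X *\<^sub>v v = (- t) \<cdot>\<^sub>v (Z *\<^sub>v v)"
      unfolding Xv[OF v(1)] Zv[OF v(1)] lin[OF C(1,2) v(3)] lin[OF C(3,4) v(4)]
      using C adj v(1) by (simp add: mult_mat_vec[of _ N N] smult_add_distrib_vec[of _ N])
    also have "Y *\<^sub>v ((- t) \<cdot>\<^sub>v (Z *\<^sub>v v)) = (- t) \<cdot>\<^sub>v ((Y * Z) *\<^sub>v v)"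
      using Y(1) Z v(1) by (simp add: mult_mat_vec[of _ N N])
    finally have e: "v = (- t) \<cdot>\<^sub>v ((Y * Z) *\<^sub>v v)" .
    have t: "t \<noteq> 0"
    proof
      assume "t = 0"
      then have "v $ i = 0" if "i < N" for i
        using arg_cong[OF e, of "\<lambda>v. v $ i"] that Y(1) Z by simp
      then show False using v(1,2) by (auto intro: eq_vecI)
    qed
    have "(- 1 / t) \<cdot>\<^sub>v v = (- 1 / t) \<cdot>\<^sub>v ((- t) \<cdot>\<^sub>v ((Y * Z) *\<^sub>v v))" using e by simp
    also have "\<dots> = (Y * Z) *\<^sub>v v" using t by (simp add: smult_smult_assoc)
    finally have "eigenvalue (Y * Z) (- 1 / t)"
      unfolding eigenvalue_def eigenvector_def using v YZ by (intro exI[of _ v]) auto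
    then have "poly (char_poly (Y * Z)) (- 1 / t) = 0" using eigenvalue_root_char_poly[OF YZ] by simp
    moreover have "t = - 1 / (- 1 / t)" using t by simp
    ultimately show "t \<in> (\<lambda>k. - 1 / k) ` {k. poly (char_poly (Y * Z)) k = 0}" by blast
  qed
  moreover have "char_poly (Y * Z) \<noteq> 0" using degree_monic_char_poly[OF YZ] by auto
  ultimately show ?thesis by (rule finite_subset[OF _ finite_imageI[OF poly_roots_finite]])
qed

text \<open>\<open>M\<close> is not a clause type but a constraint matrix, whose kernel will contain
  the code: no nonzero state satisfies the constraint on both blocks.\<close>

definition separates :: "complex mat \<Rightarrow> nat \<times> nat list \<times> nat list \<Rightarrow> bool" where
  "separates M = (\<lambda>(n, A, B). \<forall>\<psi>\<in>carrier_vec (2 ^ n). act_on 2 n M A *\<^sub>v \<psi> = 0\<^sub>v (2 ^ n) \<longrightarrow>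
     act_on 2 n M B *\<^sub>v \<psi> = 0\<^sub>v (2 ^ n) \<longrightarrow> \<psi> = 0\<^sub>v (2 ^ n))"

lemma act_on_linear:
  assumes "0 < e" "length A = b" "M \<in> carrier_mat (e ^ b) (e ^ b)" "W \<in> carrier_mat (e ^ b) (e ^ b)"
  shows "act_on e n (M + t \<cdot>\<^sub>m W) A = act_on e n M A + t \<cdot>\<^sub>m act_on e n W A"
proof (rule eq_matI)
  fix i j assume "i < dim_row (act_on e n M A + t \<cdot>\<^sub>m act_on e n W A)"
    "j < dim_col (act_on e n M A + t \<cdot>\<^sub>m act_on e n W A)"
  then show "act_on e n (M + t \<cdot>\<^sub>m W) A $$ (i, j) = (act_on e n M A + t \<cdot>\<^sub>m act_on e n W A) $$ (i, j)"
    using restrict_index_less[OF assms(1), of A] assms by (auto simp: act_on_def)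
qed (simp_all add: act_on_def)

lemma finite_not_separates:
  assumes M: "M \<in> carrier_mat (2 ^ b) (2 ^ b)" and W: "W \<in> carrier_mat (2 ^ b) (2 ^ b)"
    and b: "length A = b" "length B = b" and sep: "separates M (n, A, B)"
  shows "finite {t. \<not> separates (M + t \<cdot>\<^sub>m W) (n, A, B)}"
proof -
  have "{t. \<not> separates (M + t \<cdot>\<^sub>m W) (n, A, B)} = {t. \<exists>v\<in>carrier_vec (2 ^ n). v \<noteq> 0\<^sub>v (2 ^ n) \<and>
      (act_on 2 n M A + t \<cdot>\<^sub>m act_on 2 n W A) *\<^sub>v v = 0\<^sub>v (2 ^ n) \<and>
      (act_on 2 n M B + t \<cdot>\<^sub>m act_on 2 n W B) *\<^sub>v v = 0\<^sub>v (2 ^ n)}"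
    unfolding separates_def prod.case act_on_linear[OF zero_less_numeral b(1) M W] act_on_linear[OF zero_less_numeral b(2) M W]
    by blast
  then show ?thesis
    using sep by (simp only:) (rule finite_singular_line, auto simp: separates_def)
qed

lemma separates_smult:
  assumes "length A = b" "length B = b" "M \<in> carrier_mat (2 ^ b) (2 ^ b)" "t \<noteq> 0" "separates M (n, A, B)"
  shows "separates (t \<cdot>\<^sub>m M) (n, A, B)"
proof -
  have "act_on 2 n (t \<cdot>\<^sub>m M) A' *\<^sub>v \<psi> = t \<cdot>\<^sub>v (act_on 2 n M A' *\<^sub>v \<psi>)"
    if "length A' = b" "\<psi> \<in> carrier_vec (2 ^ n)" for A' \<psi>
  proof -
    have "act_on 2 n (t \<cdot>\<^sub>m M) A' = t \<cdot>\<^sub>m act_on 2 n M A'"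
      using restrict_index_less[of 2 A'] that(1) assms(3) by (intro eq_matI) (auto simp: act_on_def)
    then show ?thesis using smult_mat_mult_vec[OF act_on_carrier that(2)] by simp
  qed
  moreover have "v = 0\<^sub>v N" if "t \<cdot>\<^sub>v v = 0\<^sub>v N" "v \<in> carrier_vec N" for v N
  proof (rule eq_vecI)
    fix i assume i: "i < dim_vec (0\<^sub>v N)"
    then have "(t \<cdot>\<^sub>v v) $ i = 0" using that by simp
    then show "v $ i = 0\<^sub>v N $ i" using i that(2) assms(4) by simp
  qed (use that in simp)
  ultimately have "act_on 2 n M A' *\<^sub>v \<psi> = 0\<^sub>v (2 ^ n)"
    if "length A' = b" "\<psi> \<in> carrier_vec (2 ^ n)" "act_on 2 n (t \<cdot>\<^sub>m M) A' *\<^sub>v \<psi> = 0\<^sub>v (2 ^ n)" for A' \<psi>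
    using that mult_mat_vec_carrier[OF act_on_carrier that(2)] by simp
  then show ?thesis using assms(1,2,5) by (auto simp: separates_def)
qed

text \<open>The last \<open>d\<close> rows vanish, which leaves a kernel of dimension at least
  \<open>d\<close>. Unlike a plain bound on the rank, this is preserved by linear combinations, so a
  whole line of such matrices has large kernels.\<close>

definition low_rank :: "nat \<Rightarrow> nat \<Rightarrow> complex mat set" where
  "low_rank b d = {M \<in> carrier_mat (2 ^ b) (2 ^ b). \<forall>i j. 2 ^ b - d \<le> i \<longrightarrow> i < 2 ^ b \<longrightarrow> j < 2 ^ b \<longrightarrow> M $$ (i, j) = 0}"

text \<open>
  A generic combination of finitely many matrices separates whatever one of them separates: each
  of the countably many conditions excludes only finitely many parameters of a line.
\<close>

lemma generic_separates:
  assumes "set Ws \<subseteq> low_rank b d"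
    and S: "\<And>n A B. (n, A, B) \<in> S \<Longrightarrow> length A = b \<and> length B = b"
  shows "\<exists>M\<in>low_rank b d. \<forall>\<kappa>\<in>S. (\<exists>W\<in>set Ws. separates W \<kappa>) \<longrightarrow> separates M \<kappa>"
  using assms(1)
proof (induction Ws)
  case Nil
  have "0\<^sub>m (2 ^ b) (2 ^ b) \<in> low_rank b d" by (auto simp: low_rank_def)
  then show ?case by auto
next
  case (Cons W Ws)
  then obtain M where M: "M \<in> low_rank b d" "\<forall>\<kappa>\<in>S. (\<exists>W\<in>set Ws. separates W \<kappa>) \<longrightarrow> separates M \<kappa>" by auto
  have W: "W \<in> low_rank b d" using Cons.prems by simp
  have MW: "M \<in> carrier_mat (2 ^ b) (2 ^ b)" "W \<in> carrier_mat (2 ^ b) (2 ^ b)"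
    using M(1) W by (auto simp: low_rank_def)
  let ?bad = "\<lambda>\<kappa>. {t :: real. t \<noteq> 0 \<and> (separates M \<kappa> \<or> separates W \<kappa>) \<and> \<not> separates (M + complex_of_real t \<cdot>\<^sub>m W) \<kappa>}"
  have "finite (?bad \<kappa>)" if "\<kappa> \<in> S" for \<kappa>
  proof -
    obtain n A B where k: "\<kappa> = (n, A, B)" by (cases \<kappa>)
    then have b: "length A = b" "length B = b" using S that by auto
    have "finite {t :: real. \<not> separates (M + complex_of_real t \<cdot>\<^sub>m W) \<kappa>}" if "separates M \<kappa>"
      using finite_vimageI[OF finite_not_separates[OF MW b that[unfolded k]], of complex_of_real]
      by (simp add: k vimage_def inj_on_def)
    \<comment> \<open>Here the line is read from its far end: up to the factor \<open>t\<close> its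
      matrix is \<open>W\<close> plus \<open>1 / t\<close> times \<open>M\<close>, so the finiteness
      result applies with \<open>W\<close> as base point and parameter \<open>1 / t\<close>.\<close>
    moreover have "finite {t :: real. t \<noteq> 0 \<and> \<not> separates (M + complex_of_real t \<cdot>\<^sub>m W) \<kappa>}" if "separates W \<kappa>"
    proof -
      have "finite {t :: real. \<not> separates (W + complex_of_real (1 / t) \<cdot>\<^sub>m M) \<kappa>}"
        using finite_vimageI[OF finite_not_separates[OF MW(2,1) b that[unfolded k]], of "\<lambda>t. complex_of_real (1 / t)"]
        by (simp add: k vimage_def inj_on_def)
      moreover have "separates (M + complex_of_real t \<cdot>\<^sub>m W) \<kappa>"
        if "t \<noteq> 0" "separates (W + complex_of_real (1 / t) \<cdot>\<^sub>m M) \<kappa>" for t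
      proof -
        have "M + complex_of_real t \<cdot>\<^sub>m W = complex_of_real t \<cdot>\<^sub>m (W + complex_of_real (1 / t) \<cdot>\<^sub>m M)"
          using MW that(1) by (intro eq_matI) (auto simp: algebra_simps)
        moreover have "separates (complex_of_real t \<cdot>\<^sub>m (W + complex_of_real (1 / t) \<cdot>\<^sub>m M)) (n, A, B)"
          using MW that by (intro separates_smult[OF b]) (auto simp: k)
        ultimately show ?thesis by (simp add: k)
      qed
      ultimately show ?thesis by (elim finite_subset[rotated]) blast
    qed
    ultimately show ?thesis
      by (cases "separates M \<kappa>"; cases "separates W \<kappa>") (auto elim: finite_subset[rotated])
  qed
  \<comment> \<open>\<open>S\<close> may be infinite, but its elements come from a countable
    type.\<close>
  then have "countable (\<Union>\<kappa>\<in>S. ?bad \<kappa>)" by (intro countable_UN) (auto intro: countable_finite)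
  then have "countable ((\<Union>\<kappa>\<in>S. ?bad \<kappa>) \<union> {0})" by (rule countable_Un) simp
  then have "(\<Union>\<kappa>\<in>S. ?bad \<kappa>) \<union> {0} \<noteq> UNIV" using uncountable_UNIV_real by metis
  then obtain t where t: "t \<notin> (\<Union>\<kappa>\<in>S. ?bad \<kappa>) \<union> {0}" by blast
  have "M + complex_of_real t \<cdot>\<^sub>m W \<in> low_rank b d" using M(1) W by (auto simp: low_rank_def)
  moreover have "\<forall>\<kappa>\<in>S. (\<exists>W'\<in>set (W # Ws). separates W' \<kappa>) \<longrightarrow> separates (M + complex_of_real t \<cdot>\<^sub>m W) \<kappa>"
    using t M(2) by auto
  ultimately show ?case by blast
qed

subsection \<open>An orthonormal basis of the kernel\<close>

text \<open>The basis grows by one vector at a time. Membership in the kernel and orthogonality to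
  the previous \<open>k\<close> vectors are together at most \<open>2 ^ b - d + k\<close> equations,
  fewer than the dimension as long as \<open>k < d\<close>.\<close>

lemma low_rank_kernel:
  assumes M: "M \<in> low_rank b d" and d: "d \<le> 2 ^ b" "k \<le> d"
  shows "\<exists>E :: nat \<Rightarrow> nat \<Rightarrow> complex. (\<forall>y<k. \<forall>y'<k. (\<Sum>x<2 ^ b. cnj (E x y) * E x y') = of_bool (y = y')) \<and>
    (\<forall>y<k. \<forall>r<2 ^ b. (\<Sum>x<2 ^ b. M $$ (r, x) * E x y) = 0)"
  using d(2)
proof (induction k)
  case (Suc k)
  let ?m = "2 ^ b :: nat"
  from Suc.IH[OF Suc_leD[OF Suc.prems]] obtain E :: "nat \<Rightarrow> nat \<Rightarrow> complex" where
    "(\<forall>y<k. \<forall>y'<k. (\<Sum>x<?m. cnj (E x y) * E x y') = of_bool (y = y')) \<and>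
     (\<forall>y<k. \<forall>r<?m. (\<Sum>x<?m. M $$ (r, x) * E x y) = 0)" by (rule exE)
  then have E: "\<And>y y'. y < k \<Longrightarrow> y' < k \<Longrightarrow> (\<Sum>x<?m. cnj (E x y) * E x y') = of_bool (y = y')"
    "\<And>y r. y < k \<Longrightarrow> r < ?m \<Longrightarrow> (\<Sum>x<?m. M $$ (r, x) * E x y) = 0" by simp_all
  \<comment> \<open>The zero rows of \<open>M\<close> are reused for the conjugates of the vectors
    found so far.\<close>
  define Q where "Q = mat ?m ?m (\<lambda>(r, x). if r < ?m - d then M $$ (r, x)
    else if r - (?m - d) < k then cnj (E x (r - (?m - d))) else 0)"
  have Q: "Q \<in> carrier_mat ?m ?m" by (simp add: Q_def)
  have "det Q = 0"
  proof -
    \<comment> \<open>The last row has offset \<open>d - 1\<close> among the reused ones, which is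
      at least \<open>k\<close>, so it is still zero.\<close>
    have row: "row Q (?m - 1) = 0\<^sub>v ?m"
      using Suc.prems d(1) by (intro eq_vecI) (auto simp: Q_def)
    show ?thesis
    proof (rule ccontr)
      assume "det Q \<noteq> 0"
      then have "Q \<in> Units (ring_mat TYPE(complex) ?m undefined)" by (rule det_non_zero_imp_unit[OF Q])
      then obtain Y where Y: "Y \<in> carrier_mat ?m ?m" "Q * Y = 1\<^sub>m ?m"
        by (auto simp: Units_def ring_mat_def)
      have "(Q * Y) $$ (?m - 1, ?m - 1) = row Q (?m - 1) \<bullet> col Y (?m - 1)"
        using Q Y(1) by (subst index_mult_mat(1)) auto
      also have "\<dots> = 0" unfolding row
        by (rule scalar_prod_left_zero, rule carrier_vecI) (simp add: carrier_matD(1)[OF Y(1)])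
      finally show False using Y(2) by simp
    qed
  qed
  then obtain v where v: "v \<in> carrier_vec ?m" "v \<noteq> 0\<^sub>v ?m" "Q *\<^sub>v v = 0\<^sub>v ?m"
    using det_0_iff_vec_prod_zero_field[OF Q] by blast
  have Qv: "(\<Sum>x<?m. Q $$ (r, x) * v $ x) = 0" if "r < ?m" for r
  proof -
    have "(Q *\<^sub>v v) $ r = (\<Sum>x<?m. Q $$ (r, x) * v $ x)"
      using that v(1) Q by (simp add: scalar_prod_def mult_mat_vec_def lessThan_atLeast0)
    then show ?thesis using v(3) that by simp
  qed
  have Mv: "(\<Sum>x<?m. M $$ (r, x) * v $ x) = 0" if "r < ?m" for r
  proof (cases "r < ?m - d")
    case True
    then show ?thesis using Qv[OF that] that by (simp add: Q_def)
  next
    case False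
    then show ?thesis using M that by (simp add: low_rank_def)
  qed
  have Ev: "(\<Sum>x<?m. cnj (E x y) * v $ x) = 0" if "y < k" for y
  proof -
    define r where "r = ?m - d + y"
    have r: "r < ?m" "\<not> r < ?m - d" "r - (?m - d) = y" using that Suc.prems d(1) by (auto simp: r_def)
    show ?thesis using Qv[OF r(1)] r that by (simp add: Q_def)
  qed
  define r where "r = Re (v \<bullet>c v)"
  have "0 \<le> r" unfolding r_def self_inner(1)[OF v(1)] by (simp add: sum_nonneg)
  moreover have "r \<noteq> 0" using self_inner_eq_0[OF v(1)] v(2) by (auto simp: r_def)
  ultimately have r: "0 < r" by simp
  have vv: "(\<Sum>x<?m. cnj (v $ x) * v $ x) = complex_of_real r"
  proof -
    have "(\<Sum>x<?m. cnj (v $ x) * v $ x) = v \<bullet>c v"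
      using v(1) by (simp add: scalar_prod_def lessThan_atLeast0 mult.commute)
    also have "\<dots> = complex_of_real r" using self_inner(2)[OF v(1)] by (simp add: r_def complex_eq_iff)
    finally show ?thesis .
  qed
  define c where "c = complex_of_real (1 / sqrt r)"
  have c: "cnj c = c" "c * c * complex_of_real r = 1"
    using r by (simp_all add: c_def flip: of_real_mult)
  define E' where "E' x y = (if y = k then c * v $ x else E x y)" for x y
  have "(\<Sum>x<?m. cnj (E' x y) * E' x y') = of_bool (y = y')" if yy: "y < Suc k" "y' < Suc k" for y y'
  proof -
    consider "y = k" "y' = k" | "y = k" "y' < k" | "y < k" "y' = k" | "y < k" "y' < k"
      using yy by (auto simp: less_Suc_eq)
    then show ?thesis
    proof cases
      case 1
      have "(\<Sum>x<?m. cnj (E' x y) * E' x y') = c * c * (\<Sum>x<?m. cnj (v $ x) * v $ x)"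
        using 1 c(1) by (simp add: E'_def sum_distrib_left mult_ac)
      then show ?thesis using 1 c(2) vv by simp
    next
      case 2
      have "(\<Sum>x<?m. cnj (E' x y) * E' x y') = c * cnj (\<Sum>x<?m. cnj (E x y') * v $ x)"
        using 2 c(1) by (simp add: E'_def sum_distrib_left mult_ac)
      then show ?thesis using 2 Ev by simp
    next
      case 3
      have "(\<Sum>x<?m. cnj (E' x y) * E' x y') = c * (\<Sum>x<?m. cnj (E x y) * v $ x)"
        using 3 by (simp add: E'_def sum_distrib_left mult_ac)
      then show ?thesis using 3 Ev by simp
    next
      case 4
      then show ?thesis using E(1) by (simp add: E'_def)
    qed
  qed
  moreover have "(\<Sum>x<?m. M $$ (r, x) * E' x y) = 0" if "y < Suc k" "r < ?m" for y r
  proof (cases "y = k")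
    case True
    have "(\<Sum>x<?m. M $$ (r, x) * E' x y) = c * (\<Sum>x<?m. M $$ (r, x) * v $ x)"
      using True by (simp add: E'_def sum_distrib_left mult_ac)
    then show ?thesis using Mv that by simp
  qed (use E(2) that in \<open>simp add: E'_def\<close>)
  ultimately show ?case by blast
qed simp

subsection \<open>Overlapping blocks\<close>

lemma index_eqI:
  assumes "i < e ^ n" "j < e ^ n" "\<And>p. p < n \<Longrightarrow> digit e i p = digit e j p" shows "i = j"
proof -
  have "place_value e n (digit e i) = place_value e n (digit e j)"
    using assms(3) by (simp add: place_value_def)
  then show ?thesis using assms(1,2) by (simp add: place_value_digit)
qed

text \<open>Two lists of the same qubits in different order are also a conflict, because decoding a
  block depends on the order.\<close>

definition conflicts :: "nat \<Rightarrow> (nat \<times> nat list \<times> nat list) set" where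
  "conflicts b = {(n, A, B). length A = b \<and> length B = b \<and> distinct A \<and> distinct B \<and>
     set A \<subseteq> {..<n} \<and> set B \<subseteq> {..<n} \<and> set A \<inter> set B \<noteq> {} \<and> A \<noteq> B}"

text \<open>A block system with the single block \<open>A\<close>, indexed by the unit type. Basis
  states agreeing with \<open>i\<close> off \<open>A\<close> are parametrized by \<open>upd\<close>,
  which overwrites the digits on \<open>A\<close>; on each such slice the constraint is the plain
  linear system of \<open>W\<close>.\<close>

lemma act_on_null_slices:
  assumes A: "length A = b" "distinct A" "set A \<subseteq> {..<n}" and psi: "\<psi> \<in> carrier_vec (2 ^ n)"
    and null: "act_on 2 n W A *\<^sub>v \<psi> = 0\<^sub>v (2 ^ n)" and i: "i < 2 ^ n"
  obtains upd where "\<And>v. v < 2 ^ b \<Longrightarrow> upd v < 2 ^ n"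
    "\<And>v l. v < 2 ^ b \<Longrightarrow> l < b \<Longrightarrow> digit 2 (upd v) (A ! l) = digit 2 v l"
    "\<And>v p. v < 2 ^ b \<Longrightarrow> p < n \<Longrightarrow> p \<notin> set A \<Longrightarrow> digit 2 (upd v) p = digit 2 i p"
    "upd (restrict_index 2 A i) = i"
    "\<And>r. r < 2 ^ b \<Longrightarrow> (\<Sum>v<2 ^ b. W $$ (r, v) * \<psi> $ upd v) = 0"
proof -
  interpret block_system 2 n b "{()}" "\<lambda>_. A" by standard (use A in auto)
  define u where "u = fst (dec i)"
  define z where "z = snd (dec i)"
  have uz: "u \<in> configs (2 ^ b) {()}" "z \<in> configs 2 rest" using dec_in[of i] by (auto simp: u_def z_def)
  have uv: "u(() := v) \<in> configs (2 ^ b) {()}" if "v < 2 ^ b" for v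
    using that by (auto simp: PiE_iff extensional_def)
  define upd where "upd v = enc (u(() := v)) z" for v
  have dec_upd: "dec (upd v) = (u(() := v), z)" if "v < 2 ^ b" for v
    unfolding upd_def by (rule dec_enc[OF uv[OF that] uz(2)])
  show thesis
  proof (rule that[of upd])
    show "upd v < 2 ^ n" if "v < 2 ^ b" for v
      unfolding upd_def by (rule enc_less[OF uv[OF that] uz(2)])
    show "digit 2 (upd v) (A ! l) = digit 2 v l" if "v < 2 ^ b" "l < b" for v l
      using digit_block[of "()" l "upd v"] dec_upd[OF that(1)] that(2) by simp
    show "digit 2 (upd v) p = digit 2 i p" if "v < 2 ^ b" "p < n" "p \<notin> set A" for v p
    proof -
      have "p \<in> rest" using that by (simp add: rest_def)
      then show ?thesis using digit_rest[of p "upd v"] digit_rest[of p i] dec_upd[OF that(1)] by (simp add: z_def)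
    qed
    have "u(() := restrict_index 2 A i) = u" by (auto simp: u_def dec_def fun_eq_iff)
    then show "upd (restrict_index 2 A i) = i" using enc_dec[OF i] by (simp add: upd_def u_def z_def)
    show "(\<Sum>v<2 ^ b. W $$ (r, v) * \<psi> $ upd v) = 0" if r: "r < 2 ^ b" for r
    proof -
      have "(act_on 2 n W A *\<^sub>v \<psi>) $ enc (u(() := r)) z =
          (\<Sum>v<2 ^ b. W $$ ((u(() := r)) (), v) * \<psi> $ enc ((u(() := r))(() := v)) z)"
        by (rule act_on_block[OF psi _ uv[OF r] uz(2)]) simp
      then show ?thesis using null enc_less[OF uv[OF r] uz(2)] by (simp add: upd_def)
    qed
  qed
qed

text \<open>One equation per element leaves a solution space of dimension at least
  \<open>2 ^ (b - 2)\<close>, the number of indices with the forbidden pattern.\<close>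

definition pattern_free :: "nat \<Rightarrow> nat \<Rightarrow> nat \<Rightarrow> nat set" where
  "pattern_free b p q = {x. x < 2 ^ b \<and> \<not> (digit 2 x p = 0 \<and> digit 2 x q = 1)}"

lemma card_pattern_free:
  assumes "p < b" "q < b" "p \<noteq> q" shows "card (pattern_free b p q) \<le> 2 ^ b - 2 ^ (b - 2)"
proof -
  let ?B = "\<lambda>l :: nat. if l = p then {0} else if l = q then {1} else {..<2 :: nat}"
  let ?G = "place_value 2 b ` PiE {..<b} ?B"
  have sub: "PiE {..<b} ?B \<subseteq> configs 2 {..<b}" by (intro PiE_mono) auto
  have "card ?G = card (PiE {..<b} ?B)"
    using bij_betw_place_value[of 2 b] inj_on_subset[OF _ sub] by (intro card_image) (auto simp: bij_betw_def)
  also have "\<dots> = (\<Prod>l<b. if l \<in> {p, q} then 1 else 2)"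
    unfolding card_PiE[OF finite_lessThan] by (intro prod.cong) auto
  also have "\<dots> = 2 ^ card ({..<b} - {p, q})"
    by (simp add: prod.If_cases set_diff_eq Collect_neg_eq Int_def conj_commute)
  also have "card ({..<b} - {p, q}) = b - 2" using assms by (simp add: card_Diff_subset)
  finally have G: "card ?G = 2 ^ (b - 2)" .
  have GU: "?G \<subseteq> {..<2 ^ b}"
    using place_value_configs_less[OF subsetD[OF sub]] by (intro image_subsetI) simp
  have "pattern_free b p q \<subseteq> {..<2 ^ b} - ?G"
  proof
    fix x assume x: "x \<in> pattern_free b p q"
    have "x \<notin> ?G"
    proof
      assume "x \<in> ?G"
      then obtain w where w: "w \<in> PiE {..<b} ?B" "x = place_value 2 b w" by blast
      then have dw: "digits 2 b x = w" using digits_place_value[OF subsetD[OF sub w(1)]] by simp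
      have "digit 2 x l = w l" if "l < b" for l using fun_cong[OF dw, of l] that by (simp add: digits_def)
      moreover have "w p \<in> ?B p" "w q \<in> ?B q" using PiE_mem[OF w(1), of p] PiE_mem[OF w(1), of q] assms by simp_all
      ultimately show False using x assms by (auto simp: pattern_free_def)
    qed
    then show "x \<in> {..<2 ^ b} - ?G" using x by (auto simp: pattern_free_def)
  qed
  then have "card (pattern_free b p q) \<le> card ({..<2 ^ b} - ?G)" by (intro card_mono) auto
  also have "\<dots> = 2 ^ b - 2 ^ (b - 2)"
    using GU G by (subst card_Diff_subset) (auto intro: finite_subset)
  finally show ?thesis .
qed

text \<open>Equations indexed by \<open>F\<close> are assigned to distinct rows among the first
  \<open>2 ^ b - d\<close>; \<open>h\<close> is this assignment, and all other rows are
  zero.\<close>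

lemma exists_low_rank:
  fixes F :: "nat set" and f :: "nat \<Rightarrow> nat \<Rightarrow> complex"
  assumes F: "F \<subseteq> {..<2 ^ b}" "card F \<le> 2 ^ b - d"
  obtains W h where "W \<in> low_rank b d" "\<And>x. x \<in> F \<Longrightarrow> h x < 2 ^ b"
    "\<And>x v. x \<in> F \<Longrightarrow> v < 2 ^ b \<Longrightarrow> W $$ (h x, v) = f x v"
proof -
  have fin: "finite F" by (rule finite_subset[OF F(1)]) simp
  obtain h where h: "inj_on h F" "h ` F \<subseteq> {..<2 ^ b - d}"
    using inj_on_iff_card_le[OF fin finite_lessThan[of "2 ^ b - d"]] F(2) by (auto simp: card_lessThan)
  have h_less: "h x < 2 ^ b - d" if "x \<in> F" for x using h(2) that by blast
  define W where "W = mat (2 ^ b) (2 ^ b) (\<lambda>(r, v). \<Sum>x\<in>F. if h x = r then f x v else 0)"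
  show thesis
  proof (rule that[of W h])
    show "W \<in> low_rank b d"
      unfolding low_rank_def W_def by (auto intro!: sum.neutral dest!: h_less)
    show hx: "h x < 2 ^ b" if "x \<in> F" for x using h_less[OF that] by simp
    show "W $$ (h x, v) = f x v" if "x \<in> F" "v < 2 ^ b" for x v
    proof -
      have "W $$ (h x, v) = (\<Sum>x'\<in>F. if h x' = h x then f x' v else 0)"
        using hx[OF that(1)] that by (simp add: W_def)
      also have "\<dots> = (\<Sum>x'\<in>F. if x' = x then f x' v else 0)"
        using h(1) that(1) by (intro sum.cong refl) (auto simp: inj_on_def)
      also have "\<dots> = f x v" using fin that(1) by simp
      finally show ?thesis .
    qed
  qed
qed

lemma restrict_index_in_pattern_free:
  assumes "length A = b" "p < b" "q < b"
  shows "restrict_index 2 A i \<in> pattern_free b p q \<longleftrightarrow> \<not> (digit 2 i (A ! p) = 0 \<and> digit 2 i (A ! q) = 1)"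
  using assms restrict_index_less[of 2 A i] by (auto simp: pattern_free_def digit_restrict_index)

text \<open>
  If a qubit is at position \<open>p\<close> of one block and at position \<open>q\<close> of the other, kernel vectors with
  the qubits at \<open>p\<close> and \<open>q\<close> in states 0 and 1 are incompatible.
\<close>

lemma separates_positions:
  assumes pq: "p < b" "q < b" "p \<noteq> q" and d: "d \<le> 2 ^ (b - 2)"
  obtains W where "W \<in> low_rank b d"
    "\<And>n A B. (n, A, B) \<in> conflicts b \<Longrightarrow> A ! p = B ! q \<Longrightarrow> separates W (n, A, B)"
proof -
  have "card (pattern_free b p q) \<le> 2 ^ b - d" using card_pattern_free[OF pq] d by linarith
  \<comment> \<open>The equations are that every amplitude without the pattern vanishes, so the
    kernel is spanned by the basis states with 0 at \<open>p\<close> and 1 at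
    \<open>q\<close>.\<close>
  then obtain W h where W: "W \<in> low_rank b d" and h: "\<And>x. x \<in> pattern_free b p q \<Longrightarrow> h x < 2 ^ b"
    "\<And>x v. x \<in> pattern_free b p q \<Longrightarrow> v < 2 ^ b \<Longrightarrow> W $$ (h x, v) = of_bool (x = v)"
    using exists_low_rank[of "pattern_free b p q" b d "\<lambda>x v. of_bool (x = v)"] by (auto simp: pattern_free_def)
  have null: "\<psi> $ i = 0"
    if A: "length A = b" "distinct A" "set A \<subseteq> {..<n}" and psi: "\<psi> \<in> carrier_vec (2 ^ n)"
      and Z: "act_on 2 n W A *\<^sub>v \<psi> = 0\<^sub>v (2 ^ n)" and i: "i < 2 ^ n"
      and ni: "\<not> (digit 2 i (A ! p) = 0 \<and> digit 2 i (A ! q) = 1)" for n A \<psi> i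
  proof -
    obtain upd where upd: "upd (restrict_index 2 A i) = i"
      "\<And>r. r < 2 ^ b \<Longrightarrow> (\<Sum>v<2 ^ b. W $$ (r, v) * \<psi> $ upd v) = 0"
      by (rule act_on_null_slices[OF A psi Z i]) (rule that)
    let ?x = "restrict_index 2 A i"
    have x: "?x \<in> pattern_free b p q" "?x < 2 ^ b"
      using ni restrict_index_in_pattern_free[OF A(1) pq(1,2)] restrict_index_less[of 2 A i] A(1) by auto
    have "0 = (\<Sum>v<2 ^ b. of_bool (?x = v) * \<psi> $ upd v)"
      using upd(2)[OF h(1)[OF x(1)]] h(2)[OF x(1)] by simp
    also have "\<dots> = (\<Sum>v<2 ^ b. if ?x = v then \<psi> $ upd v else 0)" by (intro sum.cong refl) auto
    also have "\<dots> = \<psi> $ i" using x(2) upd(1) by simp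
    finally show ?thesis by simp
  qed
  show thesis
  proof (rule that[OF W])
    fix n A B assume c: "(n, A, B) \<in> conflicts b" and AB: "A ! p = B ! q"
    show "separates W (n, A, B)"
      unfolding separates_def prod.case
    proof (intro ballI impI)
      fix \<psi> :: "complex vec"
      assume psi: "\<psi> \<in> carrier_vec (2 ^ n)" "act_on 2 n W A *\<^sub>v \<psi> = 0\<^sub>v (2 ^ n)" "act_on 2 n W B *\<^sub>v \<psi> = 0\<^sub>v (2 ^ n)"
      \<comment> \<open>A nonzero amplitude would need the shared qubit to be 0 as position
        \<open>p\<close> of \<open>A\<close> and 1 as position \<open>q\<close> of
        \<open>B\<close>.\<close>
      have "\<psi> $ i = 0" if i: "i < 2 ^ n" for i
        using null[OF _ _ _ psi(1,2) i] null[OF _ _ _ psi(1,3) i] c AB by (fastforce simp: conflicts_def)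
      then show "\<psi> = 0\<^sub>v (2 ^ n)" using psi(1) by (intro eq_vecI) auto
    qed
  qed
qed

text \<open>
  If the blocks share position \<open>p\<close> but not position \<open>q\<close>, the qubit at \<open>p\<close> cannot be in a singlet
  with two different partners.
\<close>

lemma separates_partners:
  assumes pq: "p < b" "q < b" "p \<noteq> q" and d: "d \<le> 2 ^ (b - 2)"
  obtains W where "W \<in> low_rank b d"
    "\<And>n A B. (n, A, B) \<in> conflicts b \<Longrightarrow> A ! p = B ! p \<Longrightarrow> A ! q \<noteq> B ! q \<Longrightarrow> separates W (n, A, B)"
proof -
  define sw where "sw x = place_value 2 b (\<lambda>l. digit 2 x (if l = p then q else if l = q then p else l))" for x
  have sw: "sw x < 2 ^ b" "\<And>l. l < b \<Longrightarrow> digit 2 (sw x) l = digit 2 x (if l = p then q else if l = q then p else l)" for x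
    unfolding sw_def by (rule place_value_less, simp add: digit_less) (subst digit_place_value, simp_all add: digit_less)
  \<comment> \<open>Here \<open>sw\<close> exchanges the digits at \<open>p\<close> and
    \<open>q\<close>. Of two indices exchanged by \<open>sw\<close> only the one with 0 at
    \<open>p\<close> and 1 at \<open>q\<close> contributes an equation, that the two amplitudes are
    opposite; indices with equal digits must have amplitude 0. The kernel is a singlet on
    \<open>p\<close> and \<open>q\<close> times an arbitrary vector.\<close>
  let ?F = "pattern_free b q p"
  let ?f = "\<lambda>x v. (of_bool (x = v) + of_bool (digit 2 x p \<noteq> digit 2 x q \<and> sw x = v)) :: complex"
  have "card ?F \<le> 2 ^ b - d" using card_pattern_free[OF pq(2,1) pq(3)[symmetric]] d by linarith
  then obtain W h where W: "W \<in> low_rank b d" and h: "\<And>x. x \<in> ?F \<Longrightarrow> h x < 2 ^ b"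
    "\<And>x v. x \<in> ?F \<Longrightarrow> v < 2 ^ b \<Longrightarrow> W $$ (h x, v) = ?f x v"
    using exists_low_rank[of ?F b d ?f] by (auto simp: pattern_free_def)
  have equal: "\<psi> $ i = 0" if A: "length A = b" "distinct A" "set A \<subseteq> {..<n}" and psi: "\<psi> \<in> carrier_vec (2 ^ n)"
      and Z: "act_on 2 n W A *\<^sub>v \<psi> = 0\<^sub>v (2 ^ n)" and i: "i < 2 ^ n"
      and eq: "digit 2 i (A ! p) = digit 2 i (A ! q)" for n A \<psi> i
  proof -
    obtain upd where upd: "upd (restrict_index 2 A i) = i"
      "\<And>r. r < 2 ^ b \<Longrightarrow> (\<Sum>v<2 ^ b. W $$ (r, v) * \<psi> $ upd v) = 0"
      by (rule act_on_null_slices[OF A psi Z i]) (rule that)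
    let ?x = "restrict_index 2 A i"
    have x: "?x \<in> ?F" "?x < 2 ^ b"
      using eq restrict_index_in_pattern_free[OF A(1) pq(2,1)] restrict_index_less[of 2 A i] A(1) by auto
    have "digit 2 ?x p = digit 2 ?x q" using eq A(1) pq by (simp add: digit_restrict_index)
    then have "0 = (\<Sum>v<2 ^ b. of_bool (?x = v) * \<psi> $ upd v)"
      using upd(2)[OF h(1)[OF x(1)]] h(2)[OF x(1)] by simp
    also have "\<dots> = (\<Sum>v<2 ^ b. if ?x = v then \<psi> $ upd v else 0)" by (intro sum.cong refl) auto
    also have "\<dots> = \<psi> $ i" using x(2) upd(1) by simp
    finally show ?thesis by simp
  qed
  have antisymmetric: "\<psi> $ i + \<psi> $ j = 0" if A: "length A = b" "distinct A" "set A \<subseteq> {..<n}" and psi: "\<psi> \<in> carrier_vec (2 ^ n)"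
      and Z: "act_on 2 n W A *\<^sub>v \<psi> = 0\<^sub>v (2 ^ n)" and i: "i < 2 ^ n" "j < 2 ^ n"
      and eq: "digit 2 i (A ! p) = 0" "digit 2 i (A ! q) = 1"
        "digit 2 j (A ! p) = 1" "digit 2 j (A ! q) = 0"
        "\<And>l. l < n \<Longrightarrow> l \<noteq> A ! p \<Longrightarrow> l \<noteq> A ! q \<Longrightarrow> digit 2 i l = digit 2 j l" for n A \<psi> i j
  proof -
    obtain upd where upd: "\<And>v. v < 2 ^ b \<Longrightarrow> upd v < 2 ^ n"
      "\<And>v l. v < 2 ^ b \<Longrightarrow> l < b \<Longrightarrow> digit 2 (upd v) (A ! l) = digit 2 v l"
      "\<And>v p. v < 2 ^ b \<Longrightarrow> p < n \<Longrightarrow> p \<notin> set A \<Longrightarrow> digit 2 (upd v) p = digit 2 i p"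
      "upd (restrict_index 2 A i) = i"
      "\<And>r. r < 2 ^ b \<Longrightarrow> (\<Sum>v<2 ^ b. W $$ (r, v) * \<psi> $ upd v) = 0"
      by (rule act_on_null_slices[OF A psi Z i(1)]) (rule that)
    let ?x = "restrict_index 2 A i"
    have x: "?x \<in> ?F" "?x < 2 ^ b"
      using eq(1,2) restrict_index_in_pattern_free[OF A(1) pq(2,1)] restrict_index_less[of 2 A i] A(1) by auto
    have dx: "digit 2 ?x l = digit 2 i (A ! l)" if "l < b" for l using that A(1) by (simp add: digit_restrict_index)
    have j: "upd (sw ?x) = j"
    proof (rule index_eqI[OF upd(1)[OF sw(1)] i(2)])
      fix l assume l: "l < n"
      show "digit 2 (upd (sw ?x)) l = digit 2 j l"
      proof (cases "l \<in> set A")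
        case False
        then have "l \<noteq> A ! p" "l \<noteq> A ! q" using A(1) pq nth_mem[of p A] nth_mem[of q A] by auto
        then show ?thesis using False upd(3)[OF sw(1)] eq(5) l by simp
      next
        case True
        then obtain k where k: "k < b" "l = A ! k" using A(1) by (auto simp: in_set_conv_nth)
        have "digit 2 (upd (sw ?x)) l = digit 2 i (A ! (if k = p then q else if k = q then p else k))"
          using upd(2)[OF sw(1) k(1)] sw(2)[OF k(1)] dx k pq by simp
        moreover have "l \<noteq> A ! p" "l \<noteq> A ! q" if "k \<noteq> p" "k \<noteq> q"
          using that k pq A(1,2) by (simp_all add: nth_eq_iff_index_eq)
        ultimately show ?thesis using eq l k(2) by (cases "k = p"; cases "k = q") auto
      qed
    qed
    have "0 = (\<Sum>v<2 ^ b. ?f ?x v * \<psi> $ upd v)"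
      using upd(5)[OF h(1)[OF x(1)]] h(2)[OF x(1)] by simp
    also have "\<dots> = (\<Sum>v<2 ^ b. (if ?x = v then \<psi> $ upd v else 0) + (if sw ?x = v then \<psi> $ upd v else 0))"
      using eq(1,2) dx pq by (intro sum.cong refl) auto
    also have "\<dots> = \<psi> $ i + \<psi> $ j" using x(2) sw(1)[of ?x] upd(4) j by (simp add: sum.distrib)
    finally show ?thesis by simp
  qed
  show thesis
  proof (rule that[OF W])
    fix n A B assume c: "(n, A, B) \<in> conflicts b" and Ap: "A ! p = B ! p" and Aq: "A ! q \<noteq> B ! q"
    have A: "length A = b" "distinct A" "set A \<subseteq> {..<n}" and B: "length B = b" "distinct B" "set B \<subseteq> {..<n}"
      using c by (auto simp: conflicts_def)
    have ne: "A ! p \<noteq> A ! q" "A ! p \<noteq> B ! q"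
      using nth_eq_iff_index_eq[OF A(2), of p q] nth_eq_iff_index_eq[OF B(2), of p q] A(1) B(1) pq Ap
      by simp_all
    have less: "A ! p < n" "A ! q < n" "B ! q < n"
      using subsetD[OF A(3) nth_mem[of p A]] subsetD[OF A(3) nth_mem[of q A]] subsetD[OF B(3) nth_mem[of q B]]
        A(1) B(1) pq by auto
    show "separates W (n, A, B)"
      unfolding separates_def prod.case
    proof (intro ballI impI)
      fix \<psi> :: "complex vec"
      assume psi: "\<psi> \<in> carrier_vec (2 ^ n)" "act_on 2 n W A *\<^sub>v \<psi> = 0\<^sub>v (2 ^ n)" "act_on 2 n W B *\<^sub>v \<psi> = 0\<^sub>v (2 ^ n)"
      have "\<psi> $ i = 0" if i: "i < 2 ^ n" for i
      proof (cases "digit 2 i (A ! p) = digit 2 i (A ! q) \<or> digit 2 i (A ! p) = digit 2 i (B ! q)")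
        case True
        then show ?thesis using equal[OF A psi(1,2) i] equal[OF B psi(1,3) i] Ap by auto
      next
        case False
        \<comment> \<open>Both partners now differ from the shared qubit, hence agree with each
          other. Exchanging the shared qubit with its partner in \<open>A\<close> flips the sign of
          the amplitude and makes the shared qubit agree with its partner in \<open>B\<close>, where
          the amplitude is 0.\<close>
        define j where "j = place_value 2 n (\<lambda>l. if l = A ! p then digit 2 i (A ! q) else
          if l = A ! q then digit 2 i (A ! p) else digit 2 i l)"
        have j: "j < 2 ^ n" "\<And>l. l < n \<Longrightarrow> digit 2 j l = (if l = A ! p then digit 2 i (A ! q) else
          if l = A ! q then digit 2 i (A ! p) else digit 2 i l)"
          unfolding j_def by (rule place_value_less, simp add: digit_less) (subst digit_place_value, simp_all add: digit_less)
        have bits: "digit 2 i (A ! p) < 2" "digit 2 i (A ! q) < 2" "digit 2 i (B ! q) < 2"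
          by (simp_all add: digit_less)
        have "digit 2 j (B ! p) = digit 2 j (B ! q)"
          using False bits j(2) less Ap Aq ne by auto
        then have "\<psi> $ j = 0" by (rule equal[OF B psi(1,3) j(1)])
        moreover have "\<psi> $ i + \<psi> $ j = 0"
        proof (cases "digit 2 i (A ! p) = 0")
          case True
          then show ?thesis
            using False bits j(2) less ne by (intro antisymmetric[OF A psi(1,2) i j(1)]) auto
        next
          case F: False
          have "\<psi> $ j + \<psi> $ i = 0"
            using F False bits j(2) less ne by (intro antisymmetric[OF A psi(1,2) j(1) i]) auto
          then show ?thesis by (simp add: add.commute)
        qed
        ultimately show ?thesis by simp
      qed
      then show "\<psi> = 0\<^sub>v (2 ^ n)" using psi(1) by (intro eq_vecI) auto
    qed
  qed
qed

lemma conflict_cases: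
  assumes "(n, A, B) \<in> conflicts b"
  obtains p q where "p < b" "q < b" "p \<noteq> q" "A ! p = B ! q"
    | p q where "p < b" "q < b" "p \<noteq> q" "A ! p = B ! p" "A ! q \<noteq> B ! q"
proof -
  have l: "length A = b" "length B = b" "A \<noteq> B" using assms by (auto simp: conflicts_def)
  obtain x where "x \<in> set A" "x \<in> set B" using assms by (auto simp: conflicts_def)
  then obtain p p' where p: "p < b" "p' < b" "A ! p = B ! p'" using l by (metis in_set_conv_nth)
  show thesis
  proof (cases "p = p'")
    case True
    obtain q where "q < b" "A ! q \<noteq> B ! q" using l nth_equalityI[of A B] by auto
    then show thesis using that(2)[of p q] p True by auto
  qed (use p that(1) in blast)
qed

text \<open>There are infinitely many conflicts, but each is separated by a matrix that depends only
  on an ordered pair of positions and on the kind of conflict. These finitely many matrices are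
  combined into one by genericity.\<close>

lemma exists_monogamous_code:
  assumes b: "2 \<le> b" and d: "d \<le> 2 ^ (b - 2)"
  obtains M :: "complex mat" and E :: "nat \<Rightarrow> nat \<Rightarrow> complex" where
    "\<And>\<kappa>. \<kappa> \<in> conflicts b \<Longrightarrow> separates M \<kappa>"
    "\<And>y y'. y < d \<Longrightarrow> y' < d \<Longrightarrow> (\<Sum>x<2 ^ b. cnj (E x y) * E x y') = of_bool (y = y')"
    "\<And>y r. y < d \<Longrightarrow> r < 2 ^ b \<Longrightarrow> (\<Sum>x<2 ^ b. M $$ (r, x) * E x y) = 0"
proof -
  let ?P = "{(p, q). p < b \<and> q < b \<and> p \<noteq> q}"
  have "\<forall>k\<in>?P. \<exists>W. W \<in> low_rank b d \<and> (\<forall>n A B. (n, A, B) \<in> conflicts b \<longrightarrow> A ! fst k = B ! snd k \<longrightarrow> separates W (n, A, B))"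
  proof
    fix k assume "k \<in> ?P"
    then have k: "fst k < b" "snd k < b" "fst k \<noteq> snd k" by auto
    show "\<exists>W. W \<in> low_rank b d \<and> (\<forall>n A B. (n, A, B) \<in> conflicts b \<longrightarrow> A ! fst k = B ! snd k \<longrightarrow> separates W (n, A, B))"
      by (rule separates_positions[OF k d]) blast
  qed
  from bchoice[OF this] obtain V1 where V1: "\<forall>k\<in>?P. V1 k \<in> low_rank b d \<and>
      (\<forall>n A B. (n, A, B) \<in> conflicts b \<longrightarrow> A ! fst k = B ! snd k \<longrightarrow> separates (V1 k) (n, A, B))"
    by blast
  have "\<forall>k\<in>?P. \<exists>W. W \<in> low_rank b d \<and> (\<forall>n A B. (n, A, B) \<in> conflicts b \<longrightarrow> A ! fst k = B ! fst k \<longrightarrow> A ! snd k \<noteq> B ! snd k \<longrightarrow> separates W (n, A, B))"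
  proof
    fix k assume "k \<in> ?P"
    then have k: "fst k < b" "snd k < b" "fst k \<noteq> snd k" by auto
    show "\<exists>W. W \<in> low_rank b d \<and> (\<forall>n A B. (n, A, B) \<in> conflicts b \<longrightarrow> A ! fst k = B ! fst k \<longrightarrow> A ! snd k \<noteq> B ! snd k \<longrightarrow> separates W (n, A, B))"
      by (rule separates_partners[OF k d]) blast
  qed
  from bchoice[OF this] obtain V2 where V2: "\<forall>k\<in>?P. V2 k \<in> low_rank b d \<and>
      (\<forall>n A B. (n, A, B) \<in> conflicts b \<longrightarrow> A ! fst k = B ! fst k \<longrightarrow> A ! snd k \<noteq> B ! snd k \<longrightarrow> separates (V2 k) (n, A, B))"
    by blast
  have "finite ?P" by (rule finite_subset[of _ "{..<b} \<times> {..<b}"]) auto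
  then have "finite (V1 ` ?P \<union> V2 ` ?P)" by simp
  from finite_list[OF this] obtain Ws where Ws: "set Ws = V1 ` ?P \<union> V2 ` ?P" by (rule exE)
  have "set Ws \<subseteq> low_rank b d" using V1 V2 by (auto simp: Ws)
  then obtain M where M: "M \<in> low_rank b d" "\<forall>\<kappa>\<in>conflicts b. (\<exists>W\<in>set Ws. separates W \<kappa>) \<longrightarrow> separates M \<kappa>"
    by (rule bexE[OF generic_separates[of Ws b d "conflicts b"]]) (auto simp: conflicts_def)
  have sep: "separates M \<kappa>" if "\<kappa> \<in> conflicts b" for \<kappa>
  proof -
    obtain n A B where k: "\<kappa> = (n, A, B)" by (cases \<kappa>)
    have "\<exists>W\<in>set Ws. separates W (n, A, B)"
      using that[unfolded k]
    proof (cases rule: conflict_cases)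
      case (1 p q)
      then show ?thesis using bspec[OF V1, of "(p, q)"] that k by (intro bexI[of _ "V1 (p, q)"]) (auto simp: Ws)
    next
      case (2 p q)
      then show ?thesis using bspec[OF V2, of "(p, q)"] that k by (intro bexI[of _ "V2 (p, q)"]) (auto simp: Ws)
    qed
    then show ?thesis using M(2) that k by blast
  qed
  have "d \<le> 2 ^ b" by (rule order_trans[OF d power_increasing]) auto
  from low_rank_kernel[OF M(1) this order_refl] show thesis
    using that[of M] sep by blast
qed

section \<open>The QCSP on qubits\<close>

lemma place_value_pull_upt: "u \<in> configs D {..<a} \<Longrightarrow> pull [0..<a] u = u"
  by (auto simp: pull_def fun_eq_iff PiE_iff extensional_def)

lemma kernel_of_hermitian:
  assumes "pos_semidef (d ^ a) M" "v \<in> configs d {..<a}" "v' \<in> configs d {..<a}"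
  shows "cnj (kernel_of d a M v' v) = kernel_of d a M v v'"
  unfolding kernel_of_def
  by (rule hermitian_index[OF assms(1)]) (use assms place_value_configs_less in auto)

context code
begin

lemma code_op_carrier [simp]: "code_op M a \<in> carrier_mat (m ^ a) (m ^ a)"
  by (simp add: code_op_def)

lemma form_code_op_terms_nonneg:
  assumes "pos_semidef (d ^ length qs) M" "distinct qs"
  shows "0 \<le> Re (form d (set qs) (kernel_of d (length qs) M) qs (push (set qs) w \<phi>) +
       (if \<exists>q\<in>set qs. w q \<noteq> 0 then norm_form d (set qs) (push (set qs) w \<phi>) else 0))"
  using form_full_nonneg[OF assms d_pos, of "push (set qs) w \<phi>"] norm_form_nonneg[of d "set qs" "push (set qs) w \<phi>"]
  by simp

lemma form_code_op_nonneg: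
  assumes "pos_semidef (d ^ length qs) M" "distinct qs"
  shows "0 \<le> Re (form m (set qs) (kernel_of m (length qs) (code_op M (length qs))) qs \<phi>)"
  unfolding form_code_op[OF finite_set order_refl assms(2)] Re_sum
  by (intro sum_nonneg form_code_op_terms_nonneg[OF assms])

text \<open>The form is a sum over decoding outcomes of old clause energies and of norms, all
  nonnegative; Hermitian symmetry follows by exchanging the two summation indices.\<close>

lemma pos_semidef_code_op:
  assumes M: "pos_semidef (d ^ a) M" and m: "0 < m" shows "pos_semidef (m ^ a) (code_op M a)"
  unfolding pos_semidef_def
proof (intro conjI ballI)
  show "mat_adjoint (code_op M a) = code_op M a"
  proof (rule eq_matI)
    fix i j assume "i < dim_row (code_op M a)" "j < dim_col (code_op M a)"
    then have ij: "i < m ^ a" "j < m ^ a" by (simp_all add: code_op_def)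
    let ?Y = "configs d {..<a}" and ?x = "digits m a i" and ?x' = "digits m a j"
    have mw: "cnj (code_kernel M a w y' y) = code_kernel M a w y y'" if "y \<in> ?Y" "y' \<in> ?Y" for w y y'
      using kernel_of_hermitian[OF M that] by (auto simp: code_kernel_def)
    have "cnj (dual_kernel a (code_kernel M a) ?x' ?x) = (\<Sum>w\<in>configs (Suc m) {..<a}. \<Sum>y\<in>?Y. \<Sum>y'\<in>?Y.
        cnj (code_kernel M a w y y') * (\<Prod>l<a. cnj (K (w l) (y' l) (?x l)) * K (w l) (y l) (?x' l)))"
      unfolding dual_kernel_def cnj_sum
      by (intro sum.cong refl) (simp add: mult.commute)
    also have "\<dots> = (\<Sum>w\<in>configs (Suc m) {..<a}. \<Sum>y'\<in>?Y. \<Sum>y\<in>?Y.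
        cnj (code_kernel M a w y y') * (\<Prod>l<a. cnj (K (w l) (y' l) (?x l)) * K (w l) (y l) (?x' l)))"
      by (intro sum.cong refl sum.swap)
    also have "\<dots> = dual_kernel a (code_kernel M a) ?x ?x'"
      unfolding dual_kernel_def by (intro sum.cong refl arg_cong2[where f = "(*)"] mw)
    finally show "mat_adjoint (code_op M a) $$ (i, j) = code_op M a $$ (i, j)"
      using ij by (subst adjoint_index) (simp_all add: code_op_def)
  qed (simp_all add: code_op_def mat_adjoint_def)
next
  fix v :: "complex vec" assume v: "v \<in> carrier_vec (m ^ a)"
  let ?X = "configs m {..<a}"
  have U: "set [0..<a] = {..<a}" by auto
  have "(code_op M a *\<^sub>v v) \<bullet>c v = (\<Sum>i<m ^ a. \<Sum>j<m ^ a. code_op M a $$ (i, j) * v $ j * cnj (v $ i))"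
    by (rule quadratic_form_sum[OF code_op_carrier v v])
  also have "\<dots> = (\<Sum>x\<in>?X. \<Sum>x'\<in>?X. code_op M a $$ (place_value m a x, place_value m a x') *
      v $ place_value m a x' * cnj (v $ place_value m a x))"
    by (rule sum_sum_reindex_bij_betw[OF bij_betw_place_value[OF m], symmetric])
  also have "\<dots> = form m {..<a} (kernel_of m a (code_op M a)) [0..<a] (\<lambda>x. v $ place_value m a x)"
    unfolding form_def kernel_of_def by (intro sum.cong refl) (simp add: place_value_pull_upt lessThan_atLeast0)
  finally show "0 \<le> Re ((code_op M a *\<^sub>v v) \<bullet>c v)"
    using form_code_op_nonneg[of "[0..<a]" M] M unfolding U by simp
qed simp

text \<open>Zero energy forces every block of a clause into the code.\<close>

lemma form_code_op_null:
  assumes M: "pos_semidef (d ^ length qs) M" and qs: "distinct qs"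
    and 0: "Re (form m (set qs) (kernel_of m (length qs) (code_op M (length qs))) qs \<phi>) = 0"
    and W: "\<And>y. y < d \<Longrightarrow> (\<Sum>x<m. g x * E x y) = 0"
    and q: "q \<in> set qs" and x: "x \<in> configs m (set qs)"
  shows "(\<Sum>v<m. g v * \<phi> (x(q := v))) = 0"
proof -
  let ?U = "set qs"
  define w0 where "w0 = (\<lambda>q\<in>?U. 0 :: nat)"
  have w0: "w0 \<in> configs (Suc m) ?U" by (auto simp: w0_def)
  let ?t = "\<lambda>w. Re (form d ?U (kernel_of d (length qs) M) qs (push ?U w \<phi>) +
       (if \<exists>q\<in>?U. w q \<noteq> 0 then norm_form d ?U (push ?U w \<phi>) else 0))"
  have "(\<Sum>w\<in>configs (Suc m) ?U. ?t w) = 0"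
    using 0 unfolding form_code_op[OF finite_set order_refl qs] Re_sum .
  then have t: "?t w = 0" if "w \<in> configs (Suc m) ?U" for w
    using that form_code_op_terms_nonneg[OF M qs] by (subst (asm) sum_nonneg_eq_0_iff) auto
  have null: "push ?U w \<phi> y = 0" if w: "w \<in> configs (Suc m) ?U" "w \<noteq> w0" and y: "y \<in> configs d ?U" for w y
  proof -
    have "\<exists>q\<in>?U. w q \<noteq> 0" using configs_eq_iff[OF w(1) w0] w(2) by (auto simp: w0_def)
    then have "Re (norm_form d ?U (push ?U w \<phi>)) = 0"
      using t[OF w(1)] form_full_nonneg[OF M qs d_pos, of "push ?U w \<phi>"] norm_form_nonneg[of d ?U "push ?U w \<phi>"] by simp
    then show ?thesis by (rule norm_form_eq_0D[OF _ finite_set y])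
  qed
  \<comment> \<open>All outcomes with a failure are zero, so the reconstruction formula keeps only
    \<open>w0\<close>, which exhibits \<open>\<phi>\<close> as an encoded vector.\<close>
  have code: "\<phi> x = (\<Sum>y\<in>configs d ?U. (\<Prod>q\<in>?U. E (x q) (y q)) * push ?U w0 \<phi> y)" if "x \<in> configs m ?U" for x
  proof -
    have "\<phi> x = (\<Sum>w\<in>configs (Suc m) ?U. \<Sum>y\<in>configs d ?U. (\<Prod>q\<in>?U. cnj (K (w q) (y q) (x q))) * push ?U w \<phi> y)"
      by (rule push_reconstruct[OF finite_set that])
    also have "\<dots> = (\<Sum>w\<in>configs (Suc m) ?U. if w = w0 then
        (\<Sum>y\<in>configs d ?U. (\<Prod>q\<in>?U. E (x q) (y q)) * push ?U w0 \<phi> y) else 0)"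
    proof (intro sum.cong refl)
      fix w assume w: "w \<in> configs (Suc m) ?U"
      show "(\<Sum>y\<in>configs d ?U. (\<Prod>q\<in>?U. cnj (K (w q) (y q) (x q))) * push ?U w \<phi> y) =
          (if w = w0 then (\<Sum>y\<in>configs d ?U. (\<Prod>q\<in>?U. E (x q) (y q)) * push ?U w0 \<phi> y) else 0)"
      proof (cases "w = w0")
        case True
        have "(\<Prod>q\<in>?U. cnj (K (w0 q) (y q) (x q))) = (\<Prod>q\<in>?U. E (x q) (y q))" for y
          by (intro prod.cong refl) (simp add: w0_def)
        then show ?thesis by (simp only: True refl if_True)
      next
        case False
        then show ?thesis by (simp add: null[OF w False])
      qed
    qed
    also have "\<dots> = (\<Sum>y\<in>configs d ?U. (\<Prod>q\<in>?U. E (x q) (y q)) * push ?U w0 \<phi> y)"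
      using w0 by (simp add: sum.delta)
    finally show ?thesis .
  qed
  have xq: "x(q := v) \<in> configs m ?U" if "v < m" for v
    using x q that by (auto simp: PiE_iff extensional_def)
  have split: "(\<Prod>p\<in>?U. E ((x(q := v)) p) (y p)) = E v (y q) * (\<Prod>p\<in>?U - {q}. E (x p) (y p))" for v y
    using q by (simp add: prod.remove)
  have "(\<Sum>v<m. g v * \<phi> (x(q := v))) =
      (\<Sum>v<m. \<Sum>y\<in>configs d ?U. (g v * E v (y q)) * ((\<Prod>p\<in>?U - {q}. E (x p) (y p)) * push ?U w0 \<phi> y))"
    by (intro sum.cong refl) (simp only: code xq lessThan_iff split sum_distrib_left mult.assoc)
  also have "\<dots> = (\<Sum>y\<in>configs d ?U. (\<Sum>v<m. g v * E v (y q)) * ((\<Prod>p\<in>?U - {q}. E (x p) (y p)) * push ?U w0 \<phi> y))"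
    unfolding sum_distrib_right by (rule sum.swap)
  also have "\<dots> = 0"
    using q by (intro sum.neutral ballI) (simp add: W PiE_mem[where S = ?U and T = "\<lambda>_. {..<d}", simplified])
  finally show ?thesis .
qed

end

lemma poly_nat_mono: fixes p :: "nat poly" assumes "x \<le> y" shows "poly p x \<le> poly p y"
  by (induction p) (use assms in \<open>auto intro: add_mono mult_mono\<close>)

lemma poly_nat_pos: fixes p :: "nat poly" shows "p \<noteq> 0 \<Longrightarrow> 0 < x \<Longrightarrow> 0 < poly p x"
  by (induction p) (auto simp: pCons_eq_0_iff)

section \<open>Cutting the qubit list of a clause into blocks\<close>

definition chunk :: "nat \<Rightarrow> 'b list \<Rightarrow> nat \<Rightarrow> 'b list" where
  "chunk b qs l = take b (drop (l * b) qs)"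

lemma concat_chunks: "length qs = b * a \<Longrightarrow> concat (map (chunk b qs) [0..<a]) = qs"
proof (induction a arbitrary: qs)
  case (Suc a)
  have "chunk b qs (Suc l) = chunk b (drop b qs) l" for l by (simp add: chunk_def add.commute)
  then have "concat (map (chunk b qs) [0..<Suc a]) = take b qs @ concat (map (chunk b (drop b qs)) [0..<a])"
    unfolding upt_conv_Cons[OF zero_less_Suc] map_Suc_upt[symmetric]
    by (simp add: o_def) (simp add: chunk_def)
  also have "\<dots> = qs" using Suc.prems by (subst Suc.IH) auto
  finally show ?case .
qed simp

lemma length_chunk: "length qs = b * a \<Longrightarrow> l < a \<Longrightarrow> length (chunk b qs l) = b"
proof -
  assume "length qs = b * a" "l < a"
  then have "Suc l * b \<le> length qs" using mult_le_mono1[of "Suc l" a b] by (simp add: mult.commute)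
  then show ?thesis by (simp add: chunk_def)
qed

lemma chunk_nth: "length qs = b * a \<Longrightarrow> l < a \<Longrightarrow> j < b \<Longrightarrow> chunk b qs l ! j = qs ! (l * b + j)"
proof -
  assume *: "length qs = b * a" "l < a" "j < b"
  then have "Suc l * b \<le> length qs" using mult_le_mono1[of "Suc l" a b] by (simp add: mult.commute)
  then show ?thesis using * by (simp add: chunk_def)
qed

lemma set_chunk_subset: "set (chunk b qs l) \<subseteq> set qs"
  unfolding chunk_def by (meson set_drop_subset set_take_subset subset_trans)

lemma distinct_chunk: "distinct qs \<Longrightarrow> distinct (chunk b qs l)"
  by (simp add: chunk_def)

lemma chunks_disjoint:
  assumes "distinct qs" "length qs = b * a" "l < a" "l' < a" "l \<noteq> l'"
  shows "set (chunk b qs l) \<inter> set (chunk b qs l') = {}"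
proof (rule ccontr)
  assume "set (chunk b qs l) \<inter> set (chunk b qs l') \<noteq> {}"
  then obtain x where "x \<in> set (chunk b qs l)" "x \<in> set (chunk b qs l')" by blast
  then obtain j j' where j: "j < b" "j' < b" "chunk b qs l ! j = chunk b qs l' ! j'"
    using assms by (metis in_set_conv_nth length_chunk)
  have e: "qs ! (l * b + j) = qs ! (l' * b + j')" using j assms by (simp add: chunk_nth)
  have less: "k * b + i < length qs" if "k < a" "i < b" for k i
  proof -
    have "Suc k * b \<le> a * b" using that(1) by (intro mult_le_mono1) simp
    then show ?thesis using that assms(2) by (simp add: mult.commute)
  qed
  have "l * b + j = l' * b + j'"
    using e nth_eq_iff_index_eq[OF assms(1) less[OF assms(3) j(1)] less[OF assms(4) j(2)]] by simp
  then have "(l * b + j) div b = (l' * b + j') div b" by simp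
  then show False using j(1,2) assms(5) by simp
qed

definition blocks :: "nat \<Rightarrow> clause list \<Rightarrow> nat list set" where
  "blocks b cs = {chunk b qs l | t qs l. (t, qs) \<in> set cs \<and> l < length qs div b}"

text \<open>For the blocks of a valid instance this says that no two of them form a pair in
  \<open>conflicts\<close>.\<close>

definition consistent :: "nat \<Rightarrow> clause list \<Rightarrow> bool" where
  "consistent b cs \<longleftrightarrow> (\<forall>A\<in>blocks b cs. \<forall>B\<in>blocks b cs. set A \<inter> set B \<noteq> {} \<longrightarrow> A = B)"

definition encode_clause :: "nat \<Rightarrow> clause \<Rightarrow> clause" where
  "encode_clause b = (\<lambda>(t, qs). (t, concat (map (\<lambda>q. [b * q..<b * q + b]) qs)))"

text \<open>
  Naming a block by its last qubit allows the circuit to turn the other integers of the block into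
  leading zeros of the name.
\<close>

definition decode_clause :: "nat \<Rightarrow> clause \<Rightarrow> clause" where
  "decode_clause b = (\<lambda>(t, qs). (t, map (\<lambda>l. last (chunk b qs l)) [0..<length qs div b]))"

text \<open>The clauses are built from \<open>E\<close> alone. The matrix \<open>S\<close> is a
  certificate of monogamy: it annihilates the code and has no joint null vector on conflicting
  blocks.\<close>

locale qubit_code = code E d "2 ^ b" for E :: "nat \<Rightarrow> nat \<Rightarrow> complex" and d b :: nat +
  fixes S :: "complex mat" and C :: qcsp
  assumes b: "2 \<le> b" and C: "is_qcsp C" and dim: "qdim C = d"
    and separates: "\<And>\<kappa>. \<kappa> \<in> conflicts b \<Longrightarrow> separates S \<kappa>"
    and S_E: "\<And>y r. y < d \<Longrightarrow> r < 2 ^ b \<Longrightarrow> (\<Sum>x<2 ^ b. S $$ (r, x) * E x y) = 0"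
begin

definition qubit_qcsp :: qcsp where
  "qubit_qcsp = \<lparr>qdim = 2, ctypes = map (\<lambda>(a, M). (b * a, code_op M a)) (ctypes C),
     count_poly = count_poly C, gap_poly = gap_poly C\<rparr>"

lemma qubit_qcsp_simps [simp]: "qdim qubit_qcsp = 2" "count_poly qubit_qcsp = count_poly C"
  "gap_poly qubit_qcsp = gap_poly C" "length (ctypes qubit_qcsp) = length (ctypes C)"
  by (simp_all add: qubit_qcsp_def)

lemma ctypes_qubit_qcsp: "t < length (ctypes C) \<Longrightarrow>
  ctypes qubit_qcsp ! t = (b * fst (ctypes C ! t), code_op (snd (ctypes C ! t)) (fst (ctypes C ! t)))"
  by (simp add: qubit_qcsp_def case_prod_unfold)

lemma clause_type_psd: "t < length (ctypes C) \<Longrightarrow> pos_semidef (d ^ fst (ctypes C ! t)) (snd (ctypes C ! t))"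
  using C dim nth_mem by (fastforce simp: is_qcsp_def case_prod_unfold)

lemma is_qcsp_qubit_qcsp: "is_qcsp qubit_qcsp"
proof -
  have "pos_semidef (2 ^ (b * a)) (code_op M a)" if "(a, M) \<in> set (ctypes C)" for a M
    using pos_semidef_code_op[of a M] C dim that by (auto simp: is_qcsp_def power_mult)
  then show ?thesis using C by (auto simp: is_qcsp_def qubit_qcsp_def)
qed

lemma is_local_qubit_qcsp: "is_local k C \<Longrightarrow> is_local (b * k) qubit_qcsp"
  by (auto simp: is_local_def qubit_qcsp_def)

text \<open>Both sides are reduced to forms on the same sites \<open>U\<close>: the qubit side with
  sites of dimension \<open>2 ^ b\<close>, the qudit side with blocks of length 1. The code then
  relates the two dimensions. Qudits outside \<open>U\<close> are idle.\<close>

lemma attains_iff_qubits: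
  assumes bs: "block_system 2 n' b U \<beta>" and U: "U \<subseteq> {..<n}"
    and cs: "\<forall>c\<in>set cs. is_clause C n c" "\<forall>(t, qs)\<in>set cs. set qs \<subseteq> U"
  shows "attains 2 n' (clause_ops qubit_qcsp (map (\<lambda>(t, qs). (t, concat (map \<beta> qs))) cs)) \<mu> \<longleftrightarrow>
    attains (qdim C) n (clause_ops C cs) \<mu>"
proof -
  interpret Q: block_system 2 n' b U \<beta> by (rule bs)
  interpret D: block_system d n 1 U "\<lambda>q. [q]" by (rule block_system_single[OF d_pos U])
  let ?ops = "clause_ops C cs"
  have "set qs \<subseteq> U \<and> distinct qs" if M: "(M, qs) \<in> set ?ops" for M qs
  proof -
    obtain t where "(t, qs) \<in> set cs" using M by (auto simp: clause_ops_def)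
    then show ?thesis using bspec[OF cs(1), of "(t, qs)"] bspec[OF cs(2), of "(t, qs)"] by (simp add: is_clause_def)
  qed
  then have ops: "\<forall>(M, qs)\<in>set ?ops. set qs \<subseteq> U \<and> distinct qs"
    and ops1: "\<forall>(M, qs)\<in>set ?ops. set qs \<subseteq> U" by auto
  have ops2: "\<forall>(M, qs)\<in>set (code_ops ?ops). set qs \<subseteq> U"
    using ops1 by (auto simp: code_ops_def)
  have q: "clause_ops qubit_qcsp (map (\<lambda>(t, qs). (t, concat (map \<beta> qs))) cs) = Q.place_ops (code_ops ?ops)"
    unfolding clause_ops_def Q.place_ops_def code_ops_def map_map
    using cs(1) by (intro map_cong refl) (auto simp: is_clause_def ctypes_qubit_qcsp)
  have c: "D.place_ops ?ops = ?ops"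
    by (simp add: D.place_ops_def case_prod_unfold)
  have "attains d n ?ops \<mu> \<longleftrightarrow> form_attains d U ?ops \<mu>"
    using D.attains_iff[OF ops1, of \<mu>] unfolding c power_one_right .
  moreover have "form_attains (2 ^ b) U (code_ops ?ops) \<mu> \<longleftrightarrow> form_attains d U ?ops \<mu>"
    by (rule form_attains_code_ops[OF Q.finite_U ops])
  ultimately show ?thesis unfolding q dim Q.attains_iff[OF ops2] by simp
qed

lemma satisfiable_iff_qubits:
  assumes "block_system 2 n' b U \<beta>" "U \<subseteq> {..<n}"
    and "\<forall>c\<in>set cs. is_clause C n c" "\<forall>(t, qs)\<in>set cs. set qs \<subseteq> U"
    and "\<forall>c\<in>set (map (\<lambda>(t, qs). (t, concat (map \<beta> qs))) cs). is_clause qubit_qcsp n' c"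
  shows "satisfiable qubit_qcsp (n', map (\<lambda>(t, qs). (t, concat (map \<beta> qs))) cs) \<longleftrightarrow> satisfiable C (n, cs)"
  unfolding satisfiable_iff[OF C assms(3)] satisfiable_iff[OF is_qcsp_qubit_qcsp assms(5)] qubit_qcsp_simps(1)
  by (rule attains_iff_qubits[OF assms(1-4)])

text \<open>Polynomials with natural coefficients are monotone, so using the old gap polynomial at a
  larger number of qubits only weakens the requirement.\<close>

lemma gap_le: "0 < n \<Longrightarrow> n \<le> n' \<Longrightarrow> 1 / real (poly (gap_poly C) n') \<le> 1 / real (poly (gap_poly C) n)"
  using C poly_nat_mono[of n n' "gap_poly C"] poly_nat_pos[of "gap_poly C" n]
  by (intro divide_left_mono) (auto simp: is_qcsp_def)

lemma encode_block_system: "block_system 2 (b * n) b {..<n} (\<lambda>q. [b * q..<b * q + b])"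
proof
  show "set [b * q..<b * q + b] \<subseteq> {..<b * n}" if "q \<in> {..<n}" for q
  proof -
    have "b * Suc q \<le> b * n" using that by (intro mult_le_mono2) simp
    then show ?thesis by auto
  qed
  show "set [b * q..<b * q + b] \<inter> set [b * q'..<b * q' + b] = {}" if "q \<noteq> q'" for q q'
  proof -
    have div: "x div b = p" if x: "x \<in> set [b * p..<b * p + b]" for x p
    proof -
      from x obtain j where "x = b * p + j" "j < b" by (auto simp: le_iff_add)
      then show ?thesis by simp
    qed
    show ?thesis
    proof (rule equals0I)
      fix x assume "x \<in> set [b * q..<b * q + b] \<inter> set [b * q'..<b * q' + b]"
      then show False using div[of x q] div[of x q'] \<open>q \<noteq> q'\<close> by blast
    qed
  qed
qed auto

lemma concat_block_clause:
  assumes bs: "block_system 2 n' b U \<beta>" and c: "is_clause C n (t, qs)" and qs: "set qs \<subseteq> U"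
  shows "is_clause qubit_qcsp n' (t, concat (map \<beta> qs))"
proof -
  interpret block_system 2 n' b U \<beta> by (rule bs)
  have "length (concat (map \<beta> qs)) = b * length qs"
    using qs by (induction qs) (auto simp: length_block)
  moreover have "distinct (concat (map \<beta> qs))"
  proof -
    have "distinct qs" using c by (simp add: is_clause_def)
    then show ?thesis using qs
    proof (induction qs)
      case (Cons q qs)
      have "set (\<beta> q) \<inter> set (\<beta> q') = {}" if "q' \<in> set qs" for q'
        using that Cons.prems by (intro block_disjoint) auto
      then have "set (\<beta> q) \<inter> set (concat (map \<beta> qs)) = {}" by auto
      then show ?case using Cons distinct_block[of q] by simp
    qed simp
  qed
  moreover have "set (concat (map \<beta> qs)) \<subseteq> {..<n'}"
    using UN_least[of "set qs" "\<lambda>q. set (\<beta> q)" "{..<n'}"] block_subset qs by auto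
  ultimately show ?thesis using c by (auto simp: is_clause_def ctypes_qubit_qcsp)
qed

lemma encode_instance:
  assumes I: "is_instance C (n, cs)"
  shows "is_instance qubit_qcsp (b * n, map (encode_clause b) cs)"
    and "satisfiable C (n, cs) \<Longrightarrow> satisfiable qubit_qcsp (b * n, map (encode_clause b) cs)"
    and "unsatisfiable C (n, cs) \<Longrightarrow> unsatisfiable qubit_qcsp (b * n, map (encode_clause b) cs)"
proof -
  let ?\<beta> = "\<lambda>q. [b * q..<b * q + b]"
  note bs = encode_block_system[of n]
  have n: "0 < n" "n \<le> b * n" using I b by (auto simp: is_instance_def)
  have cs: "\<forall>c\<in>set cs. is_clause C n c" "\<forall>(t, qs)\<in>set cs. set qs \<subseteq> {..<n}"
    using I by (auto simp: is_instance_def is_clause_def)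
  have e: "map (encode_clause b) cs = map (\<lambda>(t, qs). (t, concat (map ?\<beta> qs))) cs"
    by (simp add: encode_clause_def)
  have cs': "\<forall>c\<in>set (map (\<lambda>(t, qs). (t, concat (map ?\<beta> qs))) cs). is_clause qubit_qcsp (b * n) c"
  proof
    fix c assume "c \<in> set (map (\<lambda>(t, qs). (t, concat (map ?\<beta> qs))) cs)"
    then obtain t qs where "(t, qs) \<in> set cs" "c = (t, concat (map ?\<beta> qs))" by auto
    then show "is_clause qubit_qcsp (b * n) c"
      using concat_block_clause[OF bs, of n t qs] bspec[OF cs(1), of "(t, qs)"] bspec[OF cs(2), of "(t, qs)"] by simp
  qed
  show "is_instance qubit_qcsp (b * n, map (encode_clause b) cs)"
    using I n cs' poly_nat_mono[OF n(2), of "count_poly C"] b unfolding e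
    by (auto simp: is_instance_def)
  show "satisfiable C (n, cs) \<Longrightarrow> satisfiable qubit_qcsp (b * n, map (encode_clause b) cs)"
    unfolding e using satisfiable_iff_qubits[OF bs order_refl cs cs'] by blast
  show "unsatisfiable C (n, cs) \<Longrightarrow> unsatisfiable qubit_qcsp (b * n, map (encode_clause b) cs)"
    unfolding e unsatisfiable_iff qubit_qcsp_simps attains_iff_qubits[OF bs order_refl cs]
    using gap_le[OF n] by (meson less_le_trans)
qed

text \<open>A satisfying state has every block of every clause in the code, hence is annihilated by
  \<open>S\<close> on each block. A conflict would make it zero.\<close>

lemma satisfiable_consistent:
  assumes I: "is_instance qubit_qcsp (n, cs)" and sat: "satisfiable qubit_qcsp (n, cs)"
  shows "consistent b cs"
proof (rule ccontr)
  assume "\<not> consistent b cs"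
  then obtain A B where AB: "A \<in> blocks b cs" "B \<in> blocks b cs" "set A \<inter> set B \<noteq> {}" "A \<noteq> B"
    by (auto simp: consistent_def)
  obtain \<psi> where psi: "\<psi> \<in> states 2 n" "\<forall>c\<in>set cs. clause_op qubit_qcsp n c *\<^sub>v \<psi> = 0\<^sub>v (2 ^ n)"
    using sat by (auto simp: satisfiable_def)
  then have pc: "\<psi> \<in> carrier_vec (2 ^ n)" "\<psi> \<noteq> 0\<^sub>v (2 ^ n)" by (auto simp: states_def)
  have block: "length A = b \<and> distinct A \<and> set A \<subseteq> {..<n} \<and> act_on 2 n S A *\<^sub>v \<psi> = 0\<^sub>v (2 ^ n)"
    if A: "A \<in> blocks b cs" for A
  proof -
    obtain t qs l where c: "(t, qs) \<in> set cs" "l < length qs div b" and Al: "A = chunk b qs l"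
      using A by (auto simp: blocks_def)
    have cl: "is_clause qubit_qcsp n (t, qs)" using I c(1) by (auto simp: is_instance_def)
    define a where "a = fst (ctypes C ! t)"
    define M where "M = snd (ctypes C ! t)"
    have t: "t < length (ctypes C)" and len: "length qs = b * a" and qs: "distinct qs" "set qs \<subseteq> {..<n}"
      using cl by (auto simp: is_clause_def ctypes_qubit_qcsp a_def)
    have l: "l < a" using c(2) len b by simp
    have chunk_less: "set (chunk b qs k) \<subseteq> {..<n}" for k by (rule order_trans[OF set_chunk_subset qs(2)])
    \<comment> \<open>The qubits of one clause are distinct, so its blocks form a block system even
      if those of the whole instance do not.\<close>
    interpret Q: block_system 2 n b "{..<a}" "chunk b qs"
      by standard (use chunk_less chunks_disjoint[OF qs(1) len] length_chunk[OF len] distinct_chunk[OF qs(1)] in simp_all)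
    have M: "pos_semidef (d ^ length [0..<a]) M" using clause_type_psd[OF t] by (simp add: a_def M_def)
    have up: "set [0..<a] \<subseteq> {..<a}" "{..<a} = set [0..<a]" by auto
    let ?f = "\<lambda>z. form (2 ^ b) {..<a} (kernel_of (2 ^ b) (length [0..<a]) (code_op M (length [0..<a]))) [0..<a] (\<lambda>u. \<psi> $ Q.enc u z)"
    have op: "clause_op qubit_qcsp n (t, qs) = act_on 2 n (code_op M a) (concat (map (chunk b qs) [0..<a]))"
      using t by (simp add: clause_op_def ctypes_qubit_qcsp a_def M_def concat_chunks[OF len, unfolded a_def])
    have "(\<Sum>z\<in>configs 2 Q.rest. Re (?f z)) = Re ((clause_op qubit_qcsp n (t, qs) *\<^sub>v \<psi>) \<bullet>c \<psi>)"
      unfolding op Q.act_on_form[OF pc(1) up(1)] by (simp add: Re_sum)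
    also have "\<dots> = 0" using psi(2) c(1) pc(1) by auto
    finally have "(\<Sum>z\<in>configs 2 Q.rest. Re (?f z)) = 0" .
    moreover have "0 \<le> Re (?f z)" for z
      unfolding up(2) by (rule form_code_op_nonneg[OF M]) simp
    ultimately have f0: "Re (?f z) = 0" if "z \<in> configs 2 Q.rest" for z
      using that by (subst (asm) sum_nonneg_eq_0_iff) auto
    have "act_on 2 n S A *\<^sub>v \<psi> = 0\<^sub>v (2 ^ n)"
    proof (rule eq_vecI)
      fix i assume "i < dim_vec (0\<^sub>v (2 ^ n) :: complex vec)"
      then have i: "i < 2 ^ n" by simp
      define u where "u = fst (Q.dec i)"
      define z where "z = snd (Q.dec i)"
      have uz: "u \<in> configs (2 ^ b) {..<a}" "z \<in> configs 2 Q.rest" and e: "Q.enc u z = i"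
        using Q.dec_in[of i] Q.enc_dec[OF i] by (auto simp: u_def z_def)
      have ul: "u l < 2 ^ b" using uz(1) l by (auto simp: PiE_iff)
      have "(act_on 2 n S A *\<^sub>v \<psi>) $ Q.enc u z = (\<Sum>v<2 ^ b. S $$ (u l, v) * \<psi> $ Q.enc (u(l := v)) z)"
        unfolding Al by (rule Q.act_on_block[OF pc(1) _ uz]) (use l in simp)
      also have "\<dots> = 0"
        by (rule form_code_op_null[OF M distinct_upt, where \<phi> = "\<lambda>u. \<psi> $ Q.enc u z"])
          (use f0[OF uz(2)] S_E[OF _ ul] uz(1) l up(2) in auto)
      finally show "(act_on 2 n S A *\<^sub>v \<psi>) $ i = 0\<^sub>v (2 ^ n) $ i" using e i by simp
    qed (simp add: act_on_def)
    then show ?thesis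
      using Al l length_chunk[OF len l] distinct_chunk[OF qs(1)] chunk_less[of l] by simp
  qed
  have "(n, A, B) \<in> conflicts b" using block[OF AB(1)] block[OF AB(2)] AB by (auto simp: conflicts_def)
  then have "\<psi> = 0\<^sub>v (2 ^ n)"
    using separates block[OF AB(1)] block[OF AB(2)] pc(1) by (fastforce simp: separates_def)
  then show False using pc(2) by simp
qed

text \<open>Consistent blocks are equal or disjoint, so each is determined by its last qubit and
  together they form a block system. The number \<open>n\<close> is kept, with numbers that name no
  block becoming idle qudits; hence the polynomials are evaluated at the same argument.\<close>

lemma decode_instance:
  assumes I: "is_instance qubit_qcsp (n, cs)" and con: "consistent b cs"
  shows "is_instance C (n, map (decode_clause b) cs)"
    and "satisfiable qubit_qcsp (n, cs) \<Longrightarrow> satisfiable C (n, map (decode_clause b) cs)"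
    and "unsatisfiable qubit_qcsp (n, cs) \<Longrightarrow> unsatisfiable C (n, map (decode_clause b) cs)"
proof -
  have n: "0 < n" using I by (simp add: is_instance_def)
  have clause: "t < length (ctypes C) \<and> length qs = b * fst (ctypes C ! t) \<and> distinct qs \<and> set qs \<subseteq> {..<n}"
    if "(t, qs) \<in> set cs" for t qs
    using I that by (auto simp: is_instance_def is_clause_def ctypes_qubit_qcsp)
  define U where "U = last ` blocks b cs"
  define \<beta> where "\<beta> q = (THE A. A \<in> blocks b cs \<and> last A = q)" for q
  have blk: "length A = b \<and> distinct A \<and> set A \<subseteq> {..<n} \<and> last A \<in> set A" if "A \<in> blocks b cs" for A
  proof -
    obtain t qs l where c: "(t, qs) \<in> set cs" "l < length qs div b" "A = chunk b qs l"
      using \<open>A \<in> blocks b cs\<close> by (auto simp: blocks_def)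
    have l: "length qs = b * fst (ctypes C ! t)" "l < fst (ctypes C ! t)"
      using clause[OF c(1)] c(2) b by auto
    have "length A = b" using length_chunk[OF l] c(3) by simp
    moreover from this have "A \<noteq> []" using b by auto
    ultimately show ?thesis
      using clause[OF c(1)] c(3) set_chunk_subset[of b qs l] distinct_chunk[of qs b l] by auto
  qed
  have \<beta>: "\<beta> (last A) = A" if "A \<in> blocks b cs" for A
    unfolding \<beta>_def
  proof (rule the_equality)
    show "B = A" if B: "B \<in> blocks b cs \<and> last B = last A" for B
      using con B \<open>A \<in> blocks b cs\<close> blk[of A] blk[of B] unfolding consistent_def by (metis disjoint_iff)
  qed (use that in simp)
  have bs: "block_system 2 n b U \<beta>"
  proof
    have "blocks b cs \<subseteq> (\<lambda>(c, l). chunk b (snd c) l) ` (SIGMA c:set cs. {..<length (snd c) div b})"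
      by (force simp: blocks_def)
    then have "finite (blocks b cs)" by (rule finite_subset) auto
    then show "finite U" by (simp add: U_def)
    have U_block: "\<exists>A\<in>blocks b cs. q = last A \<and> \<beta> q = A" if "q \<in> U" for q
      using that \<beta> by (auto simp: U_def)
    show "length (\<beta> q) = b" "distinct (\<beta> q)" "set (\<beta> q) \<subseteq> {..<n}" if "q \<in> U" for q
      using U_block[OF that] blk by auto
    show "set (\<beta> q) \<inter> set (\<beta> q') = {}" if q: "q \<in> U" "q' \<in> U" "q \<noteq> q'" for q q'
    proof -
      obtain A B where "A \<in> blocks b cs" "q = last A" "\<beta> q = A" "B \<in> blocks b cs" "q' = last B" "\<beta> q' = B"
        using U_block[OF q(1)] U_block[OF q(2)] by blast
      then show ?thesis using con q(3) unfolding consistent_def by metis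
    qed
  qed simp
  have U: "U \<subseteq> {..<n}" using blk by (fastforce simp: U_def)
  let ?cs = "map (decode_clause b) cs"
  have chunk_block: "chunk b qs l \<in> blocks b cs" if "(t, qs) \<in> set cs" "l < length qs div b" for t qs l
    using that by (auto simp: blocks_def)
  \<comment> \<open>Expanding the names by \<open>\<beta>\<close> recovers the given instance, so
    the general equivalence applies to the pair.\<close>
  have undo: "map (\<lambda>(t, qs). (t, concat (map \<beta> qs))) ?cs = cs"
  proof -
    have "(case decode_clause b c of (t, qs) \<Rightarrow> (t, concat (map \<beta> qs))) = c" if "c \<in> set cs" for c
    proof -
      obtain t qs where c: "c = (t, qs)" by (cases c)
      have m: "map \<beta> (map (\<lambda>l. last (chunk b qs l)) [0..<length qs div b]) = map (chunk b qs) [0..<length qs div b]"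
        using \<beta>[OF chunk_block] that c by simp
      have len: "length qs = b * (length qs div b)" using clause that c b by force
      show ?thesis by (simp only: c decode_clause_def prod.case m concat_chunks[OF len])
    qed
    then show ?thesis by (simp add: map_idI)
  qed
  have sub: "\<forall>(t, qs)\<in>set ?cs. set qs \<subseteq> U"
    using chunk_block by (fastforce simp: decode_clause_def U_def)
  have cl: "\<forall>c\<in>set ?cs. is_clause C n c"
  proof
    fix c assume c: "c \<in> set ?cs"
    obtain t qs where tq: "(t, qs) \<in> set cs" "c = decode_clause b (t, qs)" using c by auto
    note K = clause[OF tq(1)]
    have a: "length qs div b = fst (ctypes C ! t)" using K b by simp
    have "inj_on (\<lambda>l. last (chunk b qs l)) {0..<length qs div b}"
    proof (rule inj_onI, rule ccontr)
      fix l l' assume l: "l \<in> {0..<length qs div b}" "l' \<in> {0..<length qs div b}" "l \<noteq> l'"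
        and e: "last (chunk b qs l) = last (chunk b qs l')"
      have "last (chunk b qs l) \<in> set (chunk b qs l)" "last (chunk b qs l') \<in> set (chunk b qs l')"
        using l blk[OF chunk_block[OF tq(1)]] by auto
      then show False using e chunks_disjoint[of qs b "fst (ctypes C ! t)" l l'] K l a by auto
    qed
    moreover have "set (snd c) \<subseteq> U" using bspec[OF sub c] by (simp add: case_prod_unfold)
    ultimately show "is_clause C n c"
      using K a U tq(2) by (auto simp: is_clause_def decode_clause_def distinct_map)
  qed
  show "is_instance C (n, ?cs)" using I cl by (auto simp: is_instance_def)
  have cs': "\<forall>c\<in>set (map (\<lambda>(t, qs). (t, concat (map \<beta> qs))) ?cs). is_clause qubit_qcsp n c"
    unfolding undo using I by (auto simp: is_instance_def)
  show "satisfiable qubit_qcsp (n, cs) \<Longrightarrow> satisfiable C (n, ?cs)"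
    using satisfiable_iff_qubits[OF bs U cl sub cs'] unfolding undo by blast
  show "unsatisfiable qubit_qcsp (n, cs) \<Longrightarrow> unsatisfiable C (n, ?cs)"
    using attains_iff_qubits[OF bs U cl sub] unfolding undo unsatisfiable_iff qubit_qcsp_simps by blast
qed

end

section \<open>Constant-depth circuits\<close>

lemma foldl_snoc_length: "length (foldl (\<lambda>vs g. vs @ [h vs g]) vs0 gs) = length vs0 + length gs"
  by (induction gs arbitrary: vs0) auto

lemma foldl_snoc_prefix: "i < length vs0 \<Longrightarrow> foldl (\<lambda>vs g. vs @ [h vs g]) vs0 gs ! i = vs0 ! i"
  by (induction gs arbitrary: vs0) (auto simp: nth_append)

lemma length_gate_values [simp]: "length (gate_values x gs) = length gs"
  by (simp add: gate_values_def foldl_snoc_length)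

lemma length_gate_depths [simp]: "length (gate_depths gs) = length gs"
  by (simp add: gate_depths_def foldl_snoc_length)

lemma gate_values_append_nth [simp]:
  "i < length gs \<Longrightarrow> gate_values x (gs @ ext) ! i = gate_values x gs ! i"
  using foldl_snoc_prefix[of i "gate_values x gs" "gate_value x" ext]
  by (simp add: gate_values_def foldl_snoc_length)

lemma gate_depths_append_nth [simp]:
  "i < length gs \<Longrightarrow> gate_depths (gs @ ext) ! i = gate_depths gs ! i"
  using foldl_snoc_prefix[of i "gate_depths gs" gate_depth ext]
  by (simp add: gate_depths_def foldl_snoc_length)

lemma gate_values_snoc: "gate_values x (gs @ [g]) = gate_values x gs @ [gate_value x (gate_values x gs) g]"
  by (simp add: gate_values_def)

lemma gate_depths_snoc: "gate_depths (gs @ [g]) = gate_depths gs @ [gate_depth (gate_depths gs) g]"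
  by (simp add: gate_depths_def)

definition gates_ok :: "nat \<Rightarrow> gate list \<Rightarrow> bool" where
  "gates_ok N gs \<longleftrightarrow> is_circuit N (gs, [])"

definition gates_size :: "gate list \<Rightarrow> nat" where
  "gates_size gs = (\<Sum>g\<leftarrow>gs. 1 + length (operands g))"

lemma gates_ok_snoc:
  "gates_ok N (gs @ [g]) \<longleftrightarrow>
     gates_ok N gs \<and> (\<forall>j\<in>set (operands g). j < length gs) \<and> (\<forall>i. g = InG i \<longrightarrow> i < N)"
  by (auto simp: gates_ok_def is_circuit_def nth_append less_Suc_eq)

lemma gates_size_simps [simp]:
  "gates_size [] = 0" "gates_size (gs @ hs) = gates_size gs + gates_size hs"
  "gates_size [g] = 1 + length (operands g)"
  by (simp_all add: gates_size_def)

text \<open>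
  A predicate is counted as computable if every circuit can be extended by few gates, all of small
  depth, to one that computes it: in this relative form no gate ever has to be renumbered.
\<close>

definition extends_to :: "nat \<Rightarrow> nat \<Rightarrow> nat \<Rightarrow> (bool list \<Rightarrow> bool) list \<Rightarrow> gate list \<Rightarrow> gate list \<Rightarrow> nat list \<Rightarrow> bool" where
  "extends_to N D s Ps gs ext js \<longleftrightarrow> gates_ok N (gs @ ext) \<and> gates_size ext \<le> s \<and>
     (\<forall>p. length gs \<le> p \<and> p < length (gs @ ext) \<longrightarrow> gate_depths (gs @ ext) ! p \<le> D) \<and>
     length js = length Ps \<and>
     (\<forall>k<length Ps. js ! k < length (gs @ ext) \<and> gate_depths (gs @ ext) ! (js ! k) \<le> D \<and>
        (\<forall>x. length x = N \<longrightarrow> gate_values x (gs @ ext) ! (js ! k) = (Ps ! k) x))"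

definition computable :: "nat \<Rightarrow> nat \<Rightarrow> nat \<Rightarrow> (bool list \<Rightarrow> bool) \<Rightarrow> bool" where
  "computable N D s P \<longleftrightarrow> (\<forall>gs. gates_ok N gs \<longrightarrow> (\<exists>ext j. extends_to N D s [P] gs ext [j]))"

text \<open>The extensions are appended one after another. Earlier gates keep position, value and
  depth, so sizes add up while the depth bound stays.\<close>

lemma computable_list:
  assumes "\<forall>P\<in>set Ps. computable N D s P" and "gates_ok N gs"
  shows "\<exists>ext js. extends_to N D (length Ps * s) Ps gs ext js"
  using assms
proof (induction Ps arbitrary: gs)
  case Nil
  then show ?case by (intro exI[of _ "[]"]) (auto simp: extends_to_def)
next
  case (Cons P Ps)
  obtain e1 j where 1: "extends_to N D s [P] gs e1 [j]"
    using Cons.prems by (auto simp: computable_def)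
  then have "gates_ok N (gs @ e1)" by (simp add: extends_to_def)
  then obtain e2 js where 2: "extends_to N D (length Ps * s) Ps (gs @ e1) e2 js"
    using Cons.IH[of "gs @ e1"] Cons.prems(1) by auto
  have d: "gate_depths (gs @ e1 @ e2) ! p \<le> D" if "length gs \<le> p" "p < length (gs @ e1 @ e2)" for p
  proof (cases "p < length (gs @ e1)")
    case True
    then show ?thesis using 1 that gate_depths_append_nth[of p "gs @ e1" e2]
      by (auto simp: extends_to_def)
  next
    case False
    then show ?thesis using 2 that by (auto simp: extends_to_def)
  qed
  have j: "j < length (gs @ e1)" "gate_depths (gs @ e1) ! j \<le> D"
    "\<And>x. length x = N \<Longrightarrow> gate_values x (gs @ e1) ! j = P x"
    using 1 by (auto simp: extends_to_def)
  have j': "gate_depths (gs @ e1 @ e2) ! j \<le> D"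
    "\<And>x. length x = N \<Longrightarrow> gate_values x (gs @ e1 @ e2) ! j = P x"
    using j gate_depths_append_nth[of j "gs @ e1" e2] gate_values_append_nth[of j "gs @ e1" _ e2]
    by auto
  have "extends_to N D (length (P # Ps) * s) (P # Ps) gs (e1 @ e2) (j # js)"
    using 1 2 d j(1) j' unfolding extends_to_def by (auto simp: nth_Cons split: nat.splits)
  then show ?case by blast
qed

text \<open>One more gate \<open>G js\<close> is fed by the gates computing \<open>Ps\<close>: one
  more level, and at most \<open>length Ps\<close> wires besides the gate itself.\<close>

lemma computable_snoc:
  assumes ok: "\<And>gs ext js. extends_to N D s Ps gs ext js \<Longrightarrow>
       set (operands (G js)) \<subseteq> set js \<and> length (operands (G js)) \<le> length Ps \<and> (\<forall>i. G js = InG i \<longrightarrow> i < N) \<and>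
       (\<forall>x. length x = N \<longrightarrow> gate_value x (gate_values x (gs @ ext)) (G js) = P x)"
    and ext: "\<And>gs. gates_ok N gs \<Longrightarrow> \<exists>ext js. extends_to N D s Ps gs ext js"
  shows "computable N (Suc D) (s + length Ps + 1) P"
  unfolding computable_def
proof (intro allI impI)
  fix gs assume "gates_ok N gs"
  then obtain ext js where E: "extends_to N D s Ps gs ext js" using ext by blast
  note G = ok[OF E]
  let ?g = "G js"
  have js: "\<And>j. j \<in> set js \<Longrightarrow> j < length (gs @ ext) \<and> gate_depths (gs @ ext) ! j \<le> D"
    using E by (auto simp: extends_to_def in_set_conv_nth)
  have gd: "gate_depth (gate_depths (gs @ ext)) ?g \<le> Suc D"
  proof -
    have "Max (insert 0 ((!) (gate_depths (gs @ ext)) ` set (operands ?g))) \<le> D"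
      using G js by (subst Max_le_iff) auto
    then show ?thesis by (cases ?g) auto
  qed
  have ok': "gates_ok N ((gs @ ext) @ [?g])"
    using E G js by (subst gates_ok_snoc) (auto simp: extends_to_def)
  have "extends_to N (Suc D) (s + length Ps + 1) [P] gs (ext @ [?g]) [length (gs @ ext)]"
    using E G gd ok' gate_depths_snoc[of "gs @ ext" ?g] gate_values_snoc[of _ "gs @ ext" ?g]
    unfolding extends_to_def
    by (auto simp: nth_append le_Suc_eq)
  then show "\<exists>ext j. extends_to N (Suc D) (s + length Ps + 1) [P] gs ext [j]" by blast
qed

lemma extends_to_mono:
  "extends_to N D s Ps gs ext js \<Longrightarrow> D \<le> D' \<Longrightarrow> s \<le> s' \<Longrightarrow> extends_to N D' s' Ps gs ext js"
  unfolding extends_to_def by auto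

lemma computable_mono:
  "computable N D s P \<Longrightarrow> D \<le> D' \<Longrightarrow> s \<le> s' \<Longrightarrow> computable N D' s' P"
  unfolding computable_def by (blast intro: extends_to_mono)

lemma computable_cong:
  "computable N D s P \<Longrightarrow> (\<And>x. length x = N \<Longrightarrow> P x = Q x) \<Longrightarrow> computable N D s Q"
  unfolding computable_def extends_to_def by simp

lemma computable_input: "i < N \<Longrightarrow> computable N 1 1 (\<lambda>x. x ! i)"
  using computable_snoc[of N 0 0 "[]" "\<lambda>_. InG i" "\<lambda>x. x ! i"] computable_list[of "[]" N 0 0]
  by auto

lemma computable_not: "computable N D s P \<Longrightarrow> computable N (Suc D) (s + 2) (\<lambda>x. \<not> P x)"
  using computable_snoc[of N D s "[P]" "\<lambda>js. NotG (js ! 0)" "\<lambda>x. \<not> P x"]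
    computable_list[of "[P]" N D s]
  by (auto simp: extends_to_def)

lemma computable_all_list:
  assumes "\<forall>P\<in>set Ps. computable N D s P"
  shows "computable N (Suc D) (length Ps * s + length Ps + 1) (\<lambda>x. \<forall>P\<in>set Ps. P x)"
proof (rule computable_snoc[where G = AndG and Ps = Ps])
  fix gs ext js
  assume E: "extends_to N D (length Ps * s) Ps gs ext js"
  have "(\<forall>j\<in>set js. gate_values x (gs @ ext) ! j) = (\<forall>P\<in>set Ps. P x)" if "length x = N" for x
    using E that unfolding extends_to_def by (auto simp: all_set_conv_all_nth)
  then show "set (operands (AndG js)) \<subseteq> set js \<and> length (operands (AndG js)) \<le> length Ps \<and>
      (\<forall>i. AndG js = InG i \<longrightarrow> i < N) \<and>
      (\<forall>x. length x = N \<longrightarrow> gate_value x (gate_values x (gs @ ext)) (AndG js) = (\<forall>P\<in>set Ps. P x))"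
    using E by (auto simp: extends_to_def)
qed (use assms computable_list in blast)

text \<open>A single depth and a single polynomial serve all parameters \<open>i\<close>. This
  uniformity is what allows a part of the parameter to be quantified over input positions.\<close>

definition AC0_family :: "('i \<Rightarrow> bool list \<Rightarrow> bool) \<Rightarrow> bool" where
  "AC0_family P \<longleftrightarrow> (\<exists>D (s :: nat poly). \<forall>N i. computable N D (poly s N) (P i))"

lemma AC0_family_reindex: "AC0_family P \<Longrightarrow> AC0_family (\<lambda>i. P (h i))"
  unfolding AC0_family_def by blast

lemma AC0_family_not: assumes "AC0_family P" shows "AC0_family (\<lambda>i x. \<not> P i x)"
proof -
  obtain D and s :: "nat poly" where "\<forall>N i. computable N D (poly s N) (P i)"
    using assms by (auto simp: AC0_family_def)
  then have "\<forall>N i. computable N (Suc D) (poly (s + [:2:]) N) (\<lambda>x. \<not> P i x)"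
    using computable_not by auto
  then show ?thesis unfolding AC0_family_def by blast
qed

text \<open>A quantifier over positions is one conjunction of fan-in \<open>N\<close>: it costs one
  level and a factor \<open>N\<close> in size.\<close>

lemma AC0_family_all:
  fixes P :: "'i \<times> nat \<Rightarrow> bool list \<Rightarrow> bool"
  assumes "AC0_family P" shows "AC0_family (\<lambda>i x. \<forall>j<length x. P (i, j) x)"
proof -
  obtain D and s :: "nat poly" where c: "\<forall>N i. computable N D (poly s N) (P i)"
    using assms by (auto simp: AC0_family_def)
  have "computable N (Suc D) (poly ([:0, 1:] * s + [:1, 1:]) N) (\<lambda>x. \<forall>j<length x. P (i, j) x)" for N i
  proof -
    have "computable N (Suc D) (N * poly s N + N + 1) (\<lambda>x. \<forall>Q\<in>set (map (\<lambda>j. P (i, j)) [0..<N]). Q x)"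
      using computable_all_list[of "map (\<lambda>j. P (i, j)) [0..<N]" N D "poly s N"] c by auto
    then show ?thesis by (elim computable_cong[OF computable_mono]) (auto simp: algebra_simps)
  qed
  then show ?thesis unfolding AC0_family_def by blast
qed

lemma AC0_family_const: "AC0_family (\<lambda>i x. c i)"
proof -
  have t: "computable N 1 1 (\<lambda>x. True)" for N
    using computable_all_list[of "[]" N 0 0] by simp
  have "computable N 2 3 (\<lambda>x. False)" for N
    by (rule computable_cong[OF computable_mono[OF computable_not[OF t]]]) auto
  moreover have "computable N 2 3 (\<lambda>x. True)" for N
    by (rule computable_mono[OF t]) auto
  ultimately have "computable N 2 (poly [:3:] N) (\<lambda>x. c i)" for N i
    by (cases "c i") simp_all
  then show ?thesis unfolding AC0_family_def by blast
qed

lemma AC0_family_and: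
  assumes "AC0_family P" "AC0_family Q" shows "AC0_family (\<lambda>i x. P i x \<and> Q i x)"
proof -
  obtain D1 and s1 :: "nat poly" where 1: "\<forall>N i. computable N D1 (poly s1 N) (P i)"
    using assms(1) by (auto simp: AC0_family_def)
  obtain D2 and s2 :: "nat poly" where 2: "\<forall>N i. computable N D2 (poly s2 N) (Q i)"
    using assms(2) by (auto simp: AC0_family_def)
  let ?D = "max D1 D2"
  have "computable N (Suc ?D) (poly ([:2:] * (s1 + s2) + [:3:]) N) (\<lambda>x. P i x \<and> Q i x)" for N i
  proof -
    have "computable N ?D (poly (s1 + s2) N) (P i)" "computable N ?D (poly (s1 + s2) N) (Q i)"
      by (rule computable_mono[OF 1[rule_format]] computable_mono[OF 2[rule_format]]; simp)+
    then have "\<forall>R\<in>set [P i, Q i]. computable N ?D (poly (s1 + s2) N) R" by simp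
    from computable_all_list[OF this] show ?thesis
      by (elim computable_cong[OF computable_mono]) auto
  qed
  then show ?thesis unfolding AC0_family_def by blast
qed

text \<open>The guard gives positions beyond the input the value False, so that all parameters are
  covered by the same bounds.\<close>

lemma AC0_family_input: "AC0_family (\<lambda>i x. h i < length x \<and> x ! h i)"
proof -
  obtain D and s :: "nat poly" where c: "\<forall>N. computable N D (poly s N) (\<lambda>x. False)"
    using AC0_family_const[of "\<lambda>_ :: unit. False"] by (auto simp: AC0_family_def)
  have "computable N (max 1 D) (poly (s + 1) N) (\<lambda>x. h i < length x \<and> x ! h i)" for N i
  proof (cases "h i < N")
    case True
    show ?thesis
      by (rule computable_cong[OF computable_mono[OF computable_input[OF True]]]) (use True in auto)
  next
    case False
    show ?thesis
      by (rule computable_cong[OF computable_mono[OF c[rule_format, of N]]]) (use False in auto)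
  qed
  then show ?thesis unfolding AC0_family_def by blast
qed

text \<open>The circuit for each input length is chosen separately, so the length is a constant of
  the circuit and arbitrary functions of it are free.\<close>

lemma AC0_family_length:
  fixes P :: "'i \<times> nat \<Rightarrow> bool list \<Rightarrow> bool"
  assumes "AC0_family P" shows "AC0_family (\<lambda>i x. P (i, length x) x)"
proof -
  obtain D and s :: "nat poly" where c: "\<forall>N i. computable N D (poly s N) (P i)"
    using assms by (auto simp: AC0_family_def)
  have "computable N D (poly s N) (\<lambda>x. P (i, length x) x)" for N i
    by (rule computable_cong[OF c[rule_format, of N "(i, N)"]]) auto
  then show ?thesis unfolding AC0_family_def by blast
qed

lemma AC0I:
  fixes l :: "nat poly"
  assumes P: "AC0_family (\<lambda>i x. i < length (F x) \<and> F x ! i)"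
    and len: "\<And>x. length (F x) = L (length x)" and L: "\<And>N. L N \<le> poly l N"
  shows "AC0 F"
proof -
  obtain D and s :: "nat poly" where c: "\<forall>N i. computable N D (poly s N) (\<lambda>x. i < length (F x) \<and> F x ! i)"
    using P by (auto simp: AC0_family_def)
  have "\<exists>K. is_circuit N K \<and> circuit_depth K \<le> D \<and> circuit_size K \<le> poly (l * s + l) N \<and>
      (\<forall>x. length x = N \<longrightarrow> F x = run_circuit K x)" for N
  proof -
    let ?Ps = "map (\<lambda>i x. i < length (F x) \<and> F x ! i) [0..<L N]"
    have "gates_ok N []" by (simp add: gates_ok_def is_circuit_def)
    then obtain gs js where E: "extends_to N D (length ?Ps * poly s N) ?Ps [] gs js"
      using computable_list[of ?Ps N D "poly s N" "[]"] c by auto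
    have js: "length js = L N" "\<And>k. k < L N \<Longrightarrow> js ! k < length gs"
      "\<And>k x. k < L N \<Longrightarrow> length x = N \<Longrightarrow> gate_values x gs ! (js ! k) = F x ! k"
      using E by (auto simp: extends_to_def len)
    have "is_circuit N (gs, js)"
      using E js by (auto simp: extends_to_def gates_ok_def is_circuit_def in_set_conv_nth)
    moreover have "circuit_depth (gs, js) \<le> D"
      using E unfolding circuit_depth_def extends_to_def
      by (auto simp: in_set_conv_nth)
    moreover have "circuit_size (gs, js) \<le> poly (l * s + l) N"
    proof -
      have "circuit_size (gs, js) = gates_size gs + L N"
        by (simp add: circuit_size_def gates_size_def js)
      also have "\<dots> \<le> L N * poly s N + L N" using E by (simp add: extends_to_def)
      also have "\<dots> \<le> poly (l * s + l) N"
        using L[of N] by (simp add: add_mono mult_right_mono)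
      finally show ?thesis .
    qed
    moreover have "F x = run_circuit (gs, js) x" if "length x = N" for x
      by (rule nth_equalityI) (use that js len in \<open>auto simp: run_circuit_def\<close>)
    ultimately show ?thesis by blast
  qed
  then obtain K where "\<forall>N. is_circuit N (K N) \<and> circuit_depth (K N) \<le> D \<and>
      circuit_size (K N) \<le> poly (l * s + l) N \<and> (\<forall>x. length x = N \<longrightarrow> F x = run_circuit (K N) x)"
    by metis
  then show ?thesis unfolding AC0_def by blast
qed

lemma AC0_const: "AC0 (\<lambda>_. y)"
proof (rule AC0I[where l = "[:length y:]" and L = "\<lambda>_. length y"])
  show "AC0_family (\<lambda>i x. i < length y \<and> y ! i)" by (rule AC0_family_const)
qed auto

section \<open>Circuits for functions of symbol strings\<close>

definition symbol_of_bits :: "bool \<Rightarrow> bool \<Rightarrow> symbol" where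
  "symbol_of_bits b c = (if b then if c then Semi else Comma else Bit c)"

definition symbols :: "bool list \<Rightarrow> symbol list" where
  "symbols x = map (\<lambda>p. symbol_of_bits (x ! (2 * p)) (x ! (2 * p + 1))) [0..<length x div 2]"

abbreviation bits_of :: "symbol list \<Rightarrow> bool list" where
  "bits_of s \<equiv> concat (map symbol_bits s)"

lemma length_symbols [simp]: "length (symbols x) = length x div 2"
  by (simp add: symbols_def)

lemma length_symbol_bits [simp]: "length (symbol_bits c) = 2"
  by (cases c rule: symbol_bits.cases) auto

lemma length_bits_of [simp]: "length (bits_of s) = 2 * length s"
  by (induction s) auto

lemma bits_of_nth:
  "p < length s \<Longrightarrow> bits_of s ! (2 * p) \<longleftrightarrow> s ! p = Comma \<or> s ! p = Semi"
  "p < length s \<Longrightarrow> bits_of s ! Suc (2 * p) \<longleftrightarrow> s ! p = Bit True \<or> s ! p = Semi"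
proof (induction s arbitrary: p)
  case (Cons c s)
  { case 1 show ?case
      using 1 Cons.IH(1) by (cases p; cases c rule: symbol_bits.cases) auto
  next
    case 2 show ?case
      using 2 Cons.IH(2) by (cases p; cases c rule: symbol_bits.cases) auto }
qed auto

lemma symbols_bits_of [simp]: "symbols (bits_of s) = s"
proof (rule nth_equalityI)
  fix p assume "p < length (symbols (bits_of s))"
  then show "symbols (bits_of s) ! p = s ! p"
    by (cases "s ! p" rule: symbol_bits.cases)
       (auto simp: symbols_def bits_of_nth symbol_of_bits_def simp del: length_concat)
qed simp

definition symbol_at :: "symbol \<Rightarrow> nat \<Rightarrow> symbol list \<Rightarrow> bool" where
  "symbol_at c p s \<longleftrightarrow> p < length s \<and> s ! p = c"

definition definable :: "('i \<Rightarrow> symbol list \<Rightarrow> bool) \<Rightarrow> bool" where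
  "definable P \<longleftrightarrow> AC0_family (\<lambda>i x. P i (symbols x))"

lemma definable_reindex: "definable P \<Longrightarrow> definable (\<lambda>i. P (h i))"
  unfolding definable_def by (rule AC0_family_reindex)

lemma definable_const: "definable (\<lambda>i s. c i)"
  unfolding definable_def by (rule AC0_family_const)

lemma definable_not: "definable P \<Longrightarrow> definable (\<lambda>i s. \<not> P i s)"
  unfolding definable_def by (rule AC0_family_not)

lemma definable_and: "definable P \<Longrightarrow> definable Q \<Longrightarrow> definable (\<lambda>i s. P i s \<and> Q i s)"
  unfolding definable_def by (rule AC0_family_and)

lemma definable_or:
  assumes "definable P" "definable Q" shows "definable (\<lambda>i s. P i s \<or> Q i s)"
  using definable_not[OF definable_and[OF definable_not[OF assms(1)] definable_not[OF assms(2)]]]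
  by simp

lemma definable_imp:
  assumes "definable P" "definable Q" shows "definable (\<lambda>i s. P i s \<longrightarrow> Q i s)"
  using definable_or[OF definable_not[OF assms(1)] assms(2)] unfolding imp_conv_disj .

lemma definable_iff:
  assumes "definable P" "definable Q" shows "definable (\<lambda>i s. P i s \<longleftrightarrow> Q i s)"
  using definable_and[OF definable_imp[OF assms] definable_imp[OF assms(2,1)]]
  unfolding iff_conv_conj_imp .

lemma definable_if:
  assumes "definable P" "definable Q" "definable R"
  shows "definable (\<lambda>i s. if P i s then Q i s else R i s)"
  using definable_and[OF definable_imp[OF assms(1,2)] definable_imp[OF definable_not[OF assms(1)] assms(3)]]
  unfolding if_bool_eq_conj .

lemma definable_all:
  assumes "definable (\<lambda>k s. P (fst k) (snd k) s)"
  shows "definable (\<lambda>i s. \<forall>j<length s. P i j s)"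
proof -
  have c: "AC0_family (\<lambda>(i :: 'a \<times> nat) x. snd i < length x div 2)"
    using AC0_family_length[OF AC0_family_const, of "\<lambda>k. snd (fst k) < snd k div 2"]
    by (simp add: prod.case_eq_if)
  have "AC0_family (\<lambda>(k :: 'a \<times> nat) x. \<not> (snd k < length x div 2 \<and> \<not> P (fst k) (snd k) (symbols x)))"
    by (intro AC0_family_not AC0_family_and c assms[unfolded definable_def])
  from AC0_family_all[OF this]
  have "AC0_family (\<lambda>i x. \<forall>j<length x. \<not> (j < length x div 2 \<and> \<not> P i j (symbols x)))" by simp
  also have "(\<lambda>i x. \<forall>j<length x. \<not> (j < length x div 2 \<and> \<not> P i j (symbols x))) =
      (\<lambda>i x. \<forall>j<length (symbols x). P i j (symbols x))"
    by (intro ext) (auto intro: less_le_trans)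
  finally show ?thesis unfolding definable_def .
qed

lemma definable_ex:
  assumes "definable (\<lambda>k s. P (fst k) (snd k) s)"
  shows "definable (\<lambda>i s. \<exists>j<length s. P i j s)"
  using definable_not[OF definable_all[where P = "\<lambda>i j s. \<not> P i j s", OF definable_not[OF assms]]]
  by simp

lemma definable_length:
  assumes "definable (\<lambda>k s. P (fst k) (snd k) s)"
  shows "definable (\<lambda>i s. P i (length s) s)"
  using AC0_family_length[of "\<lambda>k x. P (fst k) (snd k div 2) (symbols x)"]
    AC0_family_reindex[OF assms[unfolded definable_def], of "\<lambda>k. (fst k, snd k div 2)"]
  unfolding definable_def by simp

lemma definable_symbol_at: "definable (\<lambda>i s. symbol_at (c i) (h i) s)"
proof -
  have b: "AC0_family (\<lambda>i x. h i < length x \<and> x ! h i)" for h :: "'a \<Rightarrow> nat"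
    by (rule AC0_family_input)
  have l: "AC0_family (\<lambda>i x. h i < length x div 2)"
    using AC0_family_length[OF AC0_family_const, of "\<lambda>k. h (fst k) < snd k div 2"]
    by (simp add: prod.case_eq_if)
  let ?b = "\<lambda>i x. 2 * h i < length x \<and> x ! (2 * h i)"
  let ?c = "\<lambda>i x. 2 * h i + 1 < length x \<and> x ! (2 * h i + 1)"
  \<comment> \<open>A disjunction over the four symbols, spelled out with negation and
    conjunction.\<close>
  have "AC0_family (\<lambda>i x. h i < length x div 2 \<and>
      \<not> (\<not> (\<not> ?b i x \<and> ?c i x \<and> c i = Bit True) \<and> \<not> (\<not> ?b i x \<and> \<not> ?c i x \<and> c i = Bit False) \<and>
         \<not> (?b i x \<and> ?c i x \<and> c i = Semi) \<and> \<not> (?b i x \<and> \<not> ?c i x \<and> c i = Comma)))"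
    by (intro AC0_family_not AC0_family_and b l AC0_family_const)
  also have "(\<lambda>i x. h i < length x div 2 \<and>
      \<not> (\<not> (\<not> ?b i x \<and> ?c i x \<and> c i = Bit True) \<and> \<not> (\<not> ?b i x \<and> \<not> ?c i x \<and> c i = Bit False) \<and>
         \<not> (?b i x \<and> ?c i x \<and> c i = Semi) \<and> \<not> (?b i x \<and> \<not> ?c i x \<and> c i = Comma))) =
      (\<lambda>i x. symbol_at (c i) (h i) (symbols x))"
  proof (intro ext, goal_cases)
    case (1 i x)
    show ?case
    proof (cases "h i < length x div 2")
      case True
      then have "2 * h i < length x" "Suc (2 * h i) < length x"
        and "symbols x ! h i = symbol_of_bits (x ! (2 * h i)) (x ! Suc (2 * h i))"
        by (auto simp: symbols_def)
      then show ?thesis using True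
        by (cases "c i" rule: symbol_bits.cases) (auto simp: symbol_at_def symbol_of_bits_def)
    qed (auto simp: symbol_at_def)
  qed
  finally show ?thesis unfolding definable_def .
qed

lemmas definable_intros = definable_const definable_not definable_and definable_or definable_imp
  definable_iff definable_if definable_all definable_ex definable_symbol_at

lemma AC0_symbol_function:
  fixes l :: "nat poly"
  assumes G: "definable (\<lambda>(i :: symbol \<times> nat) s. symbol_at (fst i) (snd i) (G s))"
    and len: "\<And>s. length (G s) = L (length s)" and L: "\<And>N. L N \<le> poly l N" and "mono L"
  shows "AC0 (\<lambda>x. bits_of (G (symbols x)))"
proof (rule AC0I[where l = "[:2:] * l" and L = "\<lambda>N. 2 * L (N div 2)"])
  have d: "definable (\<lambda>(i :: nat) s. symbol_at c (i div 2) (G s))" for c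
    using definable_reindex[OF G, of "\<lambda>i. (c, i div 2)"] by simp
  have "definable (\<lambda>i s. if even i then symbol_at Comma (i div 2) (G s) \<or> symbol_at Semi (i div 2) (G s)
      else symbol_at (Bit True) (i div 2) (G s) \<or> symbol_at Semi (i div 2) (G s))"
    by (intro definable_intros d)
  also have "(\<lambda>i s. if even i then symbol_at Comma (i div 2) (G s) \<or> symbol_at Semi (i div 2) (G s)
      else symbol_at (Bit True) (i div 2) (G s) \<or> symbol_at Semi (i div 2) (G s)) =
      (\<lambda>i s. i < length (bits_of (G s)) \<and> bits_of (G s) ! i)"
  proof (intro ext)
    fix i s
    show "(if even i then symbol_at Comma (i div 2) (G s) \<or> symbol_at Semi (i div 2) (G s)
      else symbol_at (Bit True) (i div 2) (G s) \<or> symbol_at Semi (i div 2) (G s)) \<longleftrightarrow>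
      i < length (bits_of (G s)) \<and> bits_of (G s) ! i"
    proof (cases "even i")
      case True
      then obtain p where "i = 2 * p" by blast
      then show ?thesis using bits_of_nth(1)[of p "G s"] by (auto simp: symbol_at_def simp del: length_concat)
    next
      case False
      then obtain p where "i = Suc (2 * p)" by (metis oddE Suc_eq_plus1)
      then show ?thesis using bits_of_nth(2)[of p "G s"] by (auto simp: symbol_at_def simp del: length_concat)
    qed
  qed
  finally show "AC0_family (\<lambda>i x. i < length (bits_of (G (symbols x))) \<and> bits_of (G (symbols x)) ! i)"
    unfolding definable_def .
next
  show "length (bits_of (G (symbols x))) = 2 * L (length x div 2)" for x
    by (simp add: len del: length_concat)
next
  show "2 * L (N div 2) \<le> poly ([:2:] * l) N" for N
    using L[of N] monoD[OF \<open>mono L\<close>, of "N div 2" N] by simp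
qed

section \<open>Scanning instances\<close>

text \<open>
  The state of a scan from the left: the number of symbols \<open>Semi\<close> read, the number of symbols
  \<open>Comma\<close> since the last \<open>Semi\<close>, and the value of the bits since the last symbol other than a bit.
\<close>

type_synonym scan_state = "nat \<times> nat \<times> nat"

fun step :: "scan_state \<Rightarrow> symbol \<Rightarrow> scan_state" where
  "step (k, i, v) (Bit c) = (k, i, 2 * v + of_bool c)"
| "step (k, i, v) Comma = (k, Suc i, 0)"
| "step (k, i, v) Semi = (Suc k, 0, 0)"

fun scan :: "(scan_state \<Rightarrow> symbol \<Rightarrow> symbol list) \<Rightarrow> scan_state \<Rightarrow> symbol list \<Rightarrow> symbol list" where
  "scan h st [] = []"
| "scan h st (c # s) = h st c @ scan h (step st c) s"

definition state_at :: "symbol list \<Rightarrow> nat \<Rightarrow> scan_state" where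
  "state_at s p = foldl step (0, 0, 0) (take p s)"

lemma scan_append: "scan h st (s @ t) = scan h st s @ scan h (foldl step st s) t"
  by (induction s arbitrary: st) auto

lemma concat_map_upt:
  "concat (map (\<lambda>p. map (F p) [0..<L]) [0..<m]) = map (\<lambda>i. F (i div L) (i mod L)) [0..<m * L]"
proof (induction m)
  case (Suc m)
  have "map (\<lambda>i. F (i div L) (i mod L)) [m * L..<m * L + L] = map (F m) [0..<L]"
    by (rule nth_equalityI) auto
  then show ?case using Suc upt_add_eq_append[of 0 "m * L" L] by (simp add: add.commute)
qed simp

lemma concat_map_const: "concat (map (\<lambda>j. map (\<lambda>_. c) [0..<L]) [0..<m]) = replicate (m * L) c"
  unfolding concat_map_upt[where F = "\<lambda>_ _. c"] by (simp add: map_replicate_const)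

lemma scan_eq_concat: "scan h st s = concat (map (\<lambda>p. h (foldl step st (take p s)) (s ! p)) [0..<length s])"
proof (induction s arbitrary: st)
  case (Cons c s)
  show ?case
    unfolding length_Cons upt_conv_Cons[OF zero_less_Suc] map_Suc_upt[symmetric]
    by (simp add: Cons o_def)
qed simp

text \<open>If every symbol is replaced by a string of the same length \<open>L\<close>, output
  position \<open>i\<close> depends on the scan state and the symbol at \<open>i div L\<close>
  only.\<close>

lemma scan_eq_map:
  assumes "\<And>st c. h st c = map (F st c) [0..<L]"
  shows "scan h (0, 0, 0) s =
    map (\<lambda>i. F (state_at s (i div L)) (s ! (i div L)) (i mod L)) [0..<length s * L]"
  unfolding scan_eq_concat assms state_at_def[symmetric] by (rule concat_map_upt)

lemma bits_value_Nil [simp]: "bits_value [] = 0"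
  by (simp add: bits_value_def)

lemma bits_value_snoc: "bits_value (bs @ [c]) = 2 * bits_value bs + of_bool c"
  by (simp add: bits_value_def)

lemma bits_value_replicate: "bits_value (replicate r False @ bs) = bits_value bs"
proof (induction bs rule: rev_induct)
  case Nil
  show ?case
  proof (induction r)
    case (Suc r)
    then show ?case using bits_value_snoc[of "replicate r False" False] by (simp add: replicate_append_same)
  qed simp
next
  case (snoc c bs)
  then show ?case using bits_value_snoc[of "replicate r False @ bs" c] by (simp add: bits_value_snoc)
qed

lemma bits_value_less: "bits_value bs < 2 ^ length bs"
proof (induction bs rule: rev_induct)
  case (snoc c bs)
  then show ?case by (cases c) (auto simp: bits_value_snoc)
qed simp

lemma foldl_step_bits: "foldl step (k, i, 0) (map Bit bs) = (k, i, bits_value bs)"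
  by (induction bs rule: rev_induct) (auto simp: bits_value_snoc)

lemma foldl_step_nats: "enc_nats ms u \<Longrightarrow> foldl step (k, i, 0) u = (k, i + length ms, 0)"
  by (induction arbitrary: i rule: enc_nats.induct) (auto simp: foldl_step_bits)

lemma enc_nats_zeros: "enc_nats (m # ms) u \<Longrightarrow> enc_nats (m # ms) (replicate r (Bit False) @ u)"
proof -
  assume "enc_nats (m # ms) u"
  then obtain bs w where u: "bs \<noteq> []" "enc_nats ms w" "m = bits_value bs" "u = map Bit bs @ Comma # w"
    by (cases rule: enc_nats.cases) auto
  then have "enc_nats (bits_value (replicate r False @ bs) # ms) (map Bit (replicate r False @ bs) @ Comma # w)"
    by (intro enc_nats.intros) auto
  then show ?thesis using u by (simp add: bits_value_replicate map_replicate)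
qed

lemma enc_nats_append: "enc_nats ms u \<Longrightarrow> enc_nats ms' u' \<Longrightarrow> enc_nats (ms @ ms') (u @ u')"
  by (induction rule: enc_nats.induct) (auto intro: enc_nats.intros)

lemma enc_clauses_semis: "enc_clauses cs w \<Longrightarrow> enc_clauses cs (replicate r Semi @ w)"
  by (induction r) (auto intro: enc_clauses.intros)

lemma enc_clauses_semis_right: "enc_clauses cs w \<Longrightarrow> enc_clauses cs (w @ replicate r Semi)"
proof (induction rule: enc_clauses.induct)
  case 1
  then show ?case using enc_clauses_semis[OF enc_clauses.intros(1), of r] by simp
qed (auto intro: enc_clauses.intros)

definition encodes_symbols :: "symbol list \<Rightarrow> instance_data \<Rightarrow> bool" where
  "encodes_symbols s = (\<lambda>(n, cs). \<exists>u w. enc_nats [n] u \<and> enc_clauses cs w \<and> s = u @ Semi # w)"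

lemma encodes_iff: "encodes x I \<longleftrightarrow> (\<exists>s. encodes_symbols s I \<and> x = bits_of s)"
  unfolding encodes_def encodes_symbols_def by (cases I) (simp only: prod.case, blast)

lemma encodes_symbols_pad: "encodes_symbols s I \<Longrightarrow> encodes_symbols (s @ replicate r Semi) I"
proof -
  assume "encodes_symbols s I"
  then obtain n cs u w where I: "I = (n, cs)" and s: "enc_nats [n] u" "enc_clauses cs w" "s = u @ Semi # w"
    by (cases I) (auto simp: encodes_symbols_def)
  have "s @ replicate r Semi = u @ Semi # (w @ replicate r Semi)" using s(3) by simp
  then show ?thesis
    unfolding I encodes_symbols_def prod.case using s(1) enc_clauses_semis_right[OF s(2)] by blast
qed

text \<open>The state just before a \<open>Comma\<close> holds the integer that this
  \<open>Comma\<close> terminates, together with its place in the clause.\<close>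

fun entries :: "scan_state \<Rightarrow> symbol list \<Rightarrow> scan_state list" where
  "entries st [] = []"
| "entries st (c # s) = (if c = Comma then [st] else []) @ entries (step st c) s"

lemma entries_append: "entries st (s @ t) = entries st s @ entries (foldl step st s) t"
  by (induction s arbitrary: st) auto

lemma set_entries: "set (entries st s) = {foldl step st (take p s) | p. p < length s \<and> s ! p = Comma}"
proof (induction s arbitrary: st)
  case (Cons c s)
  have "{foldl step st (take p (c # s)) | p. p < length (c # s) \<and> (c # s) ! p = Comma} =
      {st | x :: unit. c = Comma} \<union> {foldl step (step st c) (take p s) | p. p < length s \<and> s ! p = Comma}"
    (is "?L = ?R")
  proof (intro equalityI subsetI)
    fix x assume "x \<in> ?L"
    then obtain p where "p < length (c # s)" "(c # s) ! p = Comma" "x = foldl step st (take p (c # s))" by blast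
    then show "x \<in> ?R" by (cases p) auto
  next
    fix x assume "x \<in> ?R"
    then consider "x = st" "c = Comma" | p where "x = foldl step (step st c) (take p s)" "p < length s" "s ! p = Comma"
      by blast
    then show "x \<in> ?L"
    proof cases
      case 1
      then show ?thesis by (intro CollectI exI[of _ 0]) simp
    next
      case (2 p)
      then show ?thesis by (intro CollectI exI[of _ "Suc p"]) simp
    qed
  qed
  then show ?case using Cons by auto
qed simp

lemma set_entries_bits: "entries st (map Bit bs) = []"
  by (induction bs arbitrary: st) auto

lemma set_entries_nats:
  "enc_nats ms u \<Longrightarrow> set (entries (k, i, 0) u) = {(k, i + l, ms ! l) | l. l < length ms}"
proof (induction arbitrary: i rule: enc_nats.induct)
  case (2 bs ms w)
  have "{(k, i + l, (bits_value bs # ms) ! l) | l. l < length (bits_value bs # ms)} =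
      insert (k, i, bits_value bs) {(k, Suc i + l, ms ! l) | l. l < length ms}" (is "?L = ?R")
  proof (intro equalityI subsetI)
    fix x assume "x \<in> ?L"
    then obtain l where "l < length (bits_value bs # ms)" "x = (k, i + l, (bits_value bs # ms) ! l)" by blast
    then show "x \<in> ?R" by (cases l) auto
  next
    fix x assume "x \<in> ?R"
    then consider "x = (k, i, bits_value bs)" | l where "l < length ms" "x = (k, Suc i + l, ms ! l)" by blast
    then show "x \<in> ?L"
    proof cases
      case 1
      then show ?thesis by (intro CollectI exI[of _ 0]) simp
    next
      case (2 l)
      then show ?thesis by (intro CollectI exI[of _ "Suc l"]) simp
    qed
  qed
  then show ?case using 2 by (simp add: entries_append set_entries_bits foldl_step_bits)
qed simp

lemma set_entries_clauses:
  "enc_clauses cs w \<Longrightarrow> \<exists>\<kappa>. inj_on \<kappa> {..<length cs} \<and> (\<forall>c<length cs. k \<le> \<kappa> c) \<and>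
     set (entries (k, 0, 0) w) =
       {(\<kappa> c, l, (fst (cs ! c) # snd (cs ! c)) ! l) | c l. c < length cs \<and> l < Suc (length (snd (cs ! c)))}"
proof (induction arbitrary: k rule: enc_clauses.induct)
  case 1
  then show ?case by simp
next
  case (2 cs w)
  from "2.IH"[of "Suc k"] obtain \<kappa> where K: "inj_on \<kappa> {..<length cs}" "\<forall>c<length cs. Suc k \<le> \<kappa> c"
    "set (entries (Suc k, 0, 0) w) =
       {(\<kappa> c, l, (fst (cs ! c) # snd (cs ! c)) ! l) | c l. c < length cs \<and> l < Suc (length (snd (cs ! c)))}"
    by (elim exE conjE)
  show ?case
    by (intro exI[of _ \<kappa>] conjI K(1)) (use K(2,3) in auto)
next
  case (3 t qs u cs w)
  from "3.IH"[of "Suc k"] obtain \<kappa> where K: "inj_on \<kappa> {..<length cs}" "\<forall>c<length cs. Suc k \<le> \<kappa> c"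
    "set (entries (Suc k, 0, 0) w) =
       {(\<kappa> c, l, (fst (cs ! c) # snd (cs ! c)) ! l) | c l. c < length cs \<and> l < Suc (length (snd (cs ! c)))}"
    by (elim exE conjE)
  define \<kappa>' where "\<kappa>' c = (case c of 0 \<Rightarrow> k | Suc c \<Rightarrow> \<kappa> c)" for c
  let ?cs = "(t, qs) # cs"
  have "inj_on \<kappa>' {..<length ?cs}"
  proof (rule inj_onI)
    fix c c' assume c: "c \<in> {..<length ?cs}" "c' \<in> {..<length ?cs}" "\<kappa>' c = \<kappa>' c'"
    show "c = c'"
    proof (cases c; cases c')
      fix n n' assume n: "c = Suc n" "c' = Suc n'"
      then show ?thesis using c inj_onD[OF K(1), of n n'] by (simp add: \<kappa>'_def)
    next
      fix n assume n: "c = 0" "c' = Suc n"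
      then have "Suc k \<le> \<kappa> n" using c(2) K(2) by simp
      then show ?thesis using n c(3) by (simp add: \<kappa>'_def)
    next
      fix n assume n: "c = Suc n" "c' = 0"
      then have "Suc k \<le> \<kappa> n" using c(1) K(2) by simp
      then show ?thesis using n c(3) by (simp add: \<kappa>'_def)
    qed simp
  qed
  moreover have "\<forall>c<length ?cs. k \<le> \<kappa>' c"
  proof (intro allI impI)
    fix c assume "c < length ?cs"
    then show "k \<le> \<kappa>' c" using K(2) by (cases c) (auto simp: \<kappa>'_def intro: Suc_leD)
  qed
  moreover have "set (entries (k, 0, 0) (u @ Semi # w)) =
      {(\<kappa>' c, l, (fst (?cs ! c) # snd (?cs ! c)) ! l) | c l. c < length ?cs \<and> l < Suc (length (snd (?cs ! c)))}"
    (is "?L = ?R")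
  proof -
    have "?L = {(k, l, (t # qs) ! l) | l. l < Suc (length qs)} \<union>
       {(\<kappa> c, l, (fst (cs ! c) # snd (cs ! c)) ! l) | c l. c < length cs \<and> l < Suc (length (snd (cs ! c)))}"
      using set_entries_nats[OF 3(1), of k 0] K(3) by (simp add: entries_append foldl_step_nats[OF 3(1)])
    also have "\<dots> = ?R"
    proof (intro equalityI subsetI)
      fix x assume "x \<in> {(k, l, (t # qs) ! l) | l. l < Suc (length qs)} \<union>
       {(\<kappa> c, l, (fst (cs ! c) # snd (cs ! c)) ! l) | c l. c < length cs \<and> l < Suc (length (snd (cs ! c)))}"
      then consider l where "l < Suc (length qs)" "x = (k, l, (t # qs) ! l)"
        | c l where "c < length cs" "l < Suc (length (snd (cs ! c)))" "x = (\<kappa> c, l, (fst (cs ! c) # snd (cs ! c)) ! l)"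
        by blast
      then show "x \<in> ?R"
      proof cases
        case (1 l)
        then show ?thesis by (intro CollectI exI[of _ 0] exI[of _ l]) (simp add: \<kappa>'_def)
      next
        case (2 c l)
        then show ?thesis by (intro CollectI exI[of _ "Suc c"] exI[of _ l]) (simp add: \<kappa>'_def)
      qed
    next
      fix x assume "x \<in> ?R"
      then obtain c l where "c < length ?cs" "l < Suc (length (snd (?cs ! c)))" "x = (\<kappa>' c, l, (fst (?cs ! c) # snd (?cs ! c)) ! l)"
        by blast
      then show "x \<in> {(k, l, (t # qs) ! l) | l. l < Suc (length qs)} \<union>
       {(\<kappa> c, l, (fst (cs ! c) # snd (cs ! c)) ! l) | c l. c < length cs \<and> l < Suc (length (snd (cs ! c)))}"
        by (cases c) (auto simp: \<kappa>'_def)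
    qed
    finally show ?thesis .
  qed
  ultimately show ?case by blast
qed

subsection \<open>Encoding qudits into blocks\<close>

text \<open>
  Every symbol is replaced by a string of the same length, so that each position of the output is
  determined by a fixed position of the input: the bits of an integer become leading zeros, and the
  \<open>2 ^ e\<close> integers replacing it are written in place of its \<open>Comma\<close>. The arguments \<open>j\<close> and \<open>r\<close> are
  the number of the copy and the position in it; an integer that is not the number of a qudit is
  written once, as the last copy.
\<close>

definition encode_symbol :: "nat \<Rightarrow> nat \<Rightarrow> scan_state \<Rightarrow> symbol \<Rightarrow> nat \<Rightarrow> nat \<Rightarrow> symbol" where
  "encode_symbol e w = (\<lambda>(k, i, v) c j r. case c of Bit _ \<Rightarrow> Bit False | Semi \<Rightarrow> Semi
     | Comma \<Rightarrow> if r = w then if 0 < i \<or> j = 2 ^ e - 1 then Comma else Bit False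
         else Bit (if 0 < i then bit (v * 2 ^ e + j) (w - 1 - r)
           else j = 2 ^ e - 1 \<and> bit (if k = 0 then v * 2 ^ e else v) (w - 1 - r)))"

definition encode_chunk :: "nat \<Rightarrow> nat \<Rightarrow> scan_state \<Rightarrow> symbol \<Rightarrow> symbol list" where
  "encode_chunk e w st c = concat (map (\<lambda>j. map (encode_symbol e w st c j) [0..<Suc w]) [0..<2 ^ e])"

definition binary :: "nat \<Rightarrow> nat \<Rightarrow> bool list" where
  "binary w x = map (\<lambda>r. bit x (w - 1 - r)) [0..<w]"

lemma bits_value_binary: "x < 2 ^ w \<Longrightarrow> bits_value (binary w x) = x"
proof -
  assume x: "x < 2 ^ w"
  have "rev (binary w x) = map (bit x) [0..<w]"
    by (rule nth_equalityI) (auto simp: binary_def rev_nth)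
  then have "bits_value (binary w x) = take_bit w x"
    by (simp add: bits_value_def horner_sum_bit_eq_take_bit)
  then show ?thesis using x by (simp add: take_bit_nat_eq_self)
qed

lemma enc_nats_binary:
  "0 < w \<Longrightarrow> x < 2 ^ w \<Longrightarrow> enc_nats ms u \<Longrightarrow> enc_nats (x # ms) (map Bit (binary w x) @ Comma # u)"
  using enc_nats.intros(2)[of "binary w x" ms u] by (simp add: bits_value_binary) (simp add: binary_def)

lemma enc_nats_concat_binary:
  assumes "0 < w" "\<And>x. x \<in> set xs \<Longrightarrow> x < 2 ^ w"
  shows "enc_nats xs (concat (map (\<lambda>x. map Bit (binary w x) @ [Comma]) xs))"
  using assms(2) enc_nats_binary[OF assms(1)] by (induction xs) (auto intro: enc_nats.intros)

lemma encode_chunk_Bit: "encode_chunk e w st (Bit c) = replicate (2 ^ e * Suc w) (Bit False)"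
proof -
  have "encode_symbol e w st (Bit c) = (\<lambda>_ _. Bit False)" by (cases st) (simp add: encode_symbol_def)
  then show ?thesis by (simp only: encode_chunk_def concat_map_const)
qed

lemma encode_chunk_Semi: "encode_chunk e w st Semi = replicate (2 ^ e * Suc w) Semi"
proof -
  have "encode_symbol e w st Semi = (\<lambda>_ _. Semi)" by (cases st) (simp add: encode_symbol_def)
  then show ?thesis by (simp only: encode_chunk_def concat_map_const)
qed

lemma encode_chunk_Semi': "encode_chunk e w st Semi = Semi # replicate (2 ^ e * Suc w - 1) Semi"
proof -
  obtain r where "2 ^ e * Suc w = Suc r" by (cases "2 ^ e * Suc w") auto
  then show ?thesis unfolding encode_chunk_Semi by simp
qed

lemma encode_chunk_integer:
  "0 < i \<Longrightarrow> encode_chunk e w (k, i, v) Comma =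
     concat (map (\<lambda>x. map Bit (binary w x) @ [Comma]) [2 ^ e * v..<2 ^ e * v + 2 ^ e])"
proof -
  assume i: "0 < i"
  have "map (encode_symbol e w (k, i, v) Comma j) [0..<Suc w] = map Bit (binary w (2 ^ e * v + j)) @ [Comma]" for j
    using i by (simp add: encode_symbol_def binary_def mult.commute)
  moreover have "[2 ^ e * v..<2 ^ e * v + 2 ^ e] = map (\<lambda>j. 2 ^ e * v + j) [0..<2 ^ e]"
    by (rule nth_equalityI) auto
  ultimately show ?thesis by (simp add: encode_chunk_def o_def del: upt_Suc)
qed

lemma encode_chunk_first:
  "encode_chunk e w (k, 0, v) Comma = replicate ((2 ^ e - 1) * Suc w) (Bit False) @
     map Bit (binary w (if k = 0 then v * 2 ^ e else v)) @ [Comma]"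
proof -
  have up: "[0..<2 ^ e] = [0..<2 ^ e - 1] @ [2 ^ e - 1 :: nat]"
    using upt_Suc_append[of 0 "2 ^ e - 1"] by simp
  have "map (encode_symbol e w (k, 0, v) Comma j) [0..<Suc w] = map (\<lambda>_. Bit False) [0..<Suc w]" if "j < 2 ^ e - 1" for j
    using that by (intro map_cong refl) (auto simp: encode_symbol_def)
  then have "concat (map (\<lambda>j. map (encode_symbol e w (k, 0, v) Comma j) [0..<Suc w]) [0..<2 ^ e - 1]) =
      concat (map (\<lambda>j. map (\<lambda>_. Bit False) [0..<Suc w]) [0..<2 ^ e - 1])"
    by (intro arg_cong[where f = concat] map_cong refl) (auto simp del: upt_Suc)
  also have "\<dots> = replicate ((2 ^ e - 1) * Suc w) (Bit False)"
    by (rule concat_map_const)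
  finally show ?thesis
    unfolding encode_chunk_def up map_append concat_append
    by (simp add: encode_symbol_def binary_def)
qed

lemma scan_encode_bits:
  "scan (encode_chunk e w) st (map Bit bs) = replicate (length bs * (2 ^ e * Suc w)) (Bit False)"
  by (induction bs arbitrary: st) (simp_all add: encode_chunk_Bit replicate_add del: mult_Suc_right)

text \<open>The zeros written for the bits of an integer are leading zeros of the first of its
  copies. The width suffices because appending \<open>e\<close> bits to an integer of
  \<open>length bs\<close> bits gives at most \<open>length bs + e\<close> bits.\<close>

lemma scan_encode_integers:
  assumes "enc_nats ms u" "0 < i" "length u + e \<le> w" "0 < w"
  shows "enc_nats (concat (map (\<lambda>q. [2 ^ e * q..<2 ^ e * q + 2 ^ e]) ms)) (scan (encode_chunk e w) (k, i, 0) u)"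
  using assms
proof (induction arbitrary: i rule: enc_nats.induct)
  case 1
  then show ?case by (simp add: enc_nats.intros)
next
  case (2 bs ms u)
  let ?v = "bits_value bs"
  have less: "x < 2 ^ w" if "x \<in> set [2 ^ e * ?v..<2 ^ e * ?v + 2 ^ e]" for x
  proof -
    have "x < 2 ^ e * Suc ?v" using that by simp
    also have "\<dots> \<le> 2 ^ e * 2 ^ length bs" using bits_value_less[of bs] by (intro mult_le_mono2) simp
    also have "\<dots> = 2 ^ (e + length bs)" by (simp add: power_add)
    also have "\<dots> \<le> 2 ^ w" using 2 by (intro power_increasing) auto
    finally show ?thesis .
  qed
  have "enc_nats [2 ^ e * ?v..<2 ^ e * ?v + 2 ^ e] (encode_chunk e w (k, i, ?v) Comma)"
    unfolding encode_chunk_integer[OF 2(4)] using less by (intro enc_nats_concat_binary) (use 2 in auto)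
  moreover have "enc_nats (concat (map (\<lambda>q. [2 ^ e * q..<2 ^ e * q + 2 ^ e]) ms)) (scan (encode_chunk e w) (k, Suc i, 0) u)"
    using 2 by (intro "2.IH") auto
  ultimately have all: "enc_nats ([2 ^ e * ?v..<2 ^ e * ?v + 2 ^ e] @ concat (map (\<lambda>q. [2 ^ e * q..<2 ^ e * q + 2 ^ e]) ms))
      (encode_chunk e w (k, i, ?v) Comma @ scan (encode_chunk e w) (k, Suc i, 0) u)"
    by (rule enc_nats_append)
  have "[2 ^ e * ?v..<2 ^ e * ?v + 2 ^ e] = 2 ^ e * ?v # [Suc (2 ^ e * ?v)..<2 ^ e * ?v + 2 ^ e]"
    by (rule upt_conv_Cons) simp
  with enc_nats_zeros[of "2 ^ e * ?v" "[Suc (2 ^ e * ?v)..<2 ^ e * ?v + 2 ^ e] @ concat (map (\<lambda>q. [2 ^ e * q..<2 ^ e * q + 2 ^ e]) ms)"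
    _ "length bs * (2 ^ e * Suc w)"] all
  show ?case
    by (simp add: scan_append scan_encode_bits foldl_step_bits del: mult_Suc_right)
qed

text \<open>The integer in front is the number of qudits if no \<open>Semi\<close> has been read,
  and is then scaled to the number of qubits; otherwise it is a clause type and is copied.\<close>

lemma scan_encode_first:
  assumes "enc_nats (m # ms) u" "length u + e \<le> w" "0 < w"
  shows "enc_nats ((if k = 0 then 2 ^ e * m else m) # concat (map (\<lambda>q. [2 ^ e * q..<2 ^ e * q + 2 ^ e]) ms))
    (scan (encode_chunk e w) (k, 0, 0) u)"
proof -
  obtain bs u' where u: "enc_nats ms u'" "m = bits_value bs" "u = map Bit bs @ Comma # u'"
    using assms(1) by (cases rule: enc_nats.cases) auto
  have less: "(if k = 0 then m * 2 ^ e else m) < 2 ^ w"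
  proof -
    have "(if k = 0 then m * 2 ^ e else m) \<le> 2 ^ e * m" by simp
    also have "\<dots> < 2 ^ e * 2 ^ length bs" using bits_value_less[of bs] u by simp
    also have "\<dots> = 2 ^ (e + length bs)" by (simp add: power_add)
    also have "\<dots> \<le> 2 ^ w" using assms u by (intro power_increasing) auto
    finally show ?thesis .
  qed
  have "enc_nats (concat (map (\<lambda>q. [2 ^ e * q..<2 ^ e * q + 2 ^ e]) ms)) (scan (encode_chunk e w) (k, 1, 0) u')"
    using assms u by (intro scan_encode_integers) auto
  from enc_nats_zeros[OF enc_nats_binary[OF assms(3) less this], of "length bs * (2 ^ e * Suc w) + (2 ^ e - 1) * Suc w"]
  show ?thesis
    unfolding u(3) scan_append scan_encode_bits foldl_step_bits scan.simps encode_chunk_first step.simps replicate_add u(2)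
    by (cases "k = 0") (simp_all add: mult.commute)
qed

lemma scan_encode_clauses:
  assumes "enc_clauses cs s" "0 < k" "length s + e \<le> w" "0 < w"
  shows "enc_clauses (map (encode_clause (2 ^ e)) cs) (scan (encode_chunk e w) (k, 0, 0) s)"
  using assms
proof (induction arbitrary: k rule: enc_clauses.induct)
  case 1
  then show ?case by (simp add: enc_clauses.intros)
next
  case (2 cs s)
  have "enc_clauses (map (encode_clause (2 ^ e)) cs) (scan (encode_chunk e w) (Suc k, 0, 0) s)"
    using 2 by (intro "2.IH") auto
  then show ?case by (simp add: encode_chunk_Semi enc_clauses_semis del: mult_Suc_right)
next
  case (3 t qs u cs s)
  have 1: "enc_nats (t # concat (map (\<lambda>q. [2 ^ e * q..<2 ^ e * q + 2 ^ e]) qs)) (scan (encode_chunk e w) (k, 0, 0) u)"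
    using scan_encode_first[OF 3(1), of e w k] 3 by simp
  have "enc_clauses (map (encode_clause (2 ^ e)) cs) (scan (encode_chunk e w) (Suc k, 0, 0) s)"
    using 3 by (intro "3.IH") auto
  then have "enc_clauses (map (encode_clause (2 ^ e)) cs)
      (replicate (2 ^ e * Suc w - 1) Semi @ scan (encode_chunk e w) (Suc k, 0, 0) s)"
    by (rule enc_clauses_semis)
  from enc_clauses.intros(3)[OF 1 this]
  show ?case
    by (simp add: encode_clause_def scan_append foldl_step_nats[OF 3(1)] encode_chunk_Semi' del: mult_Suc_right)
qed

text \<open>No integer of the input has more than \<open>length s\<close> bits, and \<open>e\<close>
  bits are appended. The width depends on the length of \<open>s\<close> only, as a circuit
  requires.\<close>

definition encode_string :: "nat \<Rightarrow> symbol list \<Rightarrow> symbol list" where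
  "encode_string e s = scan (encode_chunk e (length s + e)) (0, 0, 0) s"

lemma encode_string_encodes:
  assumes "encodes_symbols s (n, cs)"
  shows "encodes_symbols (encode_string e s) (2 ^ e * n, map (encode_clause (2 ^ e)) cs)"
proof -
  obtain u w where s: "enc_nats [n] u" "enc_clauses cs w" "s = u @ Semi # w"
    using assms by (auto simp: encodes_symbols_def)
  let ?w = "length s + e"
  have 1: "enc_nats [2 ^ e * n] (scan (encode_chunk e ?w) (0, 0, 0) u)"
    using scan_encode_first[OF s(1), of e ?w 0] s(3) by simp
  have "enc_clauses (map (encode_clause (2 ^ e)) cs) (scan (encode_chunk e ?w) (1, 0, 0) w)"
    using s by (intro scan_encode_clauses) auto
  then have "enc_clauses (map (encode_clause (2 ^ e)) cs)
      (replicate (2 ^ e * Suc ?w - 1) Semi @ scan (encode_chunk e ?w) (1, 0, 0) w)"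
    by (rule enc_clauses_semis)
  moreover have "encode_string e s = scan (encode_chunk e ?w) (0, 0, 0) u @ Semi #
      replicate (2 ^ e * Suc ?w - 1) Semi @ scan (encode_chunk e ?w) (1, 0, 0) w"
  proof -
    define v where "v = length s + e"
    have "encode_string e s = scan (encode_chunk e v) (0, 0, 0) (u @ Semi # w)"
      by (simp add: encode_string_def v_def s(3))
    also have "\<dots> = scan (encode_chunk e v) (0, 0, 0) u @ Semi # replicate (2 ^ e * Suc v - 1) Semi @
        scan (encode_chunk e v) (1, 0, 0) w"
      by (simp add: scan_append foldl_step_nats[OF s(1)] encode_chunk_Semi' del: mult_Suc_right)
    finally show ?thesis by (simp add: v_def del: mult_Suc_right)
  qed
  ultimately show ?thesis using 1 by (auto simp: encodes_symbols_def)
qed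

subsection \<open>Decoding blocks\<close>

text \<open>\<open>i\<close> is the index of the head of the list. In a clause the type has index 0
  and the qubits start at 1, so the multiples of \<open>b\<close> are the type and the last qubit of
  each block.\<close>

fun every :: "nat \<Rightarrow> nat \<Rightarrow> 'b list \<Rightarrow> 'b list" where
  "every b i [] = []"
| "every b i (x # xs) = (if b dvd i then [x] else []) @ every b (Suc i) xs"

lemma every_append: "every b i (xs @ ys) = every b i xs @ every b (i + length xs) ys"
  by (induction xs arbitrary: i) auto

lemma every_shift: "every b (i + b) xs = every b i xs"
  by (induction xs arbitrary: i) (auto simp flip: add_Suc)

lemma every_none: "(\<And>l. l < length xs \<Longrightarrow> \<not> b dvd i + l) \<Longrightarrow> every b i xs = []"
proof (induction xs arbitrary: i)
  case (Cons x xs)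
  have "\<not> b dvd Suc i + l" if "l < length xs" for l using Cons.prems[of "Suc l"] that by simp
  then show ?case using Cons.IH[of "Suc i"] Cons.prems[of 0] by simp
qed simp

lemma every_block:
  assumes "length xs = b" "0 < b" shows "every b 1 xs = [last xs]"
proof -
  have xs: "xs = butlast xs @ [last xs]" using assms by (intro append_butlast_last_id[symmetric]) auto
  have "every b 1 (butlast xs) = []"
  proof (rule every_none)
    fix l assume "l < length (butlast xs)"
    then have "0 < 1 + l" "1 + l < b" using assms by auto
    then show "\<not> b dvd 1 + l" by (rule nat_dvd_not_less)
  qed
  then have "every b 1 (butlast xs @ [last xs]) = [last xs]"
    using assms by (simp only: every_append) simp
  then show ?thesis using xs by simp
qed

lemma every_chunks:
  assumes "0 < b" shows "length qs = b * a \<Longrightarrow> every b 1 qs = map (\<lambda>l. last (chunk b qs l)) [0..<a]"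
proof (induction a arbitrary: qs)
  case (Suc a)
  have len: "length (take b qs) = b" using Suc.prems by simp
  have "every b 1 qs = every b 1 (take b qs @ drop b qs)" by simp
  also have "\<dots> = last (take b qs) # every b (1 + b) (drop b qs)"
    by (simp only: every_append every_block[OF len assms] len) simp
  also have "every b (1 + b) (drop b qs) = map (\<lambda>l. last (chunk b (drop b qs) l)) [0..<a]"
    unfolding every_shift using Suc.prems by (intro Suc.IH) simp
  also have "\<dots> = map (\<lambda>l. last (chunk b qs (Suc l))) [0..<a]"
    by (simp add: chunk_def add.commute)
  also have "last (take b qs) # \<dots> = map (\<lambda>l. last (chunk b qs l)) [0..<Suc a]"
    unfolding upt_conv_Cons[OF zero_less_Suc] map_Suc_upt[symmetric] by (simp add: chunk_def o_def)
  finally show ?case .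
qed simp

text \<open>If the last element of a nonempty list is kept, the zeros left by dropped integers
  always precede an integer to which they can be attached.\<close>

lemma every_nonempty:
  "xs \<noteq> [] \<Longrightarrow> b dvd i + length xs - 1 \<Longrightarrow> every b i xs \<noteq> []"
proof (induction xs arbitrary: i)
  case (Cons x xs)
  then show ?case by (cases xs) auto
qed simp

text \<open>Dropped symbols become zeros, so that no position moves. The bound \<open>m\<close>
  confines the divisibility test to finitely many counts, each of which can be recognized in
  constant depth.\<close>

definition decode_symbol :: "nat \<Rightarrow> nat \<Rightarrow> scan_state \<Rightarrow> symbol \<Rightarrow> symbol" where
  "decode_symbol b m = (\<lambda>(k, i, v) c. case c of Bit x \<Rightarrow> Bit (x \<and> b dvd i \<and> i \<le> m) | Semi \<Rightarrow> Semi
     | Comma \<Rightarrow> if b dvd i \<and> i \<le> m then Comma else Bit False)"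

lemma decode_symbol_simps:
  "decode_symbol b m (k, i, v) (Bit x) = Bit (x \<and> b dvd i \<and> i \<le> m)"
  "decode_symbol b m (k, i, v) Comma = (if b dvd i \<and> i \<le> m then Comma else Bit False)"
  "decode_symbol b m (k, i, v) Semi = Semi"
  by (simp_all add: decode_symbol_def)

definition decode_string :: "nat \<Rightarrow> nat \<Rightarrow> symbol list \<Rightarrow> symbol list" where
  "decode_string b m s = scan (\<lambda>st c. [decode_symbol b m st c]) (0, 0, 0) s"

abbreviation decode_scan :: "nat \<Rightarrow> nat \<Rightarrow> scan_state \<Rightarrow> symbol list \<Rightarrow> symbol list" where
  "decode_scan b m \<equiv> scan (\<lambda>st c. [decode_symbol b m st c])"

lemma scan_decode_bits:
  "decode_scan b m (k, i, v) (map Bit bs) =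
    (if b dvd i \<and> i \<le> m then map Bit bs else replicate (length bs) (Bit False))"
  by (induction bs arbitrary: v) (auto simp: decode_symbol_simps)

lemma scan_decode_nats:
  assumes "enc_nats ms u" "ms \<noteq> [] \<longrightarrow> b dvd i + length ms - 1" "i + length ms \<le> Suc m"
  shows "enc_nats (every b i ms) (decode_scan b m (k, i, 0) u)"
  using assms
proof (induction arbitrary: i rule: enc_nats.induct)
  case 1
  then show ?case by (simp add: enc_nats.intros)
next
  case (2 bs ms u)
  have IH: "enc_nats (every b (Suc i) ms) (decode_scan b m (k, Suc i, 0) u)"
    using 2(4,5) by (intro "2.IH") auto
  show ?case
  proof (cases "b dvd i")
    case True
    then have "b dvd i \<and> i \<le> m" using 2(5) by simp
    then show ?thesis
      using enc_nats.intros(2)[OF 2(1) IH]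
      by (simp add: scan_append scan_decode_bits foldl_step_bits decode_symbol_simps)
  next
    case False
    then have "ms \<noteq> []" using 2(4) by auto
    then have "every b (Suc i) ms \<noteq> []" using 2(4) by (intro every_nonempty) auto
    then obtain q qs where q: "every b (Suc i) ms = q # qs" by (cases "every b (Suc i) ms") auto
    \<comment> \<open>The bits of the dropped integer and its \<open>Comma\<close> yield
      \<open>Suc (length bs)\<close> zeros, which become leading zeros of the next integer that is
      kept.\<close>
    show ?thesis
      using enc_nats_zeros[OF IH[unfolded q], of "Suc (length bs)"] False q
      by (simp add: scan_append scan_decode_bits foldl_step_bits decode_symbol_simps replicate_app_Cons_same)
  qed
qed

lemma scan_decode_clauses:
  assumes "enc_clauses cs w" "0 < b" "\<forall>(t, qs)\<in>set cs. b dvd length qs \<and> length qs \<le> m"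
  shows "enc_clauses (map (decode_clause b) cs) (decode_scan b m (k, 0, 0) w)"
  using assms
proof (induction arbitrary: k rule: enc_clauses.induct)
  case 1
  then show ?case by (simp add: enc_clauses.intros)
next
  case (2 cs w)
  then show ?case by (auto simp: decode_symbol_simps intro: enc_clauses.intros)
next
  case (3 t qs u cs w)
  have "enc_nats (every b 0 (t # qs)) (decode_scan b m (k, 0, 0) u)"
    using 3 by (intro scan_decode_nats) auto
  moreover have "every b 0 (t # qs) = t # map (\<lambda>l. last (chunk b qs l)) [0..<length qs div b]"
    using every_chunks[of b qs "length qs div b"] 3 by simp
  ultimately have "enc_nats (t # map (\<lambda>l. last (chunk b qs l)) [0..<length qs div b])
      (decode_scan b m (k, 0, 0) u)" by simp
  moreover have "enc_clauses (map (decode_clause b) cs) (decode_scan b m (Suc k, 0, 0) w)"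
    using 3 by (intro "3.IH") auto
  ultimately show ?case
    by (simp add: scan_append foldl_step_nats[OF 3(1)] decode_clause_def)
       (simp add: decode_symbol_simps enc_clauses.intros)
qed

lemma decode_string_encodes:
  assumes "encodes_symbols s (n, cs)" "0 < b" "\<forall>(t, qs)\<in>set cs. b dvd length qs \<and> length qs \<le> m"
  shows "encodes_symbols (decode_string b m s) (n, map (decode_clause b) cs)"
proof -
  obtain u w where s: "enc_nats [n] u" "enc_clauses cs w" "s = u @ Semi # w"
    using assms by (auto simp: encodes_symbols_def)
  have "enc_nats [n] (decode_scan b m (0, 0, 0) u)"
    using scan_decode_nats[OF s(1), of b 0 m 0] by simp
  moreover have "enc_clauses (map (decode_clause b) cs) (decode_scan b m (Suc 0, 0, 0) w)"
    by (rule scan_decode_clauses[OF s(2) assms(2,3)])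
  moreover have "decode_string b m s = decode_scan b m (0, 0, 0) u @ Semi #
      decode_scan b m (Suc 0, 0, 0) w"
    unfolding decode_string_def s(3) scan_append foldl_step_nats[OF s(1)] by (simp add: decode_symbol_simps)
  ultimately show ?thesis unfolding encodes_symbols_def prod.case by blast
qed

section \<open>Testing the consistency of blocks on the string\<close>

definition entry :: "symbol list \<Rightarrow> nat \<Rightarrow> nat \<Rightarrow> bool" where
  "entry s p j \<longleftrightarrow> symbol_at Comma p s \<and> fst (state_at s p) \<noteq> 0 \<and> fst (snd (state_at s p)) = j"

text \<open>Positions \<open>p1\<close> and \<open>p2\<close> lie in one block, \<open>p3\<close>
  and \<open>p4\<close> in another, and \<open>p1\<close> and \<open>p3\<close> name the same qubit.
  Then this qubit must have the same offset in both blocks, and qubits at equal offsets must be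
  equal. Subtracting 1 discounts the clause type at index 0.\<close>

definition consistent_string :: "nat \<Rightarrow> nat \<Rightarrow> symbol list \<Rightarrow> bool" where
  "consistent_string b m s \<longleftrightarrow> (\<forall>j1\<in>{1..m}. \<forall>j2\<in>{1..m}. \<forall>j3\<in>{1..m}. \<forall>j4\<in>{1..m}.
     \<forall>p1<length s. \<forall>p2<length s. \<forall>p3<length s. \<forall>p4<length s.
     (j1 - 1) div b = (j2 - 1) div b \<and> (j3 - 1) div b = (j4 - 1) div b \<and>
     entry s p1 j1 \<and> entry s p2 j2 \<and> entry s p3 j3 \<and> entry s p4 j4 \<and>
     fst (state_at s p1) = fst (state_at s p2) \<and> fst (state_at s p3) = fst (state_at s p4) \<and>
     snd (snd (state_at s p1)) = snd (snd (state_at s p3)) \<longrightarrow>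
     (j1 - 1) mod b = (j3 - 1) mod b \<and>
     ((j2 - 1) mod b = (j4 - 1) mod b \<longrightarrow> snd (snd (state_at s p2)) = snd (snd (state_at s p4))))"

lemma encoded_entries:
  assumes "encodes_symbols s (n, cs)"
  obtains \<kappa> where "inj_on \<kappa> {..<length cs}" "\<And>c. c < length cs \<Longrightarrow> 0 < \<kappa> c"
    "\<And>p j. p < length s \<Longrightarrow> entry s p j \<Longrightarrow> 0 < j \<Longrightarrow> \<exists>c<length cs. j - 1 < length (snd (cs ! c)) \<and>
       state_at s p = (\<kappa> c, j, snd (cs ! c) ! (j - 1))"
    "\<And>c l. c < length cs \<Longrightarrow> l < length (snd (cs ! c)) \<Longrightarrow>
       \<exists>p<length s. entry s p (Suc l) \<and> state_at s p = (\<kappa> c, Suc l, snd (cs ! c) ! l)"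
proof -
  obtain u w where s: "enc_nats [n] u" "enc_clauses cs w" "s = u @ Semi # w"
    using assms by (auto simp: encodes_symbols_def)
  from set_entries_clauses[OF s(2), of 1] obtain \<kappa> where K: "inj_on \<kappa> {..<length cs}" "\<forall>c<length cs. 1 \<le> \<kappa> c"
    "set (entries (1, 0, 0) w) =
       {(\<kappa> c, l, (fst (cs ! c) # snd (cs ! c)) ! l) | c l. c < length cs \<and> l < Suc (length (snd (cs ! c)))}"
    by (elim exE conjE)
  have E: "{state_at s p | p. p < length s \<and> s ! p = Comma} = insert (0, 0, n)
      {(\<kappa> c, l, (fst (cs ! c) # snd (cs ! c)) ! l) | c l. c < length cs \<and> l < Suc (length (snd (cs ! c)))}"
  proof -
    have "set (entries (0, 0, 0) s) = insert (0, 0, n) (set (entries (1, 0, 0) w))"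
      using set_entries_nats[OF s(1), of 0 0] by (simp add: s(3) entries_append foldl_step_nats[OF s(1)])
    then show ?thesis using set_entries[of "(0, 0, 0)" s] K(3) by (simp add: state_at_def)
  qed
  show thesis
  proof (rule that[OF K(1)])
    show "0 < \<kappa> c" if "c < length cs" for c using K(2) that by auto
    show "\<exists>c<length cs. j - 1 < length (snd (cs ! c)) \<and> state_at s p = (\<kappa> c, j, snd (cs ! c) ! (j - 1))"
      if p: "p < length s" "entry s p j" "0 < j" for p j
    proof -
      have "state_at s p \<in> {state_at s p | p. p < length s \<and> s ! p = Comma}"
        using p by (auto simp: entry_def symbol_at_def)
      then have "state_at s p \<in> {(\<kappa> c, l, (fst (cs ! c) # snd (cs ! c)) ! l) | c l. c < length cs \<and> l < Suc (length (snd (cs ! c)))}"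
        unfolding E using p(2) by (auto simp: entry_def)
      then obtain c l where cl: "c < length cs" "l < Suc (length (snd (cs ! c)))"
        "state_at s p = (\<kappa> c, l, (fst (cs ! c) # snd (cs ! c)) ! l)" by blast
      then have "l = j" using p(2) by (simp add: entry_def)
      then show ?thesis using cl p(3) by (intro exI[of _ c]) (auto simp: nth_Cons')
    qed
    show "\<exists>p<length s. entry s p (Suc l) \<and> state_at s p = (\<kappa> c, Suc l, snd (cs ! c) ! l)"
      if c: "c < length cs" "l < length (snd (cs ! c))" for c l
    proof -
      have "(\<kappa> c, Suc l, (fst (cs ! c) # snd (cs ! c)) ! Suc l) \<in> {state_at s p | p. p < length s \<and> s ! p = Comma}"
        unfolding E using c by (intro insertI2 CollectI exI[of _ c] exI[of _ "Suc l"]) simp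
      then obtain p where p: "p < length s" "s ! p = Comma" "state_at s p = (\<kappa> c, Suc l, snd (cs ! c) ! l)" by auto
      then have "entry s p (Suc l)" using K(2) c(1) by (fastforce simp: entry_def symbol_at_def)
      then show ?thesis using p by blast
    qed
  qed
qed

text \<open>A shared qubit serves as \<open>p1\<close> and \<open>p3\<close>, and letting
  \<open>p2\<close> and \<open>p4\<close> run through equal offsets compares the blocks entry by
  entry. In the converse direction distinctness within a clause makes the offset of the shared qubit
  unique.\<close>

lemma consistent_string_iff:
  assumes enc: "encodes_symbols s (n, cs)" and b: "0 < b"
    and cs: "\<forall>(t, qs)\<in>set cs. b dvd length qs \<and> length qs \<le> m \<and> distinct qs"
  shows "consistent_string b m s \<longleftrightarrow> consistent b cs"
proof -
  obtain \<kappa> where K: "inj_on \<kappa> {..<length cs}" "\<And>c. c < length cs \<Longrightarrow> 0 < \<kappa> c"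
    "\<And>p j. p < length s \<Longrightarrow> entry s p j \<Longrightarrow> 0 < j \<Longrightarrow> \<exists>c<length cs. j - 1 < length (snd (cs ! c)) \<and>
       state_at s p = (\<kappa> c, j, snd (cs ! c) ! (j - 1))"
    "\<And>c l. c < length cs \<Longrightarrow> l < length (snd (cs ! c)) \<Longrightarrow>
       \<exists>p<length s. entry s p (Suc l) \<and> state_at s p = (\<kappa> c, Suc l, snd (cs ! c) ! l)"
    by (rule encoded_entries[OF enc]) (rule that)
  let ?q = "\<lambda>c. snd (cs ! c)"
  have qs: "length (?q c) = b * (length (?q c) div b)" "length (?q c) \<le> m" "distinct (?q c)" if "c < length cs" for c
    using bspec[OF cs nth_mem[OF that]] by (auto simp: case_prod_unfold)
  show ?thesis
  proof
    assume S: "consistent_string b m s"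
    show "consistent b cs"
      unfolding consistent_def
    proof (intro ballI impI)
      fix A B assume AB: "A \<in> blocks b cs" "B \<in> blocks b cs" "set A \<inter> set B \<noteq> {}"
      have blk: "\<exists>c l. c < length cs \<and> l < length (?q c) div b \<and> A = chunk b (?q c) l" if A: "A \<in> blocks b cs" for A
      proof -
        obtain t qs l where tq: "(t, qs) \<in> set cs" "l < length qs div b" "A = chunk b qs l"
          using A by (auto simp: blocks_def)
        then obtain c where "c < length cs" "cs ! c = (t, qs)" by (auto simp: in_set_conv_nth)
        then show ?thesis using tq by (intro exI[of _ c] exI[of _ l]) simp
      qed
      obtain c l where A: "c < length cs" "l < length (?q c) div b" "A = chunk b (?q c) l" using blk[OF AB(1)] by blast
      obtain c' l' where B: "c' < length cs" "l' < length (?q c') div b" "B = chunk b (?q c') l'" using blk[OF AB(2)] by blast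
      have len: "length A = b" "length B = b" using length_chunk[OF qs(1)] A B by simp_all
      have An: "A ! i = ?q c ! (l * b + i)" if "i < b" for i using chunk_nth[OF qs(1)] A that by simp
      have Bn: "B ! i = ?q c' ! (l' * b + i)" if "i < b" for i using chunk_nth[OF qs(1)] B that by simp
      have less: "k * b + i < length (?q c)" if "c < length cs" "k < length (?q c) div b" "i < b" for c k i
      proof -
        have "Suc k * b \<le> length (?q c) div b * b" using that(2) by (intro mult_le_mono1) simp
        then show ?thesis using that(3) qs(1)[OF that(1)] by (simp add: mult.commute)
      qed
      obtain x where "x \<in> set A" "x \<in> set B" using AB(3) by blast
      then obtain a a' where a: "a < b" "a' < b" "A ! a = B ! a'" using len by (metis in_set_conv_nth)
      \<comment> \<open>\<open>p1\<close> and \<open>p3\<close> are entries of the shared qubit, at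
        offsets \<open>a\<close> and \<open>a'\<close>; \<open>p2\<close> and \<open>p4\<close> are
        the entries at offset \<open>i\<close>.\<close>
      have main: "a = a' \<and> A ! i = B ! i" if i: "i < b" for i
      proof -
        obtain p1 where p1: "p1 < length s" "entry s p1 (Suc (l * b + a))" "state_at s p1 = (\<kappa> c, Suc (l * b + a), A ! a)"
          using K(4)[OF A(1) less[OF A(1,2) a(1)]] An[OF a(1)] by auto
        obtain p2 where p2: "p2 < length s" "entry s p2 (Suc (l * b + i))" "state_at s p2 = (\<kappa> c, Suc (l * b + i), A ! i)"
          using K(4)[OF A(1) less[OF A(1,2) i]] An[OF i] by auto
        obtain p3 where p3: "p3 < length s" "entry s p3 (Suc (l' * b + a'))" "state_at s p3 = (\<kappa> c', Suc (l' * b + a'), B ! a')"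
          using K(4)[OF B(1) less[OF B(1,2) a(2)]] Bn[OF a(2)] by auto
        obtain p4 where p4: "p4 < length s" "entry s p4 (Suc (l' * b + i))" "state_at s p4 = (\<kappa> c', Suc (l' * b + i), B ! i)"
          using K(4)[OF B(1) less[OF B(1,2) i]] Bn[OF i] by auto
        have j: "Suc (l * b + a) \<in> {1..m}" "Suc (l * b + i) \<in> {1..m}" "Suc (l' * b + a') \<in> {1..m}" "Suc (l' * b + i) \<in> {1..m}"
          using less[OF A(1,2) a(1)] less[OF A(1,2) i] qs(2)[OF A(1)]
            less[OF B(1,2) a(2)] less[OF B(1,2) i] qs(2)[OF B(1)] by auto
        from S[unfolded consistent_string_def, rule_format, OF j p1(1) p2(1) p3(1) p4(1)]
        show ?thesis using p1 p2 p3 p4 a i by simp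
      qed
      then show "A = B" using len by (intro nth_equalityI) auto
    qed
  next
    assume S: "consistent b cs"
    show "consistent_string b m s"
      unfolding consistent_string_def
    proof (intro ballI allI impI, elim conjE)
      fix j1 j2 j3 j4 p1 p2 p3 p4
      assume j: "j1 \<in> {1..m}" "j2 \<in> {1..m}" "j3 \<in> {1..m}" "j4 \<in> {1..m}"
        and p: "p1 < length s" "p2 < length s" "p3 < length s" "p4 < length s"
        and div: "(j1 - 1) div b = (j2 - 1) div b" "(j3 - 1) div b = (j4 - 1) div b"
        and e: "entry s p1 j1" "entry s p2 j2" "entry s p3 j3" "entry s p4 j4"
        and k: "fst (state_at s p1) = fst (state_at s p2)" "fst (state_at s p3) = fst (state_at s p4)"
        and v: "snd (snd (state_at s p1)) = snd (snd (state_at s p3))"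
      obtain c where c: "c < length cs" "j1 - 1 < length (?q c)" "state_at s p1 = (\<kappa> c, j1, ?q c ! (j1 - 1))"
        using K(3)[OF p(1) e(1)] j by auto
      obtain c2 where c2: "c2 < length cs" "j2 - 1 < length (?q c2)" "state_at s p2 = (\<kappa> c2, j2, ?q c2 ! (j2 - 1))"
        using K(3)[OF p(2) e(2)] j by auto
      obtain c' where c': "c' < length cs" "j3 - 1 < length (?q c')" "state_at s p3 = (\<kappa> c', j3, ?q c' ! (j3 - 1))"
        using K(3)[OF p(3) e(3)] j by auto
      obtain c4 where c4: "c4 < length cs" "j4 - 1 < length (?q c4)" "state_at s p4 = (\<kappa> c4, j4, ?q c4 ! (j4 - 1))"
        using K(3)[OF p(4) e(4)] j by auto
      have eq: "c2 = c" "c4 = c'" using K(1) k c c2 c' c4 by (auto simp: inj_on_def)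
      have chunk: "chunk b (?q c) (i div b) \<in> blocks b cs \<and> length (chunk b (?q c) (i div b)) = b \<and>
          distinct (chunk b (?q c) (i div b)) \<and> chunk b (?q c) (i div b) ! (i mod b) = ?q c ! i"
        if ci: "c < length cs" "i < length (?q c)" for c i
      proof -
        have l: "i div b < length (?q c) div b"
          using ci b qs(1)[OF ci(1)] by (simp add: less_mult_imp_div_less mult.commute)
        then have "chunk b (?q c) (i div b) \<in> blocks b cs"
          using nth_mem[OF ci(1)] unfolding blocks_def
          by (intro CollectI exI[of _ "fst (cs ! c)"] exI[of _ "?q c"] exI[of _ "i div b"]) simp
        then show ?thesis
          using length_chunk[OF qs(1)[OF ci(1)] l] distinct_chunk[OF qs(3)[OF ci(1)]]
            chunk_nth[OF qs(1)[OF ci(1)] l, of "i mod b"] b by simp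
      qed
      define A where "A = chunk b (?q c) ((j1 - 1) div b)"
      define B where "B = chunk b (?q c') ((j3 - 1) div b)"
      note A = chunk[OF c(1,2), folded A_def]
      note B = chunk[OF c'(1,2), folded B_def]
      have A2: "A ! ((j2 - 1) mod b) = ?q c ! (j2 - 1)"
        using chunk[OF c(1), of "j2 - 1"] c2(2) eq(1) div(1) by (simp add: A_def)
      have B4: "B ! ((j4 - 1) mod b) = ?q c' ! (j4 - 1)"
        using chunk[OF c'(1), of "j4 - 1"] c4(2) eq(2) div(2) by (simp add: B_def)
      have v': "A ! ((j1 - 1) mod b) = B ! ((j3 - 1) mod b)" using v c(3) c'(3) A B by simp
      then have "set A \<inter> set B \<noteq> {}"
        using A B b nth_mem[of "(j1 - 1) mod b" A] nth_mem[of "(j3 - 1) mod b" B] by auto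
      then have AB: "A = B" using S A B by (auto simp: consistent_def)
      then have m: "(j1 - 1) mod b = (j3 - 1) mod b"
        using v' A b nth_eq_iff_index_eq[of A "(j1 - 1) mod b" "(j3 - 1) mod b"] by simp
      have "snd (snd (state_at s p2)) = snd (snd (state_at s p4))" if "(j2 - 1) mod b = (j4 - 1) mod b"
        using A2 B4 AB that c2(3) c4(3) eq by simp
      with m show "(j1 - 1) mod b = (j3 - 1) mod b \<and>
          ((j2 - 1) mod b = (j4 - 1) mod b \<longrightarrow> snd (snd (state_at s p2)) = snd (snd (state_at s p4)))" by simp
    qed
  qed
qed

section \<open>The reductions are computed by constant-depth circuits\<close>

lemma state_at_0: "state_at s 0 = (0, 0, 0)"
  by (simp add: state_at_def)

lemma state_at_Suc: "p < length s \<Longrightarrow> state_at s (Suc p) = step (state_at s p) (s ! p)"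
  by (simp add: state_at_def take_Suc_conv_app_nth)

lemma state_at_Suc_beyond: "length s \<le> p \<Longrightarrow> state_at s (Suc p) = state_at s p"
  by (simp add: state_at_def)

abbreviation semis :: "symbol list \<Rightarrow> nat \<Rightarrow> nat" where "semis s p \<equiv> fst (state_at s p)"
abbreviation commas :: "symbol list \<Rightarrow> nat \<Rightarrow> nat" where "commas s p \<equiv> fst (snd (state_at s p))"
abbreviation number :: "symbol list \<Rightarrow> nat \<Rightarrow> nat" where "number s p \<equiv> snd (snd (state_at s p))"

lemma state_at_Suc_cases:
  "symbol_at (Bit c) p s \<Longrightarrow> state_at s (Suc p) = (semis s p, commas s p, 2 * number s p + of_bool c)"
  "symbol_at Comma p s \<Longrightarrow> state_at s (Suc p) = (semis s p, Suc (commas s p), 0)"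
  "symbol_at Semi p s \<Longrightarrow> state_at s (Suc p) = (Suc (semis s p), 0, 0)"
  by (cases "state_at s p"; simp add: symbol_at_def state_at_Suc)+

lemma position_symbol_cases:
  obtains "length s \<le> p" | c where "symbol_at (Bit c) p s" | "symbol_at Comma p s" | "symbol_at Semi p s"
  by (cases "s ! p"; cases "p < length s") (auto simp: symbol_at_def)

lemma symbol_at_unique: "symbol_at c p s \<Longrightarrow> symbol_at c' p s \<longleftrightarrow> c' = c"
  by (auto simp: symbol_at_def)

lemma semis_Suc: "semis s (Suc p) = semis s p + of_bool (symbol_at Semi p s)"
  by (cases rule: position_symbol_cases[where s = s and p = p])
    (auto simp: state_at_Suc_beyond state_at_Suc_cases symbol_at_unique, simp_all add: symbol_at_def)

lemma semis_add:
  "semis s p \<le> semis s (p + r) \<and> (semis s (p + r) = semis s p \<longleftrightarrow> (\<forall>q. p \<le> q \<and> q < p + r \<longrightarrow> \<not> symbol_at Semi q s))"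
proof (induction r)
  case (Suc r)
  have all: "(\<forall>q. p \<le> q \<and> q < p + Suc r \<longrightarrow> \<not> symbol_at Semi q s) \<longleftrightarrow>
      (\<forall>q. p \<le> q \<and> q < p + r \<longrightarrow> \<not> symbol_at Semi q s) \<and> \<not> symbol_at Semi (p + r) s"
    by (auto simp: less_Suc_eq)
  have "semis s (p + Suc r) = semis s (p + r) + of_bool (symbol_at Semi (p + r) s)"
    using semis_Suc[of s "p + r"] by simp
  then show ?case unfolding all using Suc by (cases "symbol_at Semi (p + r) s") auto
qed auto

lemma semis_eq_0_iff: "semis s p = 0 \<longleftrightarrow> \<not> (\<exists>q<length s. q < p \<and> symbol_at Semi q s)"
  using semis_add[of s 0 p] by (auto simp: state_at_0 symbol_at_def)

text \<open>Clause numbers are unbounded counts, which constant-depth circuits cannot compute.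
  Equality of two such counts only says that no \<open>Semi\<close> lies between the
  positions.\<close>

lemma semis_eq_iff:
  "semis s p = semis s p' \<longleftrightarrow>
    (\<forall>q<length s. p \<le> q \<and> q < p' \<or> p' \<le> q \<and> q < p \<longrightarrow> \<not> symbol_at Semi q s)"
proof -
  have *: "semis s p' = semis s p \<longleftrightarrow> (\<forall>q<length s. p \<le> q \<and> q < p' \<or> p' \<le> q \<and> q < p \<longrightarrow> \<not> symbol_at Semi q s)"
    if le: "p \<le> p'" for p p'
  proof -
    have "semis s p' = semis s p \<longleftrightarrow> (\<forall>q. p \<le> q \<and> q < p' \<longrightarrow> \<not> symbol_at Semi q s)"
      using semis_add[of s p "p' - p"] le by simp
    moreover have "\<not> (p' \<le> q \<and> q < p)" "symbol_at Semi q s \<Longrightarrow> q < length s" for q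
      using le by (simp_all add: symbol_at_def)
    ultimately show ?thesis by blast
  qed
  show ?thesis
  proof (cases "p \<le> p'")
    case True
    show ?thesis unfolding *[OF True, symmetric] by (rule eq_commute)
  next
    case False
    then have "p' \<le> p" by simp
    have "semis s p = semis s p' \<longleftrightarrow> (\<forall>q<length s. p' \<le> q \<and> q < p \<or> p \<le> q \<and> q < p' \<longrightarrow> \<not> symbol_at Semi q s)"
      by (rule *[OF \<open>p' \<le> p\<close>])
    then show ?thesis unfolding disj_commute[of "p' \<le> _ \<and> _ < p"] .
  qed
qed

text \<open>Peels off one \<open>Comma\<close> per step, at the price of one more quantifier level.
  For a fixed bound \<open>j\<close> the nesting is constant, which is why the arity of clauses
  enters the circuits as a constant.\<close>

lemma Suc_le_commas_iff:
  "Suc j \<le> commas s p \<longleftrightarrow> (\<exists>r<length s. r < p \<and> symbol_at Comma r s \<and> j \<le> commas s r \<and>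
     (\<forall>q<length s. r < q \<and> q < p \<longrightarrow> \<not> symbol_at Semi q s))"
proof (induction p)
  case 0
  show ?case by (simp add: state_at_0)
next
  case (Suc p)
  show ?case
  proof (cases rule: position_symbol_cases[where s = s and p = p])
    case 1
    then show ?thesis using Suc by (auto simp: state_at_Suc_beyond less_Suc_eq symbol_at_def)
  next
    case (2 c)
    then have "\<not> symbol_at Comma p s" "\<not> symbol_at Semi p s" by (auto simp: symbol_at_def)
    then show ?thesis using Suc 2 by (auto simp: state_at_Suc_cases less_Suc_eq)
  next
    case 3
    then have p: "p < length s" by (simp add: symbol_at_def)
    show ?thesis (is "?l \<longleftrightarrow> ?r")
    proof
      assume ?l
      then show ?r using 3 p by (intro exI[of _ p]) (auto simp: state_at_Suc_cases)
    next
      assume ?r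
      then obtain r where r: "r < length s" "r < Suc p" "symbol_at Comma r s" "j \<le> commas s r"
        "\<forall>q<length s. r < q \<and> q < Suc p \<longrightarrow> \<not> symbol_at Semi q s" by blast
      have "j \<le> commas s p"
      proof (cases "r = p")
        case False
        then have "Suc j \<le> commas s p" unfolding Suc using r by (intro exI[of _ r]) auto
        then show ?thesis by simp
      qed (use r in simp)
      then show ?l using 3 by (simp add: state_at_Suc_cases)
    qed
  next
    case 4
    then have "p < length s" "\<not> symbol_at Comma p s" by (auto simp: symbol_at_def)
    then show ?thesis using 4 by (auto simp: state_at_Suc_cases less_Suc_eq)
  qed
qed

text \<open>The bits are written most significant first, so bit \<open>e\<close> is the symbol
  \<open>e + 1\<close> places before \<open>p\<close>, provided no separator comes in between. The
  guard \<open>e < p\<close> takes care of truncated subtraction.\<close>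

lemma bit_number_iff:
  "p \<le> length s \<Longrightarrow> bit (number s p) e \<longleftrightarrow> e < p \<and> symbol_at (Bit True) (p - 1 - e) s \<and>
     (\<forall>q<length s. p - 1 - e < q \<and> q < p \<longrightarrow> \<not> symbol_at Comma q s \<and> \<not> symbol_at Semi q s)"
proof (induction p arbitrary: e)
  case 0
  show ?case by (simp add: state_at_0)
next
  case (Suc p)
  then have p: "p < length s" by simp
  let ?N = "\<lambda>q. \<not> symbol_at Comma q s \<and> \<not> symbol_at Semi q s"
  have split: "(\<forall>q<length s. x < q \<and> q < Suc p \<longrightarrow> ?N q) \<longleftrightarrow> (\<forall>q<length s. x < q \<and> q < p \<longrightarrow> ?N q) \<and> (x < p \<longrightarrow> ?N p)" for x
    using p by (auto simp: less_Suc_eq)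
  show ?case
  proof (cases "?N p")
    case True
    then obtain c where c: "symbol_at (Bit c) p s"
      using p by (cases rule: position_symbol_cases[where s = s and p = p]) auto
    show ?thesis
    proof (cases e)
      case 0
      have "symbol_at (Bit True) p s \<longleftrightarrow> c" using c by (auto simp: symbol_at_def)
      then show ?thesis using 0 c by (auto simp: state_at_Suc_cases bit_0)
    next
      case (Suc e')
      have "bit (number s (Suc p)) (Suc e') \<longleftrightarrow> bit (number s p) e'"
        using c by (simp add: state_at_Suc_cases bit_Suc)
      then show ?thesis
        using Suc.IH[of e'] p split[of "p - 1 - e'"] True unfolding \<open>e = Suc e'\<close> by simp
    qed
  next
    case False
    then have "number s (Suc p) = 0" by (auto simp: state_at_Suc_cases)
    moreover have "\<not> (symbol_at (Bit True) (Suc p - 1 - e) s \<and> (Suc p - 1 - e < p \<longrightarrow> ?N p))" if "e < Suc p"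
      using False that by (cases e) (auto simp: symbol_at_def)
    ultimately show ?thesis unfolding split by auto
  qed
qed

lemma definable_semis_eq_0: "definable (\<lambda>i s. semis s (h i) = 0)"
  unfolding semis_eq_0_iff by (intro definable_intros)

lemma definable_semis_eq: "definable (\<lambda>i s. semis s (h i) = semis s (h' i))"
  unfolding semis_eq_iff by (intro definable_intros)

lemma definable_commas_ge: "definable (\<lambda>i s. j \<le> commas s (h i))"
proof -
  have "definable (\<lambda>p s. j \<le> commas s p)"
  proof (induction j)
    case 0
    show ?case by (simp add: definable_const)
  next
    case (Suc j)
    show ?case unfolding Suc_le_commas_iff by (intro definable_intros definable_reindex[OF Suc])
  qed
  then show ?thesis by (rule definable_reindex)
qed

lemma definable_commas_eq: "definable (\<lambda>i s. commas s (h i) = j)"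
proof -
  have "(\<lambda>i s. commas s (h i) = j) = (\<lambda>i s. j \<le> commas s (h i) \<and> \<not> Suc j \<le> commas s (h i))"
    by (intro ext) auto
  then show ?thesis by (simp only:) (intro definable_intros definable_commas_ge)
qed

definition number_bit :: "nat \<Rightarrow> nat \<Rightarrow> symbol list \<Rightarrow> bool" where
  "number_bit p e s \<longleftrightarrow> p \<le> length s \<and> bit (number s p) e"

lemma definable_number_bit: "definable (\<lambda>i s. number_bit (h i) (e i) s)"
proof -
  have l: "definable (\<lambda>i s. h i \<le> length s)"
    by (rule definable_length[where P = "\<lambda>i n s. h i \<le> n", OF definable_const])
  have "(\<lambda>i s. number_bit (h i) (e i) s) = (\<lambda>i s. h i \<le> length s \<and> e i < h i \<and> symbol_at (Bit True) (h i - 1 - e i) s \<and>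
     (\<forall>q<length s. h i - 1 - e i < q \<and> q < h i \<longrightarrow> \<not> symbol_at Comma q s \<and> \<not> symbol_at Semi q s))"
    by (intro ext) (auto simp: number_bit_def bit_number_iff)
  then show ?thesis by (simp only:) (intro definable_intros l)
qed

lemma definable_ball_finite:
  "finite J \<Longrightarrow> (\<And>j. j \<in> J \<Longrightarrow> definable (P j)) \<Longrightarrow> definable (\<lambda>i s. \<forall>j\<in>J. P j i s)"
proof (induction J rule: finite_induct)
  case empty
  show ?case by (simp add: definable_const)
next
  case (insert j J)
  then show ?case using definable_and[of "P j" "\<lambda>i s. \<forall>j\<in>J. P j i s"] by simp
qed

text \<open>A number read before position \<open>p\<close> has no bits at or beyond
  \<open>p\<close>, so quantifying over positions of the string covers all of its bits.\<close>

lemma number_eq_iff: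
  assumes "p < length s" "p' < length s"
  shows "number s p = number s p' \<longleftrightarrow> (\<forall>e<length s. number_bit p e s \<longleftrightarrow> number_bit p' e s)"
proof
  assume R: "\<forall>e<length s. number_bit p e s \<longleftrightarrow> number_bit p' e s"
  show "number s p = number s p'"
  proof (rule bit_eqI)
    fix e
    show "bit (number s p) e \<longleftrightarrow> bit (number s p') e"
    proof (cases "e < length s")
      case True
      then show ?thesis using R assms by (simp add: number_bit_def)
    next
      case False
      then show ?thesis using assms by (simp add: bit_number_iff)
    qed
  qed
qed (simp add: number_bit_def assms less_imp_le)

lemma definable_consistent_string: "definable (\<lambda>i s. consistent_string b m s)"
proof -
  have "consistent_string b m = (\<lambda>s. \<forall>j1\<in>{1..m}. \<forall>j2\<in>{1..m}. \<forall>j3\<in>{1..m}. \<forall>j4\<in>{1..m}.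
     \<forall>p1<length s. \<forall>p2<length s. \<forall>p3<length s. \<forall>p4<length s.
     (j1 - 1) div b = (j2 - 1) div b \<and> (j3 - 1) div b = (j4 - 1) div b \<and>
     entry s p1 j1 \<and> entry s p2 j2 \<and> entry s p3 j3 \<and> entry s p4 j4 \<and>
     semis s p1 = semis s p2 \<and> semis s p3 = semis s p4 \<and>
     (\<forall>e<length s. number_bit p1 e s \<longleftrightarrow> number_bit p3 e s) \<longrightarrow>
     (j1 - 1) mod b = (j3 - 1) mod b \<and>
     ((j2 - 1) mod b = (j4 - 1) mod b \<longrightarrow> (\<forall>e<length s. number_bit p2 e s \<longleftrightarrow> number_bit p4 e s)))"
    unfolding consistent_string_def by (intro ext ball_cong refl) (simp add: number_eq_iff)
  then show ?thesis
    unfolding entry_def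
    by (simp only:) (intro definable_ball_finite finite_atLeastAtMost definable_intros definable_semis_eq
      definable_semis_eq_0 definable_commas_eq definable_number_bit)
qed

lemma definable_less_length: "definable (\<lambda>i s. h i < length s)"
  by (rule definable_length[where P = "\<lambda>i n s. h i < n", OF definable_const])

section \<open>Definability of the two string functions\<close>

lemma length_decode_string [simp]: "length (decode_string b m s) = length s"
proof -
  have "length (decode_scan b m st s) = length s" for st
    by (induction s arbitrary: st) auto
  then show ?thesis by (simp add: decode_string_def)
qed

lemma decode_string_nth:
  "p < length s \<Longrightarrow> decode_string b m s ! p = decode_symbol b m (state_at s p) (s ! p)"
  unfolding decode_string_def by (subst scan_eq_map[where F = "\<lambda>st c _. decode_symbol b m st c" and L = 1]) simp_all

lemma definable_decode_string: "definable (\<lambda>i s. symbol_at (c i) (h i) (decode_string b m s))"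
proof -
  \<comment> \<open>Divisibility of the count is replaced by a finite disjunction over its
    admissible values.\<close>
  let ?keep = "\<lambda>p s. \<not> (\<forall>j\<in>{..m}. \<not> (b dvd j \<and> commas s p = j))"
  have "(\<lambda>i s. symbol_at (c i) (h i) (decode_string b m s)) = (\<lambda>i s.
     symbol_at (Bit True) (h i) s \<and> ((?keep (h i) s \<and> c i = Bit True) \<or> (\<not> ?keep (h i) s \<and> c i = Bit False)) \<or>
     symbol_at (Bit False) (h i) s \<and> c i = Bit False \<or> symbol_at Semi (h i) s \<and> c i = Semi \<or>
     symbol_at Comma (h i) s \<and> ((?keep (h i) s \<and> c i = Comma) \<or> (\<not> ?keep (h i) s \<and> c i = Bit False)))"
  proof (intro ext, goal_cases)
    case (1 i s)
    obtain k l v where st: "state_at s (h i) = (k, l, v)" by (cases "state_at s (h i)")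
    have keep: "?keep (h i) s \<longleftrightarrow> b dvd l \<and> l \<le> m" by (auto simp: st)
    show ?case
    proof (cases rule: position_symbol_cases[where s = s and p = "h i"])
      case 1
      then show ?thesis by (simp add: symbol_at_def)
    next
      case (2 x)
      then show ?thesis
        unfolding keep by (cases x; cases "b dvd l \<and> l \<le> m") (auto simp: symbol_at_def decode_string_nth decode_symbol_simps st)
    next
      case 3
      then show ?thesis
        unfolding keep by (cases "b dvd l \<and> l \<le> m") (auto simp: symbol_at_def decode_string_nth decode_symbol_simps st)
    next
      case 4
      then show ?thesis
        unfolding keep by (cases "b dvd l \<and> l \<le> m") (auto simp: symbol_at_def decode_string_nth decode_symbol_simps st)
    qed
  qed
  then show ?thesis
    by (simp only:) (intro definable_intros definable_ball_finite finite_atMost definable_commas_eq)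
qed

text \<open>
  \<open>y\<close> is a fixed unsatisfiable instance. Both branches are padded, since the length of the output of
  a circuit is determined by the length of its input.
\<close>

definition decode_or :: "symbol list \<Rightarrow> nat \<Rightarrow> nat \<Rightarrow> symbol list \<Rightarrow> symbol list" where
  "decode_or y b m s = (if consistent_string b m s then decode_string b m s @ replicate (length y) Semi
     else y @ replicate (length s) Semi)"

lemma AC0_decode_or: "AC0 (\<lambda>x. bits_of (decode_or y b m (symbols x)))"
proof (rule AC0_symbol_function[where L = "\<lambda>n. n + length y" and l = "[:length y, 1:]"])
  have sub: "definable (\<lambda>(i :: symbol \<times> nat) s. snd i < length s + length y)"
    by (rule definable_length[where P = "\<lambda>i n s. snd i < n + length y", OF definable_const])
  have "(\<lambda>i s. symbol_at (fst i) (snd i) (decode_or y b m s)) = (\<lambda>(i :: symbol \<times> nat) s.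
     if consistent_string b m s
     then symbol_at (fst i) (snd i) (decode_string b m s) \<or>
       \<not> snd i < length s \<and> snd i < length s + length y \<and> fst i = Semi
     else snd i < length y \<and> y ! snd i = fst i \<or>
       \<not> snd i < length y \<and> snd i < length s + length y \<and> fst i = Semi)"
    by (intro ext) (auto simp: decode_or_def symbol_at_def nth_append)
  then show "definable (\<lambda>(i :: symbol \<times> nat) s. symbol_at (fst i) (snd i) (decode_or y b m s))"
    by (simp only:) (intro definable_intros sub definable_less_length definable_consistent_string definable_decode_string)
qed (auto simp: decode_or_def mono_def)

text \<open>Multiplication by a power of two leaves room for \<open>j\<close> without carries. This
  is what makes the numbering of the qubits of a block a matter of copying bits.\<close>

lemma bit_shift_add:
  fixes v j :: nat assumes "j < 2 ^ e"
  shows "bit (v * 2 ^ e + j) q \<longleftrightarrow> (if q < e then bit j q else bit v (q - e))"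
proof (cases "q < e")
  case True
  then obtain k where k: "e = Suc (q + k)" using less_imp_Suc_add by blast
  have "(x * 2 ^ q + j) div 2 ^ q = x + j div 2 ^ q" for x :: nat by simp
  from this[of "v * 2 ^ k * 2"] have "(v * 2 ^ e + j) div 2 ^ q = v * 2 ^ k * 2 + j div 2 ^ q"
    by (simp add: k power_add mult_ac)
  then show ?thesis using True by (simp add: bit_iff_odd)
next
  case False
  then have "(2 :: nat) ^ q = 2 ^ e * 2 ^ (q - e)" by (simp flip: power_add)
  then have "(v * 2 ^ e + j) div 2 ^ q = v div 2 ^ (q - e)"
    using assms by (simp add: div_mult2_eq)
  then show ?thesis using False by (simp add: bit_iff_odd)
qed

lemma definable_encode_symbol:
  fixes c :: "'i \<Rightarrow> symbol" and p j r w :: "'i \<Rightarrow> nat"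
  assumes "\<And>i. j i < 2 ^ e"
  shows "definable (\<lambda>i s. p i < length s \<and> encode_symbol e (w i) (state_at s (p i)) (s ! p i) (j i) (r i) = c i)"
proof -
  \<comment> \<open>The significance of the bit written at place \<open>r i\<close>. Its lowest
    \<open>e\<close> values come from the copy number, the others from the input integer shifted by
    \<open>e\<close>.\<close>
  let ?q = "\<lambda>i. w i - 1 - r i"
  let ?y = "\<lambda>i s. if \<not> commas s (p i) = 0 then (?q i < e \<and> bit (j i) (?q i)) \<or> (\<not> ?q i < e \<and> number_bit (p i) (?q i - e) s)
    else j i = 2 ^ e - 1 \<and> (if semis s (p i) = 0 then \<not> ?q i < e \<and> number_bit (p i) (?q i - e) s else number_bit (p i) (?q i) s)"
  have "(\<lambda>i s. p i < length s \<and> encode_symbol e (w i) (state_at s (p i)) (s ! p i) (j i) (r i) = c i) = (\<lambda>i s.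
     (symbol_at (Bit True) (p i) s \<or> symbol_at (Bit False) (p i) s) \<and> c i = Bit False \<or>
     symbol_at Semi (p i) s \<and> c i = Semi \<or>
     symbol_at Comma (p i) s \<and> ((r i = w i \<and> (if \<not> commas s (p i) = 0 \<or> j i = 2 ^ e - 1 then c i = Comma else c i = Bit False)) \<or>
       (r i \<noteq> w i \<and> (if ?y i s then c i = Bit True else c i = Bit False))))"
  proof (intro ext, goal_cases)
    case (1 i s)
    obtain k l v where st: "state_at s (p i) = (k, l, v)" by (cases "state_at s (p i)")
    show ?case
    proof (cases rule: position_symbol_cases[where s = s and p = "p i"])
      case 1
      then show ?thesis by (simp add: symbol_at_def)
    next
      case (2 x)
      then show ?thesis by (cases x) (auto simp: symbol_at_def encode_symbol_def st)
    next
      case 3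
      have y: "(if 0 < l then bit (v * 2 ^ e + j i) (?q i)
           else j i = 2 ^ e - 1 \<and> bit (if k = 0 then v * 2 ^ e else v) (?q i)) \<longleftrightarrow> ?y i s"
        using 3 bit_shift_add[OF assms, of v i "?q i"] bit_shift_add[of 0 e v "?q i"]
        by (auto simp: st number_bit_def symbol_at_def)
      have "encode_symbol e (w i) (state_at s (p i)) Comma (j i) (r i) =
          (if r i = w i then if 0 < l \<or> j i = 2 ^ e - 1 then Comma else Bit False else Bit (?y i s))"
        unfolding y[symmetric] by (simp add: encode_symbol_def st)
      then show ?thesis using 3 by (auto simp: symbol_at_def st)
    next
      case 4
      then show ?thesis by (auto simp: symbol_at_def encode_symbol_def st)
    qed
  qed
  then show ?thesis
    by (simp only:) (intro definable_intros definable_commas_eq definable_semis_eq_0 definable_number_bit)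
qed

lemma encode_string_eq:
  "encode_string e s = map (\<lambda>i. let L = 2 ^ e * Suc (length s + e) in
     encode_symbol e (length s + e) (state_at s (i div L)) (s ! (i div L)) (i mod L div Suc (length s + e))
       (i mod L mod Suc (length s + e))) [0..<length s * (2 ^ e * Suc (length s + e))]"
  unfolding encode_string_def Let_def
  by (rule scan_eq_map) (simp only: encode_chunk_def concat_map_upt)

lemma AC0_encode_string: "AC0 (\<lambda>x. bits_of (encode_string e (symbols x)))"
proof (rule AC0_symbol_function[where L = "\<lambda>n. n * (2 ^ e * Suc (n + e))" and l = "[:0, 1:] * ([:2 ^ e:] * [:Suc e, 1:])"])
  let ?L = "\<lambda>n. 2 ^ e * Suc (n + e)"
  \<comment> \<open>The string length is first an independent parameter \<open>n\<close>, so that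
    all divisions are constants of the circuit; it is set to \<open>length s\<close> only
    afterwards.\<close>
  let ?P = "\<lambda>(i :: symbol \<times> nat) n s. snd i < n * ?L n \<and> snd i div ?L n < length s \<and>
      encode_symbol e (n + e) (state_at s (snd i div ?L n)) (s ! (snd i div ?L n))
        (snd i mod ?L n div Suc (n + e)) (snd i mod ?L n mod Suc (n + e)) = fst i"
  have "definable (\<lambda>k s. ?P (fst k) (snd k) s)"
    by (intro definable_and definable_const definable_encode_symbol) (simp add: less_mult_imp_div_less)
  from definable_length[OF this]
  have "definable (\<lambda>i s. ?P i (length s) s)" .
  also have "(\<lambda>i s. ?P i (length s) s) = (\<lambda>i s. symbol_at (fst i) (snd i) (encode_string e s))"
    by (intro ext) (auto simp: symbol_at_def encode_string_eq Let_def less_mult_imp_div_less simp del: mult_Suc_right)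
  finally show "definable (\<lambda>(i :: symbol \<times> nat) s. symbol_at (fst i) (snd i) (encode_string e s))" .
next
  show "length (encode_string e s) = length s * (2 ^ e * Suc (length s + e))" for s
    by (simp add: encode_string_eq)
  show "N * (2 ^ e * Suc (N + e)) \<le> poly ([:0, 1:] * ([:2 ^ e:] * [:Suc e, 1:])) N" for N
    by (simp add: algebra_simps)
  show "mono (\<lambda>n :: nat. n * (2 ^ e * Suc (n + e)))"
    by (intro monoI mult_le_mono) auto
qed

section \<open>The theorem\<close>

lemma trivial_yes_string:
  assumes "0 < qdim C" shows "yes_strings C \<noteq> {}"
proof -
  have "enc_nats [bits_value [True]] (map Bit [True] @ Comma # [])"
    by (intro enc_nats.intros) auto
  then have "encodes_symbols (map Bit [True] @ Comma # [] @ [Semi]) (bits_value [True], [])"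
    unfolding encodes_symbols_def prod.case using enc_clauses.intros(1) by fastforce
  moreover have "bits_value [True] = 1" using bits_value_snoc[of "[]" True] by simp
  ultimately obtain s where "encodes_symbols s (1, [])" by auto
  then have "encodes (bits_of s) (1, [])" by (auto simp: encodes_iff)
  moreover have "is_instance C (1, [])" by (simp add: is_instance_def)
  moreover have "satisfiable C (1, [])"
  proof -
    let ?v = "vec (qdim C ^ 1) (\<lambda>i. if i = 0 then 1 else 0 :: complex)"
    have "?v \<bullet>c ?v = (\<Sum>i<qdim C ^ 1. if i = 0 then 1 else 0)"
      unfolding scalar_prod_def by (simp add: lessThan_atLeast0 if_distrib cong: if_cong)
    then have "?v \<in> states (qdim C) 1" using assms by (simp add: states_def)
    then show ?thesis unfolding satisfiable_def by auto
  qed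
  ultimately show ?thesis by (auto simp: yes_strings_def)
qed

text \<open>With \<open>m\<close> the outer rounded logarithm, \<open>d\<close> is at most 2 to the
  power \<open>2 ^ m\<close>, and \<open>4 * 2 ^ m - 2\<close> is at least \<open>2 ^ m\<close>: the
  factor 4 absorbs the two qubits lost to the excluding subspaces.\<close>

lemma exists_block_size:
  assumes "2 \<le> d"
  shows "d \<le> 2 ^ (4 * 2 ^ nat \<lceil>log 2 (real_of_int \<lceil>log 2 (real d)\<rceil>)\<rceil> - 2)"
proof -
  define L where "L = \<lceil>log 2 (real d)\<rceil>"
  define m where "m = nat \<lceil>log 2 (real_of_int L)\<rceil>"
  have "1 \<le> log 2 (real d)" using assms by (subst le_log_iff) auto
  then have L: "1 \<le> L" unfolding L_def by linarith
  have "log 2 (real_of_int L) \<le> real m" unfolding m_def using L by linarith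
  then have "real_of_int L \<le> 2 powr real m" using L by (subst (asm) log_le_iff) auto
  then have Lm: "real_of_int L \<le> 2 ^ m" by (simp add: powr_realpow)
  have "log 2 (real d) \<le> real_of_int L" unfolding L_def by linarith
  also note Lm
  finally have "log 2 (real d) \<le> 2 ^ m" .
  then have "real d \<le> 2 powr (2 ^ m)" using assms by (subst (asm) log_le_iff) auto
  also have "2 powr (2 ^ m) = real (2 ^ (2 ^ m))" using powr_realpow[of 2 "2 ^ m"] by simp
  finally have "d \<le> 2 ^ (2 ^ m)" by (simp only: of_nat_le_iff)
  also have "\<dots> \<le> 2 ^ (4 * 2 ^ m - 2)"
  proof (rule power_increasing)
    have "(1 :: nat) \<le> 2 ^ m" by simp
    then show "(2 :: nat) ^ m \<le> 4 * 2 ^ m - 2" by linarith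
  qed simp
  finally show ?thesis by (simp add: m_def L_def)
qed

text \<open>Inconsistent instances are decoded to a fixed unsatisfiable one, which does not exist
  here. Instead both reductions are constant maps to satisfiable instances.\<close>

lemma trivial_reduction:
  assumes C: "is_qcsp C" and no: "no_strings C = {}"
  shows "\<exists>C' f g. is_qcsp C' \<and> qdim C' = 2 \<and> is_local k C' \<and> AC0 f \<and> AC0 g \<and> reduces f C C' \<and> reduces g C' C"
proof -
  \<comment> \<open>No clause is allowed, so every energy is 0 and never reaches the gap 1: all
    instances are satisfiable.\<close>
  define C' where "C' = \<lparr>qdim = 2, ctypes = [], count_poly = 0, gap_poly = 1\<rparr>"
  obtain y where y: "y \<in> yes_strings C" using trivial_yes_string[of C] C by (auto simp: is_qcsp_def)
  obtain y' where y': "y' \<in> yes_strings C'" using trivial_yes_string[of C'] by (auto simp: C'_def)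
  have "no_strings C' = {}"
  proof -
    have "\<not> unsatisfiable C' (n, cs)" if I: "is_instance C' (n, cs)" for n cs
    proof
      assume U: "unsatisfiable C' (n, cs)"
      have "cs = []" using I by (simp add: is_instance_def C'_def)
      then have sum: "(\<Sum>c\<leftarrow>cs. Re ((clause_op C' n c *\<^sub>v \<psi>) \<bullet>c \<psi>)) = 0" for \<psi> by simp
      let ?v = "vec (2 ^ n) (\<lambda>i. if i = 0 then 1 else 0 :: complex)"
      have "?v \<bullet>c ?v = (\<Sum>i<(2 :: nat) ^ n. if i = 0 then 1 else 0)"
        unfolding scalar_prod_def by (simp add: lessThan_atLeast0 if_distrib cong: if_cong)
      then have "?v \<in> states 2 n" by (simp add: states_def)
      then show False using U sum unfolding unsatisfiable_def prod.case by (fastforce simp: C'_def)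
    qed
    then show ?thesis by (auto simp: no_strings_def)
  qed
  then show ?thesis using y y' no
    by (intro exI[of _ C'] exI[of _ "\<lambda>_. y'"] exI[of _ "\<lambda>_. y"])
       (auto simp: C'_def is_qcsp_def is_local_def reduces_def AC0_const)
qed

context qubit_code
begin

lemma reduces_encode:
  assumes "b = 2 ^ e" shows "reduces (\<lambda>x. bits_of (encode_string e (symbols x))) C qubit_qcsp"
proof -
  have enc: "encodes (bits_of (encode_string e (symbols x))) (b * n, map (encode_clause b) cs)"
    if x: "encodes x (n, cs)" for x n cs
  proof -
    obtain s where s: "encodes_symbols s (n, cs)" "x = bits_of s" using x by (auto simp: encodes_iff)
    then show ?thesis
      unfolding encodes_iff assms s(2) symbols_bits_of using encode_string_encodes[OF s(1)] by blast
  qed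
  show ?thesis
    unfolding reduces_def yes_strings_def no_strings_def
  proof (intro conjI subsetI; elim imageE; clarify)
    fix x n cs assume "encodes x (n, cs)" "is_instance C (n, cs)" "satisfiable C (n, cs)"
    then show "\<exists>I. encodes (bits_of (encode_string e (symbols x))) I \<and> is_instance qubit_qcsp I \<and> satisfiable qubit_qcsp I"
      using enc encode_instance by blast
  next
    fix x n cs assume "encodes x (n, cs)" "is_instance C (n, cs)" "unsatisfiable C (n, cs)"
    then show "\<exists>I. encodes (bits_of (encode_string e (symbols x))) I \<and> is_instance qubit_qcsp I \<and> unsatisfiable qubit_qcsp I"
      using enc encode_instance by blast
  qed
qed

text \<open>Satisfiable instances are consistent, so only instances that are unsatisfiable or
  outside the promise are ever replaced by \<open>y\<close>.\<close>

lemma reduces_decode: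
  assumes k: "is_local k C" and y: "bits_of y \<in> no_strings C"
  shows "reduces (\<lambda>x. bits_of (decode_or y b (b * k) (symbols x))) qubit_qcsp C"
proof -
  have lengths: "\<forall>(t, qs)\<in>set cs. b dvd length qs \<and> length qs \<le> b * k \<and> distinct qs"
    if I: "is_instance qubit_qcsp (n, cs)" for n cs
  proof (clarify, intro conjI)
    fix t qs assume "(t, qs) \<in> set cs"
    then have c: "t < length (ctypes C)" "length qs = b * fst (ctypes C ! t)" "distinct qs"
      using I by (auto simp: is_instance_def is_clause_def ctypes_qubit_qcsp)
    have "fst (ctypes C ! t) \<le> k" using k nth_mem[OF c(1)] by (auto simp: is_local_def case_prod_unfold)
    then show "b dvd length qs" "length qs \<le> b * k" "distinct qs" using c by auto
  qed
  have dec: "encodes (bits_of (decode_or y b (b * k) (symbols x))) (n, map (decode_clause b) cs)"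
    if x: "encodes x (n, cs)" "is_instance qubit_qcsp (n, cs)" "consistent b cs" for x n cs
  proof -
    obtain s where s: "encodes_symbols s (n, cs)" "x = bits_of s" using x(1) by (auto simp: encodes_iff)
    have "consistent_string b (b * k) s"
      using consistent_string_iff[OF s(1) _ lengths[OF x(2)]] x(3) b by simp
    moreover have "encodes_symbols (decode_string b (b * k) s @ replicate (length y) Semi) (n, map (decode_clause b) cs)"
      using decode_string_encodes[OF s(1), of b "b * k"] lengths[OF x(2)] b
      by (intro encodes_symbols_pad) auto
    ultimately show ?thesis unfolding encodes_iff by (auto simp: s(2) decode_or_def)
  qed
  have no: "bits_of (decode_or y b (b * k) (symbols x)) \<in> no_strings C"
    if x: "encodes x (n, cs)" "is_instance qubit_qcsp (n, cs)" "\<not> consistent b cs" for x n cs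
  proof -
    obtain s where s: "encodes_symbols s (n, cs)" "x = bits_of s" using x(1) by (auto simp: encodes_iff)
    have ncon: "\<not> consistent_string b (b * k) s"
      using consistent_string_iff[OF s(1) _ lengths[OF x(2)]] x(3) b by simp
    obtain I where I: "encodes (bits_of y) I" "is_instance C I" "unsatisfiable C I"
      using y by (auto simp: no_strings_def)
    then obtain y' where "encodes_symbols y' I" "bits_of y = bits_of y'" by (auto simp: encodes_iff)
    then have "encodes_symbols y I" using symbols_bits_of by metis
    then have "encodes (bits_of (y @ replicate (length s) Semi)) I"
      unfolding encodes_iff using encodes_symbols_pad by blast
    moreover have "decode_or y b (b * k) (symbols x) = y @ replicate (length s) Semi"
      using ncon by (simp add: decode_or_def s(2))
    ultimately show ?thesis using I(2,3) unfolding no_strings_def by (simp only: mem_Collect_eq) blast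
  qed
  show ?thesis
    unfolding reduces_def
  proof (intro conjI image_subsetI)
    fix x assume "x \<in> yes_strings qubit_qcsp"
    then obtain n cs where I: "encodes x (n, cs)" "is_instance qubit_qcsp (n, cs)" "satisfiable qubit_qcsp (n, cs)"
      by (auto simp: yes_strings_def)
    have con: "consistent b cs" by (rule satisfiable_consistent[OF I(2,3)])
    show "bits_of (decode_or y b (b * k) (symbols x)) \<in> yes_strings C"
      unfolding yes_strings_def using dec[OF I(1,2) con] decode_instance[OF I(2) con] I(3) by blast
  next
    fix x assume "x \<in> no_strings qubit_qcsp"
    then obtain n cs where I: "encodes x (n, cs)" "is_instance qubit_qcsp (n, cs)" "unsatisfiable qubit_qcsp (n, cs)"
      by (auto simp: no_strings_def)
    show "bits_of (decode_or y b (b * k) (symbols x)) \<in> no_strings C"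
    proof (cases "consistent b cs")
      case True
      then show ?thesis
        unfolding no_strings_def using dec[OF I(1,2)] decode_instance[OF I(2)] I(3) by blast
    qed (rule no[OF I(1,2)])
  qed
qed

end

theorem theorem5:
  fixes C :: qcsp and k :: nat
  assumes "is_qcsp C" and "qdim C \<ge> 2" and "is_local k C"
  shows "\<exists>(C' :: qcsp) (f :: bool list \<Rightarrow> bool list) (g :: bool list \<Rightarrow> bool list).
           is_qcsp C' \<and> qdim C' = 2 \<and>
           is_local (4 * 2 ^ nat \<lceil>log 2 (real_of_int \<lceil>log 2 (real (qdim C))\<rceil>)\<rceil> * k) C' \<and>
           AC0 f \<and> AC0 g \<and> reduces f C C' \<and> reduces g C' C"
proof (cases "no_strings C = {}")
  case True
  then show ?thesis by (rule trivial_reduction[OF assms(1)])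
next
  case False
  \<comment> \<open>The summand 2 is the exponent of the factor 4; \<open>e\<close> is the number of
    bits appended to a qudit number.\<close>
  define e where "e = nat \<lceil>log 2 (real_of_int \<lceil>log 2 (real (qdim C))\<rceil>)\<rceil> + 2"
  define b :: nat where "b = 2 ^ e"
  have b_eq: "b = 4 * 2 ^ nat \<lceil>log 2 (real_of_int \<lceil>log 2 (real (qdim C))\<rceil>)\<rceil>" by (simp add: b_def e_def power_add)
  have d: "qdim C \<le> 2 ^ (b - 2)" unfolding b_eq by (rule exists_block_size[OF assms(2)])
  have b2: "2 \<le> b" unfolding b_def e_def by (simp add: power_add)
  obtain S :: "complex mat" and E where S: "\<And>\<kappa>. \<kappa> \<in> conflicts b \<Longrightarrow> separates S \<kappa>"
    and E: "\<And>y y'. y < qdim C \<Longrightarrow> y' < qdim C \<Longrightarrow> (\<Sum>x<2 ^ b. cnj (E x y) * E x y') = of_bool (y = y')"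
    "\<And>y r. y < qdim C \<Longrightarrow> r < 2 ^ b \<Longrightarrow> (\<Sum>x<2 ^ b. S $$ (r, x) * E x y) = 0"
    by (rule exists_monogamous_code[OF b2 d]) (rule that)
  interpret qubit_code E "qdim C" b S C
    by standard (use assms E S b2 in auto)
  obtain x where x: "x \<in> no_strings C" using False by blast
  then obtain y where y: "bits_of y \<in> no_strings C" by (auto simp: no_strings_def encodes_iff)
  show ?thesis
    unfolding b_eq[symmetric]
    using is_qcsp_qubit_qcsp is_local_qubit_qcsp[OF assms(3)] AC0_encode_string AC0_decode_or
      reduces_encode[OF b_def] reduces_decode[OF assms(3) y] qubit_qcsp_simps(1) by blast
qed

end
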